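(* Let $(X,d)$ be a separable metric space, $\mu$ a finite Borel measure on $X$ such that Vitali's covering theorem is valid for $\mu$ and the family of closed balls, and let $K\colon \{(x,y)\in X\times X: x\neq y\}\to\mathbb{R}$ be a Borel measurable kernel that is antisymmetric, i.e. $K(x,y)=-K(y,x)$ for all $x\neq y$, and bounded on $\{(x,y)\in X\times X: d(x,y)>\delta\}$ for every $\delta>0$. Suppose that $X=\mathbb{R}^n$ (with the Euclidean metric) or that $\mu$ is doubling. Let $h\colon(0,\infty)\to(0,\infty)$ be an increasing function such that $\lim_{r\to0}h(r)=0$ and, for some constant $C$, $h(2r)\le C h(r)$ for all $r>0$. Suppose that for all $x,y\in X$ with $x\neq y$, $$|K(x,y)|\le\frac{1}{h(d(x,y))},$$ and for all $x,y,z\in X$ with $x\ne y$, $z\neq x$ and $d(x,y)>2d(y,z)$, $$|K(x,y)-K(x,z)|\le\frac{d(y,z)}{d(x,y)\,h(d(x,y))}.$$ Suppose also that $$\mu(B(x,r))\le h(r)\quad\text{for all } x\in X,\ r>0,$$ and that $$\lim_{r\to0}\frac{\mu(B(x,r))}{h(r)}=0\quad\text{for } \mu \text{ almost all } x\in X.$$ For $\epsilon>0$ and $f\in L^1(\mu)$ put $$T_{\epsilon}(f)(x)=\int_{X\setminus B(x,\epsilon)}K(x,y)f(y)\,d\mu(y),\qquad T^{\ast}(f)(x)=\sup_{\epsilon>0}|T_{\epsilon}(f)(x)|.$$ If $T^{\ast}\colon L^2(\mu)\to L^2(\mu)$ is bounded, i.e. there is a constant $C_0$ with $\int T^{\ast}(f)^2\,d\mu\le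 C_0\int f^2\,d\mu$ for all $f\in L^2(\mu)$, then for every $f\in L^1(\mu)$ and for $\mu$ almost all $x\in X$, $$\lim_{\epsilon\to0}T_{\epsilon}(f)(x)=T(f)(x),$$ where $T$ is the weak limit operator of the $T_\epsilon$ on $L^2(\mu)$, extended to $L^1(\mu)$ (as described in the context).
   Context: $B(x,r)=\{y\in X: d(x,y)<r\}$ denotes the open ball with centre $x$ and radius $r$. Functions are real-valued. "Vitali's covering theorem is valid for $\mu$ and the family of closed balls" means: whenever $A\subset X$ and $\mathcal{F}$ is a family of closed balls such that every point of $A$ is the centre of balls in $\mathcal{F}$ of arbitrarily small radii, there is a countable disjoint subfamily of $\mathcal{F}$ whose union covers $\mu$ almost all of $A$. (This holds if $X=\mathbb{R}^n$ or $\mu$ is doubling.) "$\mu$ is doubling" means that there is a constant $C'$ with $\mu(B(x,2r))\le C'\mu(B(x,r))$ for all $x\in X$ and $r>0$. The operator $T$: when $T^{\ast}$ is bounded in $L^2(\mu)$, the operators $T_\epsilon$ converge weakly in $L^2(\mu)$ to a bounded linear operator $T\colon L^2(\mu)\to L^2(\mu)$, that is, $\lim_{\epsilon\to0}\int T_\epsilon(f)g\,d\mu=\int T(f)g\,d\mu$ for all $f,g\in L^2(\mu)$. Under the hypotheses of the theorem one has the known weak type inequality $\mu(\{x\in X: T^{\ast}(f)(x)>t\})\le C''\|f\|_{L^1(\mu)}/t$ for all $t>0$ and $f\in L^1(\mu)$ (Coifman–Weiss for doubling measures in metric spaces; Nazarov–Treil–Volberg for general measures in $\mathbb{R}^n$),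 and $T$ has a unique extension to $L^1(\mu)$ by means of it: for $f\in L^1(\mu)$, $T(f)$ is the limit in $\mu$-measure of $T(f_k)$ for any sequence $f_k\in L^2(\mu)$ with $f_k\to f$ in $L^1(\mu)$. *)

theory Defs
  imports "HOL-Analysis.Analysis"
begin

text \<open>Separable metric spaces are rendered by the sort
  \<open>{metric_space, second_countable_topology}\<close>: a metric space is separable iff its topology
  is second countable, and it is the latter for which the library provides a type class.\<close>

definition L2 :: "'a measure \<Rightarrow> ('a \<Rightarrow> real) set" where
  "L2 \<mu> = {f \<in> borel_measurable \<mu>. integrable \<mu> (\<lambda>x. (f x)\<^sup>2)}"

definition doubling_measure :: "'a::metric_space measure \<Rightarrow> bool" where
  "doubling_measure \<mu> \<longleftrightarrow>
     (\<exists>C'. \<forall>x r. r > 0 \<longrightarrow> measure \<mu> (ball x (2 * r)) \<le> C' * measure \<mu> (ball x r))"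

text \<open>The set \<open>A\<close> is arbitrary, not necessarily measurable: \<open>AE\<close> only asks for the
  uncovered part of \<open>A\<close> to be contained in a null set.\<close>

definition vitali_closed_balls :: "'a::metric_space measure \<Rightarrow> bool" where
  "vitali_closed_balls \<mu> \<longleftrightarrow>
     (\<forall>A F. F \<subseteq> {cball x r | x r. r > 0} \<and>
            (\<forall>a\<in>A. \<forall>\<delta>>0. \<exists>r. 0 < r \<and> r < \<delta> \<and> cball a r \<in> F) \<longrightarrow>
        (\<exists>G\<subseteq>F. countable G \<and> disjoint G \<and> (AE x in \<mu>. x \<in> A \<longrightarrow> x \<in> \<Union>G)))"

text \<open>A kernel is a total function \<open>'a \<Rightarrow> 'a \<Rightarrow> real\<close>; its values on the diagonal are irrelevant,
  since \<open>T\<^sub>\<epsilon>\<close> integrates only over points at distance at least \<open>\<epsilon> > 0\<close>.\<close>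

definition truncated_op ::
    "'a::metric_space measure \<Rightarrow> ('a \<Rightarrow> 'a \<Rightarrow> real) \<Rightarrow> real \<Rightarrow> ('a \<Rightarrow> real) \<Rightarrow> 'a \<Rightarrow> real" where
  "truncated_op \<mu> K \<epsilon> f x = (LINT y : UNIV - ball x \<epsilon> | \<mu>. K x y * f y)"

definition maximal_op ::
    "'a::metric_space measure \<Rightarrow> ('a \<Rightarrow> 'a \<Rightarrow> real) \<Rightarrow> ('a \<Rightarrow> real) \<Rightarrow> 'a \<Rightarrow> ennreal" where
  "maximal_op \<mu> K f x = (SUP \<epsilon>\<in>{0<..}. ennreal \<bar>truncated_op \<mu> K \<epsilon> f x\<bar>)"

definition maximal_op_L2_bounded ::
    "'a::metric_space measure \<Rightarrow> ('a \<Rightarrow> 'a \<Rightarrow> real) \<Rightarrow> bool" where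
  "maximal_op_L2_bounded \<mu> K \<longleftrightarrow>
     (\<exists>C\<^sub>0::real. \<forall>f\<in>L2 \<mu>.
        (\<integral>\<^sup>+x. (maximal_op \<mu> K f x)\<^sup>2 \<partial>\<mu>) \<le> ennreal (C\<^sub>0 * (\<integral>x. (f x)\<^sup>2 \<partial>\<mu>)))"

text \<open>Operators on \<open>L\<^sup>2\<close> act on representatives, so linearity is only required almost everywhere.
  Together with the norm bound it makes such an operator respect equality almost everywhere.\<close>

definition bounded_linear_L2 :: "'a measure \<Rightarrow> (('a \<Rightarrow> real) \<Rightarrow> 'a \<Rightarrow> real) \<Rightarrow> bool" where
  "bounded_linear_L2 \<mu> T \<longleftrightarrow>
     (\<forall>f\<in>L2 \<mu>. T f \<in> L2 \<mu>) \<and>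
     (\<forall>f\<in>L2 \<mu>. \<forall>g\<in>L2 \<mu>. AE x in \<mu>. T (\<lambda>y. f y + g y) x = T f x + T g x) \<and>
     (\<forall>f\<in>L2 \<mu>. \<forall>c. AE x in \<mu>. T (\<lambda>y. c * f y) x = c * T f x) \<and>
     (\<exists>B. \<forall>f\<in>L2 \<mu>. (\<integral>x. (T f x)\<^sup>2 \<partial>\<mu>) \<le> B * (\<integral>x. (f x)\<^sup>2 \<partial>\<mu>))"

definition is_weak_limit_op ::
    "'a::metric_space measure \<Rightarrow> ('a \<Rightarrow> 'a \<Rightarrow> real) \<Rightarrow> (('a \<Rightarrow> real) \<Rightarrow> 'a \<Rightarrow> real) \<Rightarrow> bool" where
  "is_weak_limit_op \<mu> K T \<longleftrightarrow>
     bounded_linear_L2 \<mu> T \<and>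
     (\<forall>f\<in>L2 \<mu>. \<forall>g\<in>L2 \<mu>.
        ((\<lambda>\<epsilon>. \<integral>x. truncated_op \<mu> K \<epsilon> f x * g x \<partial>\<mu>) \<longlongrightarrow> (\<integral>x. T f x * g x \<partial>\<mu>)) (at_right 0))"

text \<open>The weak limit is unique up to equality almost everywhere of the functions \<open>T f\<close>, so the
  choice below only picks representatives (when a weak limit exists).\<close>

definition weak_limit_op ::
    "'a::metric_space measure \<Rightarrow> ('a \<Rightarrow> 'a \<Rightarrow> real) \<Rightarrow> ('a \<Rightarrow> real) \<Rightarrow> 'a \<Rightarrow> real" where
  "weak_limit_op \<mu> K = (SOME T. is_weak_limit_op \<mu> K T)"

definition tendsto_in_measure ::
    "'a measure \<Rightarrow> (nat \<Rightarrow> 'a \<Rightarrow> real) \<Rightarrow> ('a \<Rightarrow> real) \<Rightarrow> bool" where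
  "tendsto_in_measure \<mu> u g \<longleftrightarrow>
     (\<forall>\<delta>>0. (\<lambda>k. measure \<mu> {x \<in> space \<mu>. \<bar>u k x - g x\<bar> > \<delta>}) \<longlonglongrightarrow> 0)"

definition is_L1_extension_value ::
    "'a measure \<Rightarrow> (('a \<Rightarrow> real) \<Rightarrow> 'a \<Rightarrow> real) \<Rightarrow> ('a \<Rightarrow> real) \<Rightarrow> ('a \<Rightarrow> real) \<Rightarrow> bool" where
  "is_L1_extension_value \<mu> T f g \<longleftrightarrow>
     g \<in> borel_measurable \<mu> \<and>
     (\<forall>u. (\<forall>k. u k \<in> L2 \<mu> \<and> integrable \<mu> (u k)) \<and> (\<lambda>k. \<integral>x. \<bar>u k x - f x\<bar> \<partial>\<mu>) \<longlonglongrightarrow> 0 \<longrightarrow>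
        tendsto_in_measure \<mu> (\<lambda>k. T (u k)) g)"

text \<open>The operator \<open>T\<close> extended to \<open>L\<^sup>1\<close>. For finite \<open>\<mu>\<close>, \<open>L\<^sup>2\<close> is dense in \<open>L\<^sup>1\<close>, and limits in
  measure are unique up to equality almost everywhere, so here too only a representative is
  chosen (when the limit exists).\<close>

definition singular_integral_op ::
    "'a::metric_space measure \<Rightarrow> ('a \<Rightarrow> 'a \<Rightarrow> real) \<Rightarrow> ('a \<Rightarrow> real) \<Rightarrow> 'a \<Rightarrow> real" where
  "singular_integral_op \<mu> K f = (SOME g. is_L1_extension_value \<mu> (weak_limit_op \<mu> K) f g)"

end

theory Submission
  imports Defs
begin

text \<open>
  All averages are taken at scales \<open>R\<close> that are doubling at the point in question,
  \<open>\<mu> (B(x, 32 R)) \<le> D * \<mu> (B(x, R))\<close>, where \<open>D\<close> exceeds the growth of \<open>h\<close>. Between such scales the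
  truncations hardly change, because the measures of the balls grow geometrically faster than \<open>h\<close>.

  The truncations are of weak type \<open>(1,1)\<close> by the argument of Guy David and Nazarov, Treil and
  Volberg: the part of \<open>f\<close> above height \<open>t\<close> is swept to a density of height at most \<open>t\<close>, and the
  error near the swept pieces is estimated by duality from the \<open>L\<^sup>2\<close> bound for the maximal
  operator. Cotlar's inequality transfers the weak type bound to the maximal operator, so that it
  suffices to prove convergence for bounded Lipschitz \<open>f\<close>. There
  \<open>T\<^sub>\<epsilon> f(x) - f(x) T\<^sub>\<epsilon> 1(x)\<close> converges absolutely, which leaves \<open>f = 1\<close>. By antisymmetry
  \<open>\<integral>\<phi> T\<^sub>\<epsilon> 1\<close> has a limit for Lipschitz \<open>\<phi>\<close>; testing with a bump \<open>\<phi>\<close> at a doubling scale \<open>R\<close>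
  around \<open>x\<close> recovers \<open>T\<^sub>R 1(x)\<close>, the error tending to zero with the density of \<open>\<mu>\<close> relative to
  \<open>h\<close>, and the limit functional can be differentiated almost everywhere along doubling scales.

  The weak limit is then the pointwise limit, by dominated convergence.
\<close>

text \<open>The obstacle is that balls with the same centre and comparable radii need not have
  comparable measures, while every covering argument dilates balls. Hence the maximal function
  carries a dilated ball in its denominator, and the loss is recovered only at scales that are
  doubling at the point.

  Antisymmetry supplies the cancellation. It exchanges the two factors of a pairing at the cost of a
  sign, so that the integral of \<open>\<phi> * T \<epsilon> 1\<close> is half a double integral of
  \<open>K x y * (\<phi> x - \<phi> y)\<close>, which is no longer singular.

  Vanishing density supplies the smallness. It is made uniform, at level \<eta> and up to a fixed
  scale, outside a set N of small measure. Points near which N has relatively large mass are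
  discarded as well, because the tests with bumps average over balls that may meet N. All errors are
  then multiples of \<eta>.

  The exceptional sets involve all radii or all truncations at once; they are estimated through
  measurable covers.\<close>

section \<open>Coverings and the maximal function\<close>

text \<open>Greedy choice: take a ball of largest radius, discard all balls that meet it, since they
  lie in its threefold dilation, and recurse on the rest.\<close>

lemma finite_vitali_covering:
  fixes I :: "('a::metric_space \<times> real) set"
  assumes "finite I"
  shows "\<exists>J\<subseteq>I. pairwise (\<lambda>p q. disjnt (ball (fst p) (snd p)) (ball (fst q) (snd q))) J
     \<and> (\<Union>p\<in>I. ball (fst p) (snd p)) \<subseteq> (\<Union>p\<in>J. ball (fst p) (3 * snd p))"
  using assms
proof (induction "card I" arbitrary: I rule: less_induct)
  case (less I)
  show ?case
  proof (cases "I = {}")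
    case False
    define R where "R = Max (snd ` I)"
    have "R \<in> snd ` I"
      unfolding R_def using less.prems False by (intro Max_in) auto
    then obtain p where p: "p \<in> I" "snd p = R" by auto
    have le: "snd q \<le> R" if "q \<in> I" for q
      unfolding R_def using less.prems that by (intro Max_ge) auto
    \<comment> \<open>A ball of nonpositive radius is empty and disjoint from itself, so
      \<open>p\<close> has to be excluded explicitly for the cardinality to drop.\<close>
    define I' where "I' = {q\<in>I. q \<noteq> p \<and> disjnt (ball (fst q) (snd q)) (ball (fst p) (snd p))}"
    have "I' \<subset> I" using p(1) by (auto simp: I'_def)
    then have "card I' < card I" using less.prems by (simp add: psubset_card_mono)
    moreover have "finite I'" using less.prems by (simp add: I'_def)
    ultimately obtain J where J: "J \<subseteq> I'"
      "pairwise (\<lambda>p q. disjnt (ball (fst p) (snd p)) (ball (fst q) (snd q))) J"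
      "(\<Union>p\<in>I'. ball (fst p) (snd p)) \<subseteq> (\<Union>p\<in>J. ball (fst p) (3 * snd p))"
      using less.hyps by blast
    show ?thesis
    proof (intro exI[of _ "insert p J"] conjI)
      show "insert p J \<subseteq> I" using J(1) p(1) by (auto simp: I'_def)
      show "pairwise (\<lambda>p q. disjnt (ball (fst p) (snd p)) (ball (fst q) (snd q))) (insert p J)"
        using J(1,2) by (auto simp: pairwise_insert I'_def disjnt_sym)
      show "(\<Union>q\<in>I. ball (fst q) (snd q)) \<subseteq> (\<Union>q\<in>insert p J. ball (fst q) (3 * snd q))"
      proof
        fix z assume "z \<in> (\<Union>q\<in>I. ball (fst q) (snd q))"
        then obtain q where q: "q \<in> I" "dist (fst q) z < snd q" by auto
        show "z \<in> (\<Union>q\<in>insert p J. ball (fst q) (3 * snd q))"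
        proof (cases "q \<in> I'")
          case True
          then have "z \<in> (\<Union>p\<in>I'. ball (fst p) (snd p))" using q by auto
          then have "z \<in> (\<Union>p\<in>J. ball (fst p) (3 * snd p))" by (rule subsetD[OF J(3)])
          then show ?thesis by (simp only: UN_insert Un_iff simp_thms)
        next
          case False
          have "\<exists>y. dist (fst q) y < snd q \<and> dist (fst p) y < snd p"
          proof (cases "q = p")
            case True then show ?thesis using q by blast
          next
            case False
            then show ?thesis using \<open>q \<notin> I'\<close> q(1) by (auto simp: I'_def disjnt_def)
          qed
          then obtain y where y: "dist (fst q) y < snd q" "dist (fst p) y < snd p" by blast
          have "dist (fst p) z \<le> dist (fst p) y + dist (fst q) y + dist (fst q) z"
            using dist_triangle[of "fst p" z y] dist_triangle[of y z "fst q"]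
            by (simp add: dist_commute)
          also have "\<dots> < 3 * snd p" using y q le[OF q(1)] p(2) by linarith
          finally show ?thesis by auto
        qed
      qed
    qed
  qed auto
qed

section \<open>Outer measure estimates for sets not known to be measurable\<close>

definition outer_le :: "'a measure \<Rightarrow> 'a set \<Rightarrow> real \<Rightarrow> bool" where
  "outer_le M S a \<longleftrightarrow> (\<exists>N\<in>sets M. S \<subseteq> N \<and> measure M N \<le> a)"

context finite_measure
begin

lemma outer_le_mono: "outer_le M S a \<Longrightarrow> S' \<subseteq> S \<Longrightarrow> a \<le> b \<Longrightarrow> outer_le M S' b"
  unfolding outer_le_def by (meson order_trans)

lemma outer_le_sets: "N \<in> sets M \<Longrightarrow> S \<subseteq> N \<Longrightarrow> measure M N \<le> a \<Longrightarrow> outer_le M S a"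
  unfolding outer_le_def by blast

lemma outer_le_Un:
  assumes "outer_le M S a" "outer_le M S' b"
  shows "outer_le M (S \<union> S') (a + b)"
proof -
  from assms obtain N N' where "N \<in> sets M" "S \<subseteq> N" "measure M N \<le> a"
    "N' \<in> sets M" "S' \<subseteq> N'" "measure M N' \<le> b"
    unfolding outer_le_def by blast
  then show ?thesis
    using measure_subadditive[of N M N'] by (intro outer_le_sets[of "N \<union> N'"]) auto
qed

text \<open>The covers \<open>N n\<close> need not increase, but the tail intersections
  \<open>N' n\<close> do; they still contain \<open>S n\<close> because \<open>S\<close> increases,
  and continuity from below applies to them.\<close>

lemma outer_le_incseq:
  assumes "\<And>n. outer_le M (S n) a" "incseq S"
  shows "outer_le M (\<Union>n. S n) a"
proof -
  from assms(1) have "\<forall>n. \<exists>N\<in>sets M. S n \<subseteq> N \<and> measure M N \<le> a" by (auto simp: outer_le_def)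
  then obtain N where N: "\<And>n. N n \<in> sets M" "\<And>n. S n \<subseteq> N n" "\<And>n. measure M (N n) \<le> a"
    by metis
  define N' where "N' n = (\<Inter>m\<in>{n..}. N m)" for n
  have N'm: "N' n \<in> sets M" for n
    unfolding N'_def using N(1) by (intro sets.countable_INT) auto
  have inc: "incseq N'" by (auto simp: incseq_def N'_def)
  have "(\<lambda>n. measure M (N' n)) \<longlonglongrightarrow> measure M (\<Union>n. N' n)"
    using N'm inc by (intro finite_Lim_measure_incseq) auto
  moreover have "measure M (N' n) \<le> a" for n
    using finite_measure_mono[of "N' n" "N n"] N(1,3) by (force simp: N'_def intro: order_trans)
  ultimately have le: "measure M (\<Union>n. N' n) \<le> a"
    by (intro LIMSEQ_le_const2) auto
  have "S n \<subseteq> N' n" for n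
  proof -
    have "S n \<subseteq> N m" if "n \<le> m" for m
      using incseqD[OF assms(2) that] N(2)[of m] by auto
    then show ?thesis by (auto simp: N'_def)
  qed
  then have "(\<Union>n. S n) \<subseteq> (\<Union>n. N' n)" by blast
  then show ?thesis using le N'm by (intro outer_le_sets[of "\<Union>n. N' n"]) auto
qed

lemma AE_outer_le:
  assumes "\<And>e. e > 0 \<Longrightarrow> outer_le M {x\<in>space M. \<not> P x} e"
  shows "AE x in M. P x"
proof -
  have "\<forall>n::nat. \<exists>N\<in>sets M. {x\<in>space M. \<not> P x} \<subseteq> N \<and> measure M N \<le> 1 / Suc n"
    using assms unfolding outer_le_def by simp
  then obtain N where N: "\<And>n. N n \<in> sets M" "\<And>n. {x\<in>space M. \<not> P x} \<subseteq> N n"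
    "\<And>n::nat. measure M (N n) \<le> 1 / Suc n"
    by metis
  have I: "(\<Inter>n. N n) \<in> sets M" using N(1) by auto
  have "measure M (\<Inter>n. N n) \<le> 1 / Suc n" for n
    using finite_measure_mono[of "\<Inter>n. N n" "N n"] N(1) N(3)[of n] by (force intro: order_trans)
  then have "measure M (\<Inter>n. N n) \<le> 0"
    using LIMSEQ_inverse_real_of_nat
    by (intro LIMSEQ_le_const[where X="\<lambda>n. inverse (real (Suc n))"]) (auto simp: divide_inverse)
  then have "emeasure M (\<Inter>n. N n) = 0"
    by (metis emeasure_eq_measure ennreal_0 measure_nonneg order_antisym)
  moreover have "{x\<in>space M. \<not> P x} \<subseteq> (\<Inter>n. N n)" using N(2) by blast
  ultimately show ?thesis using I by (intro AE_I)
qed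

lemma outer_le_AE:
  assumes "AE x in M. x \<notin> S" "S \<subseteq> space M" "a \<ge> 0"
  shows "outer_le M S a"
proof -
  from AE_E[OF assms(1)] obtain N where
    "{x \<in> space M. \<not> x \<notin> S} \<subseteq> N" "emeasure M N = 0" "N \<in> sets M" by blast
  then show ?thesis using assms by (intro outer_le_sets[of N]) (auto simp: measure_def)
qed

end

text \<open>Lindelof reduces the balls to countably many, the finite Vitali lemma reduces each
  finite subfamily to a disjoint one, and continuity from below recovers the whole union. The
  selection property \<open>P\<close> is left open so that one covering argument serves the maximal
  function, the support of the measure and the maximal inequality for functionals.\<close>

lemma outer_le_of_ball_cover:
  fixes M :: "'a::{metric_space,second_countable_topology} measure"
  assumes "finite_measure M" and sets: "sets M = sets borel"
    and P: "\<And>x. x \<in> S \<Longrightarrow> \<exists>r>0. P x r"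
    and fin: "\<And>I. finite I \<Longrightarrow> (\<And>x r. (x, r) \<in> I \<Longrightarrow> r > 0 \<and> P x r) \<Longrightarrow>
        pairwise (\<lambda>p q. disjnt (ball (fst p) (snd p)) (ball (fst q) (snd q))) I \<Longrightarrow>
        (\<Sum>p\<in>I. measure M (ball (fst p) (3 * snd p))) \<le> a"
  shows "outer_le M S a"
proof -
  interpret finite_measure M by fact
  define F where "F = (\<lambda>p. ball (fst p) (snd p)) ` {(x, r). x \<in> S \<and> r > 0 \<and> P x r}"
  have "\<And>A. A \<in> F \<Longrightarrow> open A" by (auto simp: F_def)
  from Lindelof[OF this] obtain F' where F': "F' \<subseteq> F" "countable F'" "\<Union>F' = \<Union>F" by blast
  have SF: "S \<subseteq> \<Union>F'" unfolding F'(3) F_def using P by fastforce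
  show ?thesis
  proof (cases "F' = {}")
    case True
    then have "S = {}" using SF by auto
    moreover have "0 \<le> a" using fin[of "{}"] by simp
    ultimately show ?thesis by (intro outer_le_sets[of "{}"]) auto
  next
    case False
    define A where "A = from_nat_into F'"
    have A: "A n \<in> F" for n unfolding A_def using from_nat_into[OF False] F'(1) by blast
    then obtain p where p: "\<And>n. A n = ball (fst (p n)) (snd (p n))"
      "\<And>n. snd (p n) > 0 \<and> P (fst (p n)) (snd (p n))"
    proof -
      have "\<forall>n. \<exists>p. A n = ball (fst p) (snd p) \<and> snd p > 0 \<and> P (fst p) (snd p)"
      proof
        fix n
        obtain q where "q \<in> {(x, r). x \<in> S \<and> r > 0 \<and> P x r}" "A n = ball (fst q) (snd q)"
          using A[of n] unfolding F_def by (rule imageE)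
        then show "\<exists>p. A n = ball (fst p) (snd p) \<and> snd p > 0 \<and> P (fst p) (snd p)"
          by (intro exI[of _ q]) (auto simp: case_prod_beta)
      qed
      then show ?thesis using that by metis
    qed
    define U where "U n = (\<Union>i<n. A i)" for n :: nat
    have Um: "U n \<in> sets M" for n using p(1) by (auto simp: U_def sets)
    have "(\<lambda>n. measure M (U n)) \<longlonglongrightarrow> measure M (\<Union>n. U n)"
      using Um by (intro finite_Lim_measure_incseq) (auto simp: U_def incseq_def intro: order_less_le_trans)
    moreover have "measure M (U n) \<le> a" for n
    proof -
      obtain J where J: "J \<subseteq> p ` {..<n}"
        "pairwise (\<lambda>p q. disjnt (ball (fst p) (snd p)) (ball (fst q) (snd q))) J"
        "(\<Union>p\<in>p ` {..<n}. ball (fst p) (snd p)) \<subseteq> (\<Union>p\<in>J. ball (fst p) (3 * snd p))"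
        using finite_vitali_covering[of "p ` {..<n}"] by auto
      have fJ: "finite J" using J(1) finite_subset by blast
      have "measure M (U n) \<le> measure M (\<Union>p\<in>J. ball (fst p) (3 * snd p))"
        using J(3) fJ by (intro finite_measure_mono) (auto simp: U_def p(1) sets)
      also have "\<dots> \<le> (\<Sum>p\<in>J. measure M (ball (fst p) (3 * snd p)))"
        using fJ by (intro finite_measure_subadditive_finite) (auto simp: sets)
      also have "\<dots> \<le> a"
      proof (rule fin[OF fJ _ J(2)])
        fix x r assume "(x, r) \<in> J"
        then obtain i where "(x, r) = p i" using J(1) by auto
        then show "r > 0 \<and> P x r" using p(2)[of i] by (metis fst_conv snd_conv)
      qed
      finally show ?thesis .
    qed
    ultimately have "measure M (\<Union>n. U n) \<le> a" by (intro LIMSEQ_le_const2) auto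
    moreover have "(\<Union>n. U n) = \<Union>F'"
    proof -
      have "(\<Union>n. U n) = \<Union>(range A)" by (auto simp: U_def)
      also have "range A = F'" unfolding A_def using range_from_nat_into[OF False F'(2)] .
      finally show ?thesis .
    qed
    moreover have "(\<Union>n. U n) \<in> sets M" using Um by auto
    ultimately show ?thesis using SF by (intro outer_le_sets[of "\<Union>n. U n"]) auto
  qed
qed

text \<open>The dilated ball in the denominator makes this maximal function of weak type \<open>(1,1)\<close>
  for every measure, doubling or not.\<close>

lemma maximal_function_weak_type:
  fixes M :: "'a::{metric_space,second_countable_topology} measure"
  assumes M: "finite_measure M" and sets: "sets M = sets borel"
    and f: "integrable M f" "\<And>x. 0 \<le> f x" and t: "t > 0"
  shows "outer_le M {x. \<exists>r>0. (\<integral>y\<in>ball x r. f y \<partial>M) > t * measure M (ball x (3 * r))}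
           ((\<integral>y. f y \<partial>M) / t)"
proof (rule outer_le_of_ball_cover[OF M sets, where
      P="\<lambda>x r. (\<integral>y\<in>ball x r. f y \<partial>M) > t * measure M (ball x (3 * r))"])
  fix I :: "('a \<times> real) set"
  let ?B = "\<lambda>p. ball (fst p) (snd p)"
  assume I: "finite I"
    and P: "\<And>x r. (x, r) \<in> I \<Longrightarrow> r > 0 \<and> (\<integral>y\<in>ball x r. f y \<partial>M) > t * measure M (ball x (3 * r))"
    and disj: "pairwise (\<lambda>p q. disjnt (?B p) (?B q)) I"
  have "t * (\<Sum>p\<in>I. measure M (ball (fst p) (3 * snd p)))
      \<le> (\<Sum>p\<in>I. (\<integral>y\<in>?B p. f y \<partial>M))"
    unfolding sum_distrib_left using P by (intro sum_mono) (force intro: less_imp_le)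
  also have "\<dots> = (\<integral>y. (\<Sum>p\<in>I. indicator (?B p) y * f y) \<partial>M)"
    unfolding set_lebesgue_integral_def using f sets
    by (subst Bochner_Integration.integral_sum)
      (auto intro!: integrable_real_mult_indicator[of _ M f, simplified mult.commute[of _ "indicator _ _"]])
  also have "\<dots> \<le> (\<integral>y. f y \<partial>M)"
  proof (rule integral_mono')
    fix y
    have "(\<Sum>p\<in>I. indicator (?B p) y * f y) = indicator (\<Union>p\<in>I. ?B p) y * f y"
      using disj I
      by (subst indicator_UN_disjoint)
        (auto simp: sum_distrib_right pairwise_def disjnt_def disjoint_family_on_def)
    also have "\<dots> \<le> f y" using f(2) by (simp add: indicator_def)
    finally show "(\<Sum>p\<in>I. indicator (?B p) y * f y) \<le> f y" .
  qed (use f in auto)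
  finally show "(\<Sum>p\<in>I. measure M (ball (fst p) (3 * snd p))) \<le> (\<integral>y. f y \<partial>M) / t"
    using t by (simp add: field_simps)
qed auto

text \<open>The test functions: dense in L1, and regular enough that
  \<open>K x y * (g y - g x)\<close> is absolutely integrable in \<open>y\<close>.\<close>

definition bounded_lipschitz :: "('a::metric_space \<Rightarrow> real) \<Rightarrow> bool" where
  "bounded_lipschitz g \<longleftrightarrow> (\<exists>L\<ge>0. \<forall>x. \<bar>g x\<bar> \<le> L \<and> (\<forall>y. \<bar>g x - g y\<bar> \<le> L * dist x y))"

lemma bounded_lipschitzE:
  assumes "bounded_lipschitz g"
  obtains L where "L \<ge> 0" "\<And>x. \<bar>g x\<bar> \<le> L" "\<And>x y. \<bar>g x - g y\<bar> \<le> L * dist x y"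
  using assms unfolding bounded_lipschitz_def by blast

lemma bounded_lipschitzI:
  assumes "\<And>x. \<bar>g x\<bar> \<le> B" "\<And>x y. \<bar>g x - g y\<bar> \<le> L * dist x y"
  shows "bounded_lipschitz g"
  unfolding bounded_lipschitz_def
proof (intro exI[of _ "max 0 (max B L)"] conjI allI)
  fix x y
  show "\<bar>g x\<bar> \<le> max 0 (max B L)" using assms(1)[of x] by simp
  have "L * dist x y \<le> max 0 (max B L) * dist x y" by (intro mult_right_mono) auto
  then show "\<bar>g x - g y\<bar> \<le> max 0 (max B L) * dist x y" using assms(2)[of x y] by linarith
qed simp

lemma bounded_lipschitz_const: "bounded_lipschitz (\<lambda>x. c)"
  by (rule bounded_lipschitzI[of _ "\<bar>c\<bar>" 0]) auto

lemma bounded_lipschitz_add: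
  assumes "bounded_lipschitz f" "bounded_lipschitz g"
  shows "bounded_lipschitz (\<lambda>x. f x + g x)"
proof -
  obtain L where L: "\<And>x. \<bar>f x\<bar> \<le> L" "\<And>x y. \<bar>f x - f y\<bar> \<le> L * dist x y"
    using bounded_lipschitzE[OF assms(1)] by metis
  obtain L' where L': "\<And>x. \<bar>g x\<bar> \<le> L'" "\<And>x y. \<bar>g x - g y\<bar> \<le> L' * dist x y"
    using bounded_lipschitzE[OF assms(2)] by metis
  show ?thesis
  proof (rule bounded_lipschitzI[of _ "L + L'" "L + L'"])
    fix x y
    show "\<bar>f x + g x\<bar> \<le> L + L'" using L(1)[of x] L'(1)[of x] by linarith
    show "\<bar>f x + g x - (f y + g y)\<bar> \<le> (L + L') * dist x y"
      using L(2)[of x y] L'(2)[of x y] by (simp add: algebra_simps)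
  qed
qed

lemma bounded_lipschitz_scale:
  assumes "bounded_lipschitz f"
  shows "bounded_lipschitz (\<lambda>x. c * f x)"
proof -
  obtain L where L: "\<And>x. \<bar>f x\<bar> \<le> L" "\<And>x y. \<bar>f x - f y\<bar> \<le> L * dist x y"
    using bounded_lipschitzE[OF assms(1)] by metis
  show ?thesis
    by (rule bounded_lipschitzI[of _ "\<bar>c\<bar> * L" "\<bar>c\<bar> * L"])
      (use L in \<open>auto simp: abs_mult mult.assoc right_diff_distrib[symmetric] intro!: mult_left_mono\<close>)
qed

lemma bounded_lipschitz_sum:
  assumes "\<And>i. i \<in> I \<Longrightarrow> bounded_lipschitz (f i)"
  shows "bounded_lipschitz (\<lambda>x. \<Sum>i\<in>I. f i x)"
  using assms
  by (induction I rule: infinite_finite_induct) (auto intro: bounded_lipschitz_const bounded_lipschitz_add)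

lemma bounded_lipschitz_max0:
  assumes "bounded_lipschitz f"
  shows "bounded_lipschitz (\<lambda>x. max 0 (f x))"
proof -
  obtain L where L: "\<And>x. \<bar>f x\<bar> \<le> L" "\<And>x y. \<bar>f x - f y\<bar> \<le> L * dist x y"
    using bounded_lipschitzE[OF assms(1)] by metis
  show ?thesis
  proof (rule bounded_lipschitzI[of _ L L])
    fix x y
    show "\<bar>max 0 (f x)\<bar> \<le> L" using L(1)[of x] by linarith
    show "\<bar>max 0 (f x) - max 0 (f y)\<bar> \<le> L * dist x y"
      using L(2)[of x y] by linarith
  qed
qed

lemma bounded_lipschitz_continuous:
  assumes "bounded_lipschitz f"
  shows "continuous_on UNIV f"
proof -
  obtain L where "L \<ge> 0" "\<And>x y. \<bar>f x - f y\<bar> \<le> L * dist x y"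
    using bounded_lipschitzE[OF assms(1)] by metis
  then have "L-lipschitz_on UNIV f" by (intro lipschitz_onI) (auto simp: dist_real_def)
  then show ?thesis by (rule lipschitz_on_continuous_on)
qed

lemma bounded_lipschitz_measurable:
  assumes "sets M = sets borel" "bounded_lipschitz f"
  shows "f \<in> borel_measurable M"
  using borel_measurable_continuous_onI[OF bounded_lipschitz_continuous[OF assms(2)]] assms(1)
  by (simp cong: measurable_cong_sets)

lemma bounded_lipschitz_integrable:
  assumes "finite_measure M" "sets M = sets borel" "bounded_lipschitz f"
  shows "integrable M f"
proof -
  interpret finite_measure M by fact
  obtain L where "\<And>x. \<bar>f x\<bar> \<le> L" using bounded_lipschitzE[OF assms(3)] by metis
  then show ?thesis
    using bounded_lipschitz_measurable[OF assms(2,3)] by (intro integrable_const_bound[of _ L]) auto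
qed

section \<open>Density of bounded Lipschitz functions\<close>

lemma L1_triangle:
  fixes f g k :: "'a \<Rightarrow> real"
  assumes "integrable M f" "integrable M g" "integrable M k"
  shows "(\<integral>x. \<bar>f x - k x\<bar> \<partial>M) \<le> (\<integral>x. \<bar>f x - g x\<bar> \<partial>M) + (\<integral>x. \<bar>g x - k x\<bar> \<partial>M)"
proof -
  have "(\<integral>x. \<bar>f x - k x\<bar> \<partial>M) \<le> (\<integral>x. \<bar>f x - g x\<bar> + \<bar>g x - k x\<bar> \<partial>M)"
    using assms by (intro integral_mono) auto
  also have "\<dots> = (\<integral>x. \<bar>f x - g x\<bar> \<partial>M) + (\<integral>x. \<bar>g x - k x\<bar> \<partial>M)"
    using assms by (intro Bochner_Integration.integral_add) auto
  finally show ?thesis .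
qed

context
  fixes M :: "'a::metric_space measure"
  assumes fin: "finite_measure M" and sets[measurable_cong]: "sets M = sets borel"
begin

interpretation finite_measure M by (rule fin)

text \<open>The L1 closure of the bounded Lipschitz functions, shown below to be all of L1.\<close>

definition L1_approx where
  "L1_approx f \<longleftrightarrow> integrable M f \<and> (\<forall>e>0. \<exists>g. bounded_lipschitz g \<and> (\<integral>x. \<bar>f x - g x\<bar> \<partial>M) < e)"

lemma L1_approx_limit:
  assumes f: "integrable M f"
    and "\<And>e. e > 0 \<Longrightarrow> \<exists>g. L1_approx g \<and> (\<integral>x. \<bar>f x - g x\<bar> \<partial>M) < e"
  shows "L1_approx f"
  unfolding L1_approx_def
proof (intro conjI allI impI f)
  fix e :: real assume "e > 0"
  then obtain g where g: "L1_approx g" "(\<integral>x. \<bar>f x - g x\<bar> \<partial>M) < e/2"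
    using assms(2)[of "e/2"] by auto
  then obtain k where k: "bounded_lipschitz k" "(\<integral>x. \<bar>g x - k x\<bar> \<partial>M) < e/2"
    using \<open>e > 0\<close> half_gt_zero unfolding L1_approx_def by blast
  have "integrable M k" using bounded_lipschitz_integrable[OF fin sets k(1)] .
  then have "(\<integral>x. \<bar>f x - k x\<bar> \<partial>M) < e"
    using L1_triangle[OF f _ \<open>integrable M k\<close>, of g] g k by (auto simp: L1_approx_def)
  then show "\<exists>g. bounded_lipschitz g \<and> (\<integral>x. \<bar>f x - g x\<bar> \<partial>M) < e" using k by blast
qed

lemma L1_approx_lipschitz: "bounded_lipschitz f \<Longrightarrow> L1_approx f"
  unfolding L1_approx_def using bounded_lipschitz_integrable[OF fin sets]
  by (auto intro!: exI[of _ f])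

lemma L1_approx_add:
  assumes "L1_approx f" "L1_approx g" shows "L1_approx (\<lambda>x. f x + g x)"
  unfolding L1_approx_def
proof (intro conjI allI impI)
  show I: "integrable M (\<lambda>x. f x + g x)" using assms by (auto simp: L1_approx_def)
  fix e :: real assume "e > 0"
  then have "e/2 > 0" by simp
  then obtain f' g' where *: "bounded_lipschitz f'" "(\<integral>x. \<bar>f x - f' x\<bar> \<partial>M) < e/2"
    "bounded_lipschitz g'" "(\<integral>x. \<bar>g x - g' x\<bar> \<partial>M) < e/2"
    using assms unfolding L1_approx_def by meson
  have "integrable M f'" "integrable M g'" "integrable M f" "integrable M g"
    using bounded_lipschitz_integrable[OF fin sets] * assms by (auto simp: L1_approx_def)
  then have "(\<integral>x. \<bar>f x + g x - (f' x + g' x)\<bar> \<partial>M) \<le> (\<integral>x. \<bar>f x - f' x\<bar> + \<bar>g x - g' x\<bar> \<partial>M)"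
    by (intro integral_mono) auto
  also have "\<dots> = (\<integral>x. \<bar>f x - f' x\<bar> \<partial>M) + (\<integral>x. \<bar>g x - g' x\<bar> \<partial>M)"
    using \<open>integrable M f'\<close> \<open>integrable M g'\<close> \<open>integrable M f\<close> \<open>integrable M g\<close>
    by (intro Bochner_Integration.integral_add) auto
  also have "\<dots> < e" using * by linarith
  finally show "\<exists>k. bounded_lipschitz k \<and> (\<integral>x. \<bar>f x + g x - k x\<bar> \<partial>M) < e"
    using bounded_lipschitz_add[OF *(1,3)] by blast
qed

lemma L1_approx_scale:
  assumes "L1_approx f" shows "L1_approx (\<lambda>x. c * f x)"
  unfolding L1_approx_def
proof (intro conjI allI impI)
  show I: "integrable M (\<lambda>x. c * f x)" using assms by (auto simp: L1_approx_def)
  fix e :: real assume "e > 0"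
  then have "e / (\<bar>c\<bar> + 1) > 0" by simp
  then obtain f' where *: "bounded_lipschitz f'" "(\<integral>x. \<bar>f x - f' x\<bar> \<partial>M) < e / (\<bar>c\<bar> + 1)"
    using assms unfolding L1_approx_def by meson
  have "(\<integral>x. \<bar>c * f x - c * f' x\<bar> \<partial>M) = \<bar>c\<bar> * (\<integral>x. \<bar>f x - f' x\<bar> \<partial>M)"
    by (simp add: abs_mult flip: right_diff_distrib)
  also have "\<dots> \<le> (\<bar>c\<bar> + 1) * (\<integral>x. \<bar>f x - f' x\<bar> \<partial>M)"
    by (intro mult_right_mono) auto
  also have "\<dots> < e" using *(2) by (simp add: field_simps add_pos_nonneg)
  finally show "\<exists>k. bounded_lipschitz k \<and> (\<integral>x. \<bar>c * f x - k x\<bar> \<partial>M) < e"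
    using bounded_lipschitz_scale[OF *(1)] by blast
qed

lemma L1_approx_sum:
  assumes "\<And>i. i \<in> I \<Longrightarrow> L1_approx (f i)"
  shows "L1_approx (\<lambda>x. \<Sum>i\<in>I. f i x)"
  using assms
  by (induction I rule: infinite_finite_induct)
    (auto intro: L1_approx_lipschitz bounded_lipschitz_const L1_approx_add)

text \<open>The functions \<open>min 1 (n * infdist x (- U))\<close> increase to the indicator of
  \<open>U\<close>. The whole space is treated apart because the distance to the empty set is 0 by
  convention.\<close>

lemma L1_approx_open:
  assumes U: "open U" shows "L1_approx (indicator U)"
proof (cases "U = UNIV")
  case True
  then show ?thesis using L1_approx_lipschitz[OF bounded_lipschitz_const[of 1]] by simp
next
  case False
  define g where "g n x = min 1 (real n * infdist x (- U))" for n :: nat and x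
  have lip: "bounded_lipschitz (g n)" for n
  proof (rule bounded_lipschitzI[of _ 1 "real n"])
    fix x y
    show "\<bar>g n x\<bar> \<le> 1" by (simp add: g_def infdist_nonneg)
    have "\<bar>g n x - g n y\<bar> \<le> \<bar>real n * infdist x (-U) - real n * infdist y (-U)\<bar>"
      unfolding g_def by linarith
    also have "\<dots> = real n * \<bar>infdist x (-U) - infdist y (-U)\<bar>"
      by (simp add: abs_mult flip: right_diff_distrib)
    also have "\<dots> \<le> real n * dist x y"
      by (intro mult_left_mono infdist_triangle_abs) auto
    finally show "\<bar>g n x - g n y\<bar> \<le> real n * dist x y" .
  qed
  have Um: "U \<in> sets M" using U sets by auto
  show ?thesis
  proof (rule L1_approx_limit)
    show "integrable M (indicator U :: 'a \<Rightarrow> real)"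
      using Um by (intro integrable_real_indicator) (auto simp: emeasure_eq_measure)
    have "(\<lambda>n. \<integral>x. \<bar>indicator U x - g n x\<bar> \<partial>M) \<longlonglongrightarrow> (\<integral>x. 0 \<partial>M)"
    proof (rule integral_dominated_convergence[where w="\<lambda>_. 1"])
      show "AE x in M. (\<lambda>n. \<bar>indicator U x - g n x\<bar>) \<longlonglongrightarrow> 0"
      proof (intro AE_I2)
        fix x
        have "\<forall>\<^sub>F n in sequentially. \<bar>indicator U x - g n x\<bar> = 0"
        proof (cases "x \<in> U")
          case True
          have "infdist x (-U) > 0"
            using True U False by (intro infdist_pos_not_in_closed) auto
          then have "\<forall>\<^sub>F n in sequentially. real n \<ge> 1 / infdist x (-U)"
            using filterlim_real_sequentially by (simp add: filterlim_at_top)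
          then show ?thesis
            by eventually_elim (use True \<open>infdist x (-U) > 0\<close> in \<open>auto simp: g_def field_simps\<close>)
        next
          case False
          then show ?thesis by (simp add: g_def)
        qed
        then show "(\<lambda>n. \<bar>indicator U x - g n x\<bar>) \<longlonglongrightarrow> 0"
          by (rule tendsto_eventually)
      qed
      show "AE x in M. norm (\<bar>indicator U x - g n x\<bar>) \<le> 1" for n
        by (intro AE_I2) (auto simp: g_def indicator_def infdist_nonneg)
    qed (use Um bounded_lipschitz_measurable[OF sets lip] in auto)
    then have lim: "(\<lambda>n. \<integral>x. \<bar>indicator U x - g n x\<bar> \<partial>M) \<longlonglongrightarrow> 0" by simp
    fix e :: real assume "e > 0"
    then obtain n where "(\<integral>x. \<bar>indicator U x - g n x\<bar> \<partial>M) < e"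
      using order_tendstoD(2)[OF lim] by (auto simp: eventually_sequentially)
    then show "\<exists>g. L1_approx g \<and> (\<integral>x. \<bar>indicator U x - g x\<bar> \<partial>M) < e"
      using L1_approx_lipschitz[OF lip] by blast
  qed
qed

text \<open>Dynkin's argument: the open sets are closed under intersection and generate the Borel
  sets, and approximability passes to complements and to countable disjoint unions.\<close>

lemma L1_approx_indicator:
  assumes A: "A \<in> sets borel" shows "L1_approx (indicator A)"
proof -
  have A: "A \<in> sigma_sets UNIV {S. open S}" using A by (simp add: borel_def)
  have "Int_stable {S :: 'a set. open S}" by (auto simp: Int_stable_def)
  note ind = sigma_sets_induct_disjoint[OF this, of UNIV, simplified]
  from A show ?thesis
  proof (induction rule: ind[consumes 1, case_names basic empty compl union])
    case (basic A) then show ?case using L1_approx_open by auto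
  next
    case empty then show ?case using L1_approx_lipschitz[OF bounded_lipschitz_const[of 0]] by (simp add: indicator_def)
  next
    case (compl A)
    have "indicator (UNIV - A) = (\<lambda>x. 1 + (-1) * indicator A x :: real)"
      by (auto simp: indicator_def)
    then show ?case
      using L1_approx_add[OF L1_approx_lipschitz[OF bounded_lipschitz_const[of 1]]
          L1_approx_scale[OF compl(2), of "-1"]]
      by (simp only:)
  next
    case (union A)
    have Am: "A i \<in> sets M" for i using union(2) by (auto simp: sets borel_def)
    show ?case
    proof (rule L1_approx_limit)
      show I: "integrable M (indicator (\<Union>i. A i) :: 'a \<Rightarrow> real)"
        using Am by (intro integrable_real_indicator) (auto simp: emeasure_eq_measure)
      define g where "g n x = (\<Sum>i<n. indicator (A i) x :: real)" for n :: nat and x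
      have g: "L1_approx (g n)" for n unfolding g_def by (intro L1_approx_sum union)
      have g_eq: "g n = indicator (\<Union>i<n. A i)" for n
        using union(1)
        by (intro ext, unfold g_def, subst indicator_UN_disjoint) (auto simp: disjoint_family_on_def)
      have "(\<lambda>n. \<integral>x. \<bar>indicator (\<Union>i. A i) x - g n x\<bar> \<partial>M) \<longlonglongrightarrow> (\<integral>x. 0 \<partial>M)"
      proof (rule integral_dominated_convergence[where w="\<lambda>_. 1"])
        show "AE x in M. (\<lambda>n. \<bar>indicator (\<Union>i. A i) x - g n x\<bar>) \<longlonglongrightarrow> 0"
        proof (intro AE_I2)
          fix x
          have "\<forall>\<^sub>F n in sequentially. \<bar>indicator (\<Union>i. A i) x - g n x\<bar> = 0"
          proof (cases "\<exists>i. x \<in> A i")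
            case True
            then obtain i where i: "x \<in> A i" by blast
            have "\<forall>\<^sub>F n in sequentially. i < n" by (rule eventually_gt_at_top)
            then show ?thesis by eventually_elim (use i in \<open>auto simp: g_eq indicator_def\<close>)
          next
            case False
            then show ?thesis by (simp add: g_eq indicator_def)
          qed
          then show "(\<lambda>n. \<bar>indicator (\<Union>i. A i) x - g n x\<bar>) \<longlonglongrightarrow> 0"
            by (rule tendsto_eventually)
        qed
        show "AE x in M. norm (\<bar>indicator (\<Union>i. A i) x - g n x\<bar>) \<le> 1" for n
          by (intro AE_I2) (auto simp: g_eq indicator_def)
      qed (use Am in \<open>auto simp: g_def\<close>)
      then have lim: "(\<lambda>n. \<integral>x. \<bar>indicator (\<Union>i. A i) x - g n x\<bar> \<partial>M) \<longlonglongrightarrow> 0" by simp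
      fix e :: real assume "e > 0"
      then obtain n where "(\<integral>x. \<bar>indicator (\<Union>i. A i) x - g n x\<bar> \<partial>M) < e"
        using order_tendstoD(2)[OF lim] by (auto simp: eventually_sequentially)
      then show "\<exists>g. L1_approx g \<and> (\<integral>x. \<bar>indicator (\<Union>i. A i) x - g x\<bar> \<partial>M) < e"
        using g by blast
    qed
  qed
qed

lemma L1_approx_integrable:
  assumes "integrable M f" shows "L1_approx f"
  using assms
proof (induction rule: integrable_induct)
  case (base A c)
  have "L1_approx (\<lambda>x. c * indicator A x)"
    using base(1) by (intro L1_approx_scale L1_approx_indicator) (simp add: sets)
  then show ?case by (simp add: mult.commute)
next
  case (add f g)
  then show ?case by (intro L1_approx_add)
next
  case (lim f s)
  show ?case
  proof (rule L1_approx_limit)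
    show If: "integrable M f" using lim by auto
    have "(\<lambda>i. \<integral>x. \<bar>f x - s i x\<bar> \<partial>M) \<longlonglongrightarrow> (\<integral>x. 0 \<partial>M)"
    proof (rule integral_dominated_convergence[where w="\<lambda>x. 3 * norm (f x)"])
      show "AE x in M. (\<lambda>i. \<bar>f x - s i x\<bar>) \<longlonglongrightarrow> 0"
      proof (intro AE_I2)
        fix x assume "x \<in> space M"
        then have "(\<lambda>i. \<bar>f x - s i x\<bar>) \<longlonglongrightarrow> \<bar>f x - f x\<bar>" using lim by (intro tendsto_intros) auto
        then show "(\<lambda>i. \<bar>f x - s i x\<bar>) \<longlonglongrightarrow> 0" by simp
      qed
      show "AE x in M. norm \<bar>f x - s i x\<bar> \<le> 3 * norm (f x)" for i
      proof (intro AE_I2)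
        fix x assume "x \<in> space M"
        then have "norm (s i x) \<le> 2 * norm (f x)" using lim by auto
        then show "norm \<bar>f x - s i x\<bar> \<le> 3 * norm (f x)" by simp
      qed
    qed (use lim in auto)
    then have l: "(\<lambda>i. \<integral>x. \<bar>f x - s i x\<bar> \<partial>M) \<longlonglongrightarrow> 0" by simp
    fix e :: real assume "e > 0"
    then obtain n where "(\<integral>x. \<bar>f x - s n x\<bar> \<partial>M) < e"
      using order_tendstoD(2)[OF l] by (auto simp: eventually_sequentially)
    then show "\<exists>g. L1_approx g \<and> (\<integral>x. \<bar>f x - g x\<bar> \<partial>M) < e" using lim by blast
  qed
qed

lemma bounded_lipschitz_dense_L1:
  assumes "integrable M f" "e > 0"
  obtains g where "bounded_lipschitz g" "(\<integral>x. \<bar>f x - g x\<bar> \<partial>M) < e"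
  using L1_approx_integrable[OF assms(1)] assms(2) unfolding L1_approx_def by blast

lemma bounded_lipschitz_dense_L1_nonneg:
  assumes f: "integrable M f" "\<And>x. f x \<ge> 0" and e: "e > 0"
  obtains g where "bounded_lipschitz g" "\<And>x. g x \<ge> 0" "(\<integral>x. \<bar>f x - g x\<bar> \<partial>M) < e"
proof -
  obtain g where g: "bounded_lipschitz g" "(\<integral>x. \<bar>f x - g x\<bar> \<partial>M) < e"
    using bounded_lipschitz_dense_L1[OF f(1) e] .
  have "(\<integral>x. \<bar>f x - max 0 (g x)\<bar> \<partial>M) \<le> (\<integral>x. \<bar>f x - g x\<bar> \<partial>M)"
  proof (intro integral_mono)
    show "\<bar>f x - max 0 (g x)\<bar> \<le> \<bar>f x - g x\<bar>" for x using f(2)[of x] by linarith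
  qed (use f bounded_lipschitz_integrable[OF fin sets] g bounded_lipschitz_max0 in auto)
  then show ?thesis
    using that[of "\<lambda>x. max 0 (g x)"] g bounded_lipschitz_max0 by fastforce
qed

end

section \<open>Truncated singular integrals\<close>

text \<open>A function that is not integrable has integral 0 by convention; this is why
  integrability is asked of the majorant alone.\<close>

lemma abs_integral_le:
  fixes f g :: "'a \<Rightarrow> real"
  assumes "integrable M g" "\<And>x. x \<in> space M \<Longrightarrow> \<bar>f x\<bar> \<le> g x"
  shows "\<bar>\<integral>x. f x \<partial>M\<bar> \<le> (\<integral>x. g x \<partial>M)"
proof (cases "integrable M f")
  case True
  have "\<bar>\<integral>x. f x \<partial>M\<bar> \<le> (\<integral>x. \<bar>f x\<bar> \<partial>M)" by (rule integral_abs_bound)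
  also have "\<dots> \<le> (\<integral>x. g x \<partial>M)" using assms True by (intro integral_mono) auto
  finally show ?thesis .
next
  case False
  have "0 \<le> (\<integral>x. g x \<partial>M)" using assms by (intro integral_nonneg_AE AE_I2) (meson abs_ge_zero order_trans)
  then show ?thesis using False by (simp add: not_integrable_integral_eq)
qed

locale singular_kernel = finite_measure M for M :: "'a::{metric_space,second_countable_topology} measure" +
  fixes K :: "'a \<Rightarrow> 'a \<Rightarrow> real" and h :: "real \<Rightarrow> real" and C :: real
  assumes sets_M [measurable_cong, simp]: "sets M = sets borel"
    and K_meas: "(\<lambda>(x, y). K x y) \<in> borel_measurable (restrict_space borel {(x, y). x \<noteq> y})"
    and antisym: "\<And>x y. x \<noteq> y \<Longrightarrow> K x y = - K y x"
    and h_pos: "\<And>r. r > 0 \<Longrightarrow> h r > 0"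
    and h_mono_on: "mono_on {0<..} h"
    and h_doubling: "\<And>r. r > 0 \<Longrightarrow> h (2 * r) \<le> C * h r"
    and K_size: "\<And>x y. x \<noteq> y \<Longrightarrow> \<bar>K x y\<bar> \<le> 1 / h (dist x y)"
    and K_smooth: "\<And>x y z. x \<noteq> y \<Longrightarrow> z \<noteq> x \<Longrightarrow> dist x y > 2 * dist y z \<Longrightarrow>
           \<bar>K x y - K x z\<bar> \<le> dist y z / (dist x y * h (dist x y))"
    and growth: "\<And>x r. r > 0 \<Longrightarrow> measure M (ball x r) \<le> h r"
begin

lemma space_M [simp]: "space M = UNIV"
  using sets_eq_imp_space_eq[OF sets_M] by simp

lemma h_mono: "0 < r \<Longrightarrow> r \<le> s \<Longrightarrow> h r \<le> h s"
  using h_mono_on by (auto simp: mono_on_def)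

lemma C_ge_1: "C \<ge> 1"
proof -
  have "1 * h 1 \<le> C * h 1" using h_doubling[of 1] h_mono[of 1 2] by simp
  then show ?thesis using h_pos[of 1] by (simp only: mult_le_cancel_right)
qed

lemma h_pow2: "r > 0 \<Longrightarrow> h (2 ^ n * r) \<le> C ^ n * h r"
proof (induction n)
  case (Suc n)
  have "h (2 ^ Suc n * r) \<le> C * h (2 ^ n * r)"
    using h_doubling[of "2 ^ n * r"] Suc.prems by (simp add: mult.assoc)
  also have "\<dots> \<le> C * (C ^ n * h r)"
    using Suc C_ge_1 by (intro mult_left_mono) auto
  finally show ?case by (simp add: mult.assoc)
qed simp

text \<open>The truncated kernel as a total function. For positive \<delta> it vanishes on the
  diagonal, where \<open>K\<close> is unspecified, so antisymmetry and the bound by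
  \<open>1 / h \<delta>\<close> hold for all pairs of points.\<close>

definition TK :: "real \<Rightarrow> 'a \<Rightarrow> 'a \<Rightarrow> real" where
  "TK \<delta> x y = (if \<delta> \<le> dist x y then K x y else 0)"

abbreviation T where "T \<equiv> truncated_op M K"

lemma T_eq: "T \<delta> f x = (\<integral>y. TK \<delta> x y * f y \<partial>M)"
  unfolding truncated_op_def set_lebesgue_integral_def TK_def
  by (intro Bochner_Integration.integral_cong) (auto simp: indicator_def)

text \<open>The kernel is Borel only off the diagonal, so it is first extended by 0. Second
  countability identifies the product of the Borel structures with the Borel sets of the product
  space.\<close>

lemma TK_meas2:
  assumes "\<delta> > 0"
  shows "(\<lambda>p. TK \<delta> (fst p) (snd p)) \<in> borel_measurable (M \<Otimes>\<^sub>M M)"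
proof -
  have o: "{(x :: 'a, y). x \<noteq> y} \<in> sets borel"
  proof -
    have "closed {p :: 'a \<times> 'a. fst p = snd p}"
      by (intro closed_Collect_eq continuous_intros)
    then have "- {p :: 'a \<times> 'a. fst p = snd p} \<in> sets borel" by auto
    also have "- {p :: 'a \<times> 'a. fst p = snd p} = {(x, y). x \<noteq> y}" by auto
    finally show ?thesis .
  qed
  then have k: "(\<lambda>p. if p \<in> {(x, y). x \<noteq> y} then (case p of (x, y) \<Rightarrow> K x y) else 0)
      \<in> borel_measurable borel"
    using K_meas measurable_restrict_space_iff[of "{(x, y). x \<noteq> y}" borel 0 borel "\<lambda>(x, y). K x y"]
    by auto
  have "closed {p :: 'a \<times> 'a. \<delta> \<le> dist (fst p) (snd p)}"
    by (intro closed_Collect_le continuous_intros)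
  then have c: "{p :: 'a \<times> 'a. \<delta> \<le> dist (fst p) (snd p)} \<in> sets borel" by auto
  have eq: "TK \<delta> (fst p) (snd p) = indicator {p :: 'a \<times> 'a. \<delta> \<le> dist (fst p) (snd p)} p *
      (if p \<in> {(x, y). x \<noteq> y} then (case p of (x, y) \<Rightarrow> K x y) else 0)" for p
    using assms by (auto simp: TK_def split: prod.splits)
  have "(\<lambda>p. TK \<delta> (fst p) (snd p)) \<in> borel_measurable borel"
    unfolding eq using k c by (intro borel_measurable_times borel_measurable_indicator) auto
  moreover have "sets (M \<Otimes>\<^sub>M M) = sets (borel :: ('a \<times> 'a) measure)"
    unfolding borel_prod[symmetric] by (intro sets_pair_measure_cong sets_M)
  ultimately show ?thesis by (simp cong: measurable_cong_sets)
qed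

lemma TK_meas [measurable]:
  assumes "\<delta> > 0" shows "TK \<delta> x \<in> borel_measurable M"
  using measurable_compose[OF measurable_Pair1' TK_meas2[OF assms]] by simp

lemma TK_antisym: "\<delta> > 0 \<Longrightarrow> TK \<delta> x y = - TK \<delta> y x"
  using antisym[of x y] by (cases "x = y") (auto simp: TK_def dist_commute)

lemma TK_bound: "\<delta> > 0 \<Longrightarrow> \<bar>TK \<delta> x y\<bar> \<le> 1 / h \<delta>"
proof (cases "\<delta> \<le> dist x y")
  case True
  assume "\<delta> > 0"
  then have "x \<noteq> y" using True by auto
  have "\<bar>K x y\<bar> \<le> 1 / h (dist x y)" using K_size[OF \<open>x \<noteq> y\<close>] .
  also have "\<dots> \<le> 1 / h \<delta>" using h_pos[OF \<open>\<delta> > 0\<close>] h_mono[OF \<open>\<delta> > 0\<close> True] by (intro divide_left_mono) auto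
  finally show ?thesis using True by (simp add: TK_def)
qed (use h_pos[of \<delta>] in \<open>simp add: TK_def\<close>)

lemma TK_integrable:
  assumes "\<delta> > 0" "integrable M f"
  shows "integrable M (\<lambda>y. TK \<delta> x y * f y)"
proof (rule Bochner_Integration.integrable_bound)
  show "integrable M (\<lambda>y. 1 / h \<delta> * f y)" using assms by auto
  show "AE y in M. norm (TK \<delta> x y * f y) \<le> norm (1 / h \<delta> * f y)"
    using TK_bound[OF assms(1)] h_pos[OF assms(1)]
    by (intro AE_I2) (auto simp: abs_mult simp del: times_divide_eq_left intro!: mult_right_mono)
qed (use assms in auto)

lemma T_meas [measurable]:
  assumes "\<delta> > 0" "f \<in> borel_measurable M"
  shows "T \<delta> f \<in> borel_measurable M"
proof -
  have "(\<lambda>p. TK \<delta> (fst p) (snd p) * f (snd p)) \<in> borel_measurable (M \<Otimes>\<^sub>M M)"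
    using TK_meas2[OF assms(1)] assms(2) by auto
  then show ?thesis
    unfolding T_eq[abs_def] by (intro borel_measurable_lebesgue_integral) (simp add: split_beta)
qed

lemma T_superlevel_sets:
  assumes "\<delta> > 0" "f \<in> borel_measurable M"
  shows "{x. c < \<bar>T \<delta> f x\<bar>} \<in> sets M"
proof -
  have [measurable]: "T \<delta> f \<in> borel_measurable M" using assms by (rule T_meas)
  have "{x \<in> space M. c < \<bar>T \<delta> f x\<bar>} \<in> sets M" by measurable
  then show ?thesis by simp
qed

lemma indicator_integrable:
  assumes "A \<in> sets M" shows "integrable M (indicator A :: 'a \<Rightarrow> real)"
  using assms by (intro integrable_real_indicator) (auto simp: emeasure_eq_measure)

lemma T_bound:
  assumes "\<delta> > 0" "integrable M f"
  shows "\<bar>T \<delta> f x\<bar> \<le> (\<integral>y. \<bar>f y\<bar> \<partial>M) / h \<delta>"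
proof -
  have "\<bar>T \<delta> f x\<bar> \<le> (\<integral>y. 1 / h \<delta> * \<bar>f y\<bar> \<partial>M)"
    unfolding T_eq using assms TK_bound[OF assms(1)]
    by (intro abs_integral_le) (auto simp: abs_mult simp del: times_divide_eq_left intro!: mult_right_mono)
  then show ?thesis by simp
qed

lemma T_add: "\<delta> > 0 \<Longrightarrow> integrable M f \<Longrightarrow> integrable M g \<Longrightarrow> T \<delta> (\<lambda>y. f y + g y) x = T \<delta> f x + T \<delta> g x"
  unfolding T_eq using TK_integrable[of \<delta>] by (simp add: distrib_left)

lemma T_diff: "\<delta> > 0 \<Longrightarrow> integrable M f \<Longrightarrow> integrable M g \<Longrightarrow> T \<delta> (\<lambda>y. f y - g y) x = T \<delta> f x - T \<delta> g x"
  unfolding T_eq using TK_integrable[of \<delta>] by (simp add: right_diff_distrib)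

lemma T_scale: "T \<delta> (\<lambda>y. c * f y) x = c * T \<delta> f x"
  unfolding T_eq by (simp add: mult.left_commute)

lemma T_sum:
  assumes "\<delta> > 0" "\<And>i. i \<in> I \<Longrightarrow> integrable M (f i)"
  shows "T \<delta> (\<lambda>y. \<Sum>i\<in>I. f i y) x = (\<Sum>i\<in>I. T \<delta> (f i) x)"
  unfolding T_eq sum_distrib_left
  using assms by (intro Bochner_Integration.integral_sum TK_integrable)

lemma T_integrable:
  assumes "\<delta> > 0" "integrable M f"
  shows "integrable M (T \<delta> f)"
  using T_bound[OF assms] assms
  by (intro integrable_const_bound[where B="(\<integral>y. \<bar>f y\<bar> \<partial>M) / h \<delta>"]) auto

lemma T_mult_integrable:
  assumes "\<delta> > 0" "integrable M f" "integrable M g"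
  shows "integrable M (\<lambda>x. g x * T \<delta> f x)"
proof (rule Bochner_Integration.integrable_bound)
  show "integrable M (\<lambda>x. (\<integral>y. \<bar>f y\<bar> \<partial>M) / h \<delta> * g x)" using assms by auto
  show "AE x in M. norm (g x * T \<delta> f x) \<le> norm ((\<integral>y. \<bar>f y\<bar> \<partial>M) / h \<delta> * g x)"
    using T_bound[OF assms(1,2)] h_pos[OF assms(1)]
    by (intro AE_I2) (simp add: abs_mult mult.commute[of "\<bar>g _\<bar>"] mult_right_mono del: times_divide_eq_left)
qed (use assms in auto)

text \<open>Fubini's theorem; the double integral converges absolutely because the truncated kernel
  is bounded.\<close>

lemma T_antisym:
  assumes \<delta>: "\<delta> > 0" and f: "integrable M f" and g: "integrable M g"
  shows "(\<integral>x. g x * T \<delta> f x \<partial>M) = - (\<integral>x. f x * T \<delta> g x \<partial>M)"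
proof -
  interpret P: pair_sigma_finite M M ..
  have m: "(\<lambda>p. g (fst p) * (TK \<delta> (fst p) (snd p) * f (snd p))) \<in> borel_measurable (M \<Otimes>\<^sub>M M)"
    using TK_meas2[OF \<delta>] f g by auto
  have "integrable (M \<Otimes>\<^sub>M M) (\<lambda>p. g (fst p) * (TK \<delta> (fst p) (snd p) * f (snd p)))"
  proof (rule P.Fubini_integrable[OF m])
    show "AE x in M. integrable M (\<lambda>y. g (fst (x, y)) * (TK \<delta> (fst (x, y)) (snd (x, y)) * f (snd (x, y))))"
      using TK_integrable[OF \<delta> f] by auto
    have eq: "(\<integral>y. norm (g (fst (x, y)) * (TK \<delta> (fst (x, y)) (snd (x, y)) * f (snd (x, y)))) \<partial>M)
        = \<bar>g x\<bar> * (\<integral>y. \<bar>TK \<delta> x y * f y\<bar> \<partial>M)" for x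
      by (simp add: abs_mult)
    have le: "(\<integral>y. \<bar>TK \<delta> x y * f y\<bar> \<partial>M) \<le> (\<integral>y. 1 / h \<delta> * \<bar>f y\<bar> \<partial>M)" for x
      using f \<delta> integrable_abs[OF TK_integrable[OF \<delta> f]] TK_bound[OF \<delta>]
      by (intro integral_mono) (auto simp: abs_mult simp del: times_divide_eq_left intro!: mult_right_mono)
    have "(\<lambda>p. \<bar>TK \<delta> (fst p) (snd p) * f (snd p)\<bar>) \<in> borel_measurable (M \<Otimes>\<^sub>M M)"
      using TK_meas2[OF \<delta>] f by auto
    then have m': "(\<lambda>x. (\<integral>y. \<bar>TK \<delta> x y * f y\<bar> \<partial>M)) \<in> borel_measurable M"
      by (intro borel_measurable_lebesgue_integral) (simp add: split_beta)
    show "integrable M (\<lambda>x. \<integral>y. norm (g (fst (x, y)) * (TK \<delta> (fst (x, y)) (snd (x, y)) * f (snd (x, y)))) \<partial>M)"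
      unfolding eq
    proof (rule Bochner_Integration.integrable_bound)
      show "integrable M (\<lambda>x. (\<integral>y. 1 / h \<delta> * \<bar>f y\<bar> \<partial>M) * \<bar>g x\<bar>)" using g by auto
      show "AE x in M. norm (\<bar>g x\<bar> * (\<integral>y. \<bar>TK \<delta> x y * f y\<bar> \<partial>M))
          \<le> norm ((\<integral>y. 1 / h \<delta> * \<bar>f y\<bar> \<partial>M) * \<bar>g x\<bar>)"
        using le mult_right_mono[OF le abs_ge_zero] h_pos[OF \<delta>]
        by (intro AE_I2) (simp add: abs_mult mult.commute[of "\<bar>g _\<bar>"])
    qed (use g m' in auto)
  qed
  then have "integrable (M \<Otimes>\<^sub>M M) (\<lambda>(x, y). g x * (TK \<delta> x y * f y))"
    by (simp add: case_prod_unfold)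
  from P.Fubini_integral[OF this]
  have "(\<integral>y. (\<integral>x. g x * (TK \<delta> x y * f y) \<partial>M) \<partial>M) = (\<integral>x. (\<integral>y. g x * (TK \<delta> x y * f y) \<partial>M) \<partial>M)" .
  also have "\<dots> = (\<integral>x. g x * T \<delta> f x \<partial>M)" by (simp add: T_eq)
  also have "(\<lambda>y. \<integral>x. g x * (TK \<delta> x y * f y) \<partial>M) = (\<lambda>y. - (f y * T \<delta> g y))"
  proof
    fix y
    have "(\<integral>x. g x * (TK \<delta> x y * f y) \<partial>M) = (\<integral>x. - (f y * (TK \<delta> y x * g x)) \<partial>M)"
      using TK_antisym[OF \<delta>, of _ y] by (intro Bochner_Integration.integral_cong) (simp_all add: algebra_simps)
    then show "(\<integral>x. g x * (TK \<delta> x y * f y) \<partial>M) = - (f y * T \<delta> g y)" by (simp add: T_eq)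
  qed
  finally show ?thesis by simp
qed

end

text \<open>A pointwise bound by some member of the sequence gives a bound by the sum of the
  sequence, whose integrals form a geometric series with total \<open>2 * B\<close>.\<close>

lemma dyadic_majorant:
  fixes g :: "'a \<Rightarrow> real" and u :: "nat \<Rightarrow> 'a \<Rightarrow> real"
  assumes g: "g \<in> borel_measurable M" "\<And>y. 0 \<le> g y"
    and u: "\<And>k. integrable M (u k)" "\<And>k y. 0 \<le> u k y"
    and gu: "\<And>y. g y = 0 \<or> (\<exists>k. g y \<le> u k y)"
    and B: "\<And>k. (\<integral>y. u k y \<partial>M) \<le> (1/2)^k * B"
  shows "integrable M g" "(\<integral>y. g y \<partial>M) \<le> 2 * B"
proof -
  have "0 \<le> (\<integral>y. u 0 y \<partial>M)" using u(2) by (intro integral_nonneg_AE) auto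
  then have B0: "B \<ge> 0" using B[of 0] by simp
  have "(\<integral>\<^sup>+y. ennreal (g y) \<partial>M) \<le> (\<integral>\<^sup>+y. (\<Sum>k. ennreal (u k y)) \<partial>M)"
  proof (rule nn_integral_mono)
    fix y
    have le: "ennreal (u k y) \<le> (\<Sum>k. ennreal (u k y))" for k
      using sum_le_suminf[of "\<lambda>k. ennreal (u k y)" "{k}"] by simp
    from gu[of y] show "ennreal (g y) \<le> (\<Sum>k. ennreal (u k y))"
      using le ennreal_leI order_trans by fastforce
  qed
  also have "\<dots> = (\<Sum>k. \<integral>\<^sup>+y. ennreal (u k y) \<partial>M)"
    using u by (intro nn_integral_suminf) auto
  also have "\<dots> = (\<Sum>k. ennreal (\<integral>y. u k y \<partial>M))"
    using u by (intro suminf_cong nn_integral_eq_integral) auto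
  also have "\<dots> \<le> (\<Sum>k. ennreal ((1/2)^k * B))"
    using B by (intro suminf_le ennreal_leI) auto
  also have "\<dots> = ennreal (\<Sum>k. (1/2)^k * B)"
    using B0 by (intro suminf_ennreal2) (auto intro!: summable_mult2 summable_geometric)
  also have "(\<Sum>k. (1/2)^k * B) = 2 * B"
    using suminf_mult2[of "\<lambda>k. (1/2::real)^k" B] suminf_geometric[of "1/2::real"]
    by (simp add: summable_geometric)
  finally have le: "(\<integral>\<^sup>+y. ennreal (g y) \<partial>M) \<le> ennreal (2 * B)" .
  show I: "integrable M g"
    using g le by (intro integrableI_bounded) (auto intro: le_less_trans)
  show "(\<integral>y. g y \<partial>M) \<le> 2 * B"
    using le nn_integral_eq_integral[OF I] g B0 by auto
qed

lemma dyadic_scale: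
  fixes r d :: real
  assumes "0 < r" "r \<le> d"
  obtains k :: nat where "2 ^ k * r \<le> d" "d < 2 ^ Suc k * r"
proof -
  obtain n where "d / r < 2 ^ n" using real_arch_pow[of 2 "d / r"] by auto
  then have ex: "d < 2 ^ n * r" using assms by (simp add: field_simps)
  define m where "m = (LEAST n. d < 2 ^ n * r)"
  have m: "d < 2 ^ m * r" unfolding m_def using ex by (rule LeastI)
  have "m \<noteq> 0" using m assms by (cases m) auto
  then obtain k where k: "m = Suc k" by (cases m) auto
  have "\<not> d < 2 ^ k * r"
    using not_less_Least[of k "\<lambda>n. d < 2 ^ n * r"] k m_def by auto
  then show ?thesis using that[of k] m k by auto
qed

section \<open>Integrals of the kernel majorants and comparison of truncations\<close>

context singular_kernel
begin

definition mass :: "('a \<Rightarrow> real) \<Rightarrow> 'a \<Rightarrow> real \<Rightarrow> real" where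
  "mass f x r = (\<integral>y. indicator (ball x r) y * \<bar>f y\<bar> \<partial>M)"

lemma mass_integrable:
  fixes f :: "'a \<Rightarrow> real"
  assumes "A \<in> sets M" "integrable M f"
  shows "integrable M (\<lambda>y. indicator A y * \<bar>f y\<bar>)"
  using integrable_mult_indicator[OF assms(1) integrable_abs[OF assms(2)]] by simp

lemma mass_one [simp]: "mass (\<lambda>_. 1) x r = measure M (ball x r)"
  unfolding mass_def by simp

lemma mass_le_norm: "integrable M f \<Longrightarrow> mass f x r \<le> (\<integral>y. \<bar>f y\<bar> \<partial>M)"
  unfolding mass_def by (intro integral_mono mass_integrable) (auto simp: indicator_def)

text \<open>Monotonicity is known on the positive axis only; extension by 0 keeps it monotone, hence
  Borel.\<close>

lemma h_meas: "(\<lambda>d. if 0 < d then h d else 0) \<in> borel_measurable borel"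
  using h_mono h_pos by (intro borel_measurable_mono monoI) (auto simp: less_imp_le)

text \<open>The majorant that the smoothness condition yields for the change of the kernel when a
  point at distance \<open>d\<close> is moved by at most \<open>r\<close>.\<close>

definition far :: "real \<Rightarrow> real \<Rightarrow> real" where
  "far r d = (if r \<le> d then r / (d * h d) else 0)"

text \<open>The kernel size \<open>1 / h d\<close> times the distance: up to a Lipschitz constant,
  the majorant of the kernel against an increment of a Lipschitz function.\<close>

definition near :: "real \<Rightarrow> real \<Rightarrow> real" where
  "near r d = (if 0 < d \<and> d < r then d / h d else 0)"

lemma far_nonneg: "r > 0 \<Longrightarrow> 0 \<le> far r d"
  using h_pos[of d] by (auto simp: far_def)

lemma near_nonneg: "0 \<le> near r d"
  using h_pos[of d] by (auto simp: near_def)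

lemma far_meas: assumes "r > 0" shows "(\<lambda>y. far r (dist x y)) \<in> borel_measurable M"
proof -
  have eq: "far r = (\<lambda>d. if r \<le> d then r / (d * (if 0 < d then h d else 0)) else 0)"
    using assms by (auto simp: far_def)
  have "far r \<in> borel_measurable borel"
    unfolding eq using h_meas by measurable
  then show ?thesis by measurable
qed

lemma near_meas: "(\<lambda>y. near r (dist x y)) \<in> borel_measurable M"
proof -
  have eq: "near r = (\<lambda>d. if 0 < d \<and> d < r then d / (if 0 < d then h d else 0) else 0)"
    by (auto simp: near_def)
  have "near r \<in> borel_measurable borel"
    unfolding eq using h_meas by measurable
  then show ?thesis by measurable
qed

text \<open>On the shell where the distance lies between \<open>2^k * r\<close> and
  \<open>2^(k+1) * r\<close>, the factor \<open>r / d\<close> contributes \<open>(1/2)^k\<close>,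
  while the mass divided by \<open>h\<close> is at most \<open>C * A\<close>; one doubling of
  \<open>h\<close> pays for passing to the outer radius.\<close>

lemma far_integral:
  assumes r: "r > 0" and f: "integrable M f"
    and A: "\<And>s. s \<ge> r \<Longrightarrow> mass f x s \<le> A * h s" "A \<ge> 0"
  shows "integrable M (\<lambda>y. far r (dist x y) * \<bar>f y\<bar>)"
    "(\<integral>y. far r (dist x y) * \<bar>f y\<bar> \<partial>M) \<le> 2 * (C * A)"
proof -
  define u where "u k y = (1/2)^k / h (2^k * r) * (indicator (ball x (2 ^ Suc k * r)) y * \<bar>f y\<bar>)" for k :: nat and y
  have *: "(\<lambda>y. far r (dist x y) * \<bar>f y\<bar>) \<in> borel_measurable M"
    using far_meas[OF r] f by auto
  have hp: "h (2 ^ k * r) > 0" for k using r by (intro h_pos) auto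
  have u: "integrable M (u k)" "\<And>y. 0 \<le> u k y" for k
    using mass_integrable[of "ball x (2 ^ Suc k * r)", OF _ f] hp[of k]
    by (auto simp: u_def[abs_def] less_imp_le)
  have gu: "far r (dist x y) * \<bar>f y\<bar> = 0 \<or> (\<exists>k. far r (dist x y) * \<bar>f y\<bar> \<le> u k y)" for y
  proof (cases "r \<le> dist x y")
    case True
    obtain k where k: "2 ^ k * r \<le> dist x y" "dist x y < 2 ^ Suc k * r"
      using dyadic_scale[OF r True] .
    have "far r (dist x y) = r / (dist x y * h (dist x y))" using True by (simp add: far_def)
    also have "\<dots> \<le> r / ((2 ^ k * r) * h (2 ^ k * r))"
    proof (intro divide_left_mono mult_mono mult_pos_pos)
      show "h (2 ^ k * r) \<le> h (dist x y)" using k r by (intro h_mono) auto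
      show "0 < h (dist x y)" using True r by (intro h_pos) auto
    qed (use r k hp[of k] True in auto)
    also have "\<dots> = (1/2)^k / h (2^k * r)"
      using r by (simp add: field_simps power_one_over)
    finally have "far r (dist x y) * \<bar>f y\<bar> \<le> (1/2)^k / h (2^k * r) * \<bar>f y\<bar>"
      by (intro mult_right_mono) auto
    also have "\<dots> = u k y" using k by (simp add: u_def)
    finally show ?thesis by blast
  qed (simp add: far_def)
  have B: "(\<integral>y. u k y \<partial>M) \<le> (1/2)^k * (C * A)" for k
  proof -
    have "(\<integral>y. u k y \<partial>M) = (1/2)^k / h (2^k * r) * mass f x (2 ^ Suc k * r)"
      by (simp add: u_def mass_def)
    also have "\<dots> \<le> (1/2)^k / h (2^k * r) * (A * h (2 ^ Suc k * r))"
    proof -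
      have "r \<le> 2 ^ Suc k * r" using r one_le_power[of "2::real" "Suc k"]
        by (simp only: mult_le_cancel_right1) simp
      then show ?thesis using hp[of k] by (intro mult_left_mono A) (auto simp: less_imp_le)
    qed
    also have "\<dots> \<le> (1/2)^k / h (2^k * r) * (A * (C * h (2 ^ k * r)))"
      using hp[of k] h_doubling[of "2 ^ k * r"] r A(2)
      by (intro mult_left_mono) (auto simp: less_imp_le mult.assoc)
    also have "\<dots> = (1/2)^k * (C * A)" using hp[of k] by (simp add: field_simps)
    finally show ?thesis .
  qed
  note dm = dyadic_majorant[OF * _ u gu B]
  have "0 \<le> far r (dist x y) * \<bar>f y\<bar>" for y using far_nonneg[OF r] by simp
  then show "integrable M (\<lambda>y. far r (dist x y) * \<bar>f y\<bar>)"
    "(\<integral>y. far r (dist x y) * \<bar>f y\<bar> \<partial>M) \<le> 2 * (C * A)"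
    using dm by auto
qed

lemma far_integral_one:
  assumes "r > 0"
  shows "integrable M (\<lambda>y. far r (dist x y))" "(\<integral>y. far r (dist x y) \<partial>M) \<le> 2 * C"
  using far_integral[OF assms, of "\<lambda>_. 1" x 1] growth[of _ x] assms by auto

text \<open>The same summation over shells that shrink towards \<open>x\<close>, where the decay now
  comes from the factor \<open>d\<close>. The density bound \<open>A\<close> is kept explicit,
  because it becomes the small \<eta> at points outside the exceptional set.\<close>

lemma near_integral:
  assumes r: "r > 0" and A: "\<And>s. 0 < s \<Longrightarrow> s \<le> r \<Longrightarrow> measure M (ball x s) \<le> A * h s"
  shows "integrable M (\<lambda>y. near r (dist x y))"
    "(\<integral>y. near r (dist x y) \<partial>M) \<le> 2 * (C * A * r)"
proof -
  define s where "s k = (1/2) ^ k * r" for k :: nat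
  have s_pos: "s k > 0" and s_le: "s k \<le> r" and s_Suc: "s k = 2 * s (Suc k)" for k
    using r by (auto simp: s_def mult_le_cancel_right1 power_le_one)
  have A0: "0 \<le> A * h (s k)" for k
    using order_trans[OF measure_nonneg A[OF s_pos s_le]] .
  have A0': "0 \<le> A" using A0[of 0] h_pos[OF s_pos[of 0]] by (simp add: zero_le_mult_iff)
  define u where "u k y = s k / h (s (Suc k)) * indicator (ball x (s k)) y" for k :: nat and y
  have hp: "h (s k) > 0" for k using s_pos by (intro h_pos)
  have u: "integrable M (u k)" "\<And>y. 0 \<le> u k y" for k
  proof -
    show "integrable M (u k)"
      unfolding u_def[abs_def] by (intro integrable_mult_right indicator_integrable) auto
    show "0 \<le> u k y" for y
      unfolding u_def using hp[of "Suc k"] s_pos[of k]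
      by (intro mult_nonneg_nonneg divide_nonneg_nonneg) (auto simp: less_imp_le)
  qed
  have gu: "near r (dist x y) = 0 \<or> (\<exists>k. near r (dist x y) \<le> u k y)" for y
  proof (cases "0 < dist x y \<and> dist x y < r")
    case True
    let ?d = "dist x y"
    define m where "m = (LEAST n. s n \<le> ?d)"
    obtain n where "(1/2) ^ n < ?d / r"
      using real_arch_pow_inv[of "?d / r" "1/2"] True r by auto
    then have "s n \<le> ?d" using r by (simp add: s_def field_simps)
    then have m: "s m \<le> ?d" unfolding m_def by (rule LeastI)
    have "m \<noteq> 0" using m True by (cases m) (auto simp: s_def)
    then obtain k where k: "m = Suc k" by (cases m) auto
    have k2: "?d < s k" using not_less_Least[of k "\<lambda>n. s n \<le> ?d"] k m_def by auto
    have "near r ?d = ?d / h ?d" using True by (simp add: near_def)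
    also have "\<dots> \<le> s k / h (s (Suc k))"
      using k2 m k hp[of "Suc k"] h_mono[OF s_pos[of "Suc k"], of ?d] s_pos[of k]
      by (intro frac_le) (auto simp: less_imp_le)
    also have "\<dots> = u k y" using k2 by (simp add: u_def)
    finally show ?thesis by blast
  qed (auto simp: near_def)
  have B: "(\<integral>y. u k y \<partial>M) \<le> (1/2)^k * (C * A * r)" for k
  proof -
    have "(\<integral>y. u k y \<partial>M) = s k / h (s (Suc k)) * measure M (ball x (s k))"
      by (simp add: u_def)
    also have "\<dots> \<le> s k / h (s (Suc k)) * (A * (C * h (s (Suc k))))"
    proof -
      have "measure M (ball x (s k)) \<le> A * h (s k)" by (rule A[OF s_pos s_le])
      also have "\<dots> \<le> A * (C * h (s (Suc k)))"
        using h_doubling[OF s_pos[of "Suc k"]] A0' s_Suc[of k] by (intro mult_left_mono) auto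
      finally show ?thesis using s_pos[of k] hp[of "Suc k"] by (intro mult_left_mono) (auto simp: less_imp_le)
    qed
    also have "\<dots> = s k * (C * A)" using hp[of "Suc k"] by (simp add: field_simps)
    finally show ?thesis by (simp add: s_def mult_ac)
  qed
  from dyadic_majorant[OF near_meas near_nonneg u gu B]
  show "integrable M (\<lambda>y. near r (dist x y))"
    "(\<integral>y. near r (dist x y) \<partial>M) \<le> 2 * (C * A * r)"
    by auto
qed

lemma T_cut_diff:
  assumes "0 < a" "a \<le> b" "integrable M f"
  shows "\<bar>T a f x - T b f x\<bar> \<le> mass f x b / h a"
proof -
  have "T a f x - T b f x = (\<integral>y. TK a x y * f y - TK b x y * f y \<partial>M)"
    unfolding T_eq using assms TK_integrable[of _ f] by (subst Bochner_Integration.integral_diff) auto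
  also have "\<bar>\<dots>\<bar> \<le> (\<integral>y. 1 / h a * (indicator (ball x b) y * \<bar>f y\<bar>) \<partial>M)"
  proof (rule abs_integral_le)
    show "integrable M (\<lambda>y. 1 / h a * (indicator (ball x b) y * \<bar>f y\<bar>))"
      using mass_integrable[OF _ assms(3)] by auto
    fix y
    have "\<bar>TK a x y * f y - TK b x y * f y\<bar> = \<bar>TK a x y - TK b x y\<bar> * \<bar>f y\<bar>"
      by (simp add: abs_mult flip: left_diff_distrib)
    also have "\<bar>TK a x y - TK b x y\<bar> \<le> 1 / h a * indicator (ball x b) y"
      using TK_bound[OF assms(1), of x y] h_pos[OF assms(1)] assms by (auto simp: TK_def)
    finally show "\<bar>TK a x y * f y - TK b x y * f y\<bar> \<le> 1 / h a * (indicator (ball x b) y * \<bar>f y\<bar>)"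
      by (simp add: mult_right_mono mult.assoc del: times_divide_eq_left)
  qed
  finally show ?thesis by (simp add: mass_def)
qed

text \<open>The first condition ensures that the truncation at \<open>z\<close> removes nothing that
  lies outside \<open>ball x r\<close>; the second is the range of the smoothness condition. The
  difference of the kernels is then dominated by \<open>far\<close>.\<close>

lemma T_smooth_diff:
  assumes \<delta>: "0 < \<delta>" "\<delta> + dist x z \<le> r" "2 * dist x z < r" and f: "integrable M f"
    and A: "\<And>s. s \<ge> r \<Longrightarrow> mass f x s \<le> A * h s" "A \<ge> 0"
  shows "\<bar>T r f x - T \<delta> (\<lambda>y. indicator (- ball x r) y * f y) z\<bar> \<le> dist x z / r * (2 * (C * A))"
proof -
  define e where "e = dist x z"
  have r: "r > 0" using \<delta> zero_le_dist[of x z] by linarith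
  have If: "integrable M (\<lambda>y. indicator (- ball x r) y * f y)"
    using integrable_mult_indicator[of "- ball x r" M f] f by simp
  have "T r f x - T \<delta> (\<lambda>y. indicator (- ball x r) y * f y) z
      = (\<integral>y. TK r x y * f y - TK \<delta> z y * (indicator (- ball x r) y * f y) \<partial>M)"
    unfolding T_eq using TK_integrable[OF r f] TK_integrable[OF \<delta>(1) If]
    by (subst Bochner_Integration.integral_diff) auto
  also have "\<bar>\<dots>\<bar> \<le> (\<integral>y. e / r * (far r (dist x y) * \<bar>f y\<bar>) \<partial>M)"
  proof (rule abs_integral_le)
    show "integrable M (\<lambda>y. e / r * (far r (dist x y) * \<bar>f y\<bar>))"
      using far_integral(1)[OF r f A] by auto
    fix y
    show "\<bar>TK r x y * f y - TK \<delta> z y * (indicator (- ball x r) y * f y)\<bar>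
        \<le> e / r * (far r (dist x y) * \<bar>f y\<bar>)"
    proof (cases "r \<le> dist x y")
      case True
      have zy: "dist x y \<le> dist x z + dist z y" by (rule dist_triangle)
      then have 1: "\<delta> \<le> dist z y" using True \<delta> by linarith
      have ne: "y \<noteq> x" "z \<noteq> y" using True r 1 \<delta> by auto
      \<comment> \<open>The smoothness condition concerns the second variable; antisymmetry moves
        the difference there.\<close>
      have "K x y - K z y = - (K y x - K y z)" using antisym[of x y] antisym[of z y] ne by auto
      then have "\<bar>K x y - K z y\<bar> = \<bar>K y x - K y z\<bar>" by simp
      also have "\<dots> \<le> dist x z / (dist y x * h (dist y x))"
        using ne \<delta> True by (intro K_smooth) (auto simp: dist_commute)
      also have "\<dots> = e / r * far r (dist x y)"
        using True r by (simp add: far_def e_def dist_commute)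
      finally have "\<bar>K x y - K z y\<bar> * \<bar>f y\<bar> \<le> e / r * far r (dist x y) * \<bar>f y\<bar>"
        by (intro mult_right_mono) auto
      moreover have "TK r x y * f y - TK \<delta> z y * (indicator (- ball x r) y * f y) = (K x y - K z y) * f y"
        using True 1 by (simp add: TK_def left_diff_distrib)
      ultimately show ?thesis by (simp add: abs_mult mult.assoc)
    qed (simp add: TK_def far_def)
  qed
  also have "\<dots> = e / r * (\<integral>y. far r (dist x y) * \<bar>f y\<bar> \<partial>M)" by simp
  also have "\<dots> \<le> e / r * (2 * (C * A))"
    using far_integral(2)[OF r f A] r by (intro mult_left_mono) (auto simp: e_def)
  finally show ?thesis by (simp add: e_def)
qed

text \<open>Hormander's condition: because \<sigma> has mean zero, \<open>K x c\<close> may be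
  subtracted from the kernel, and \<open>far\<close> dominates the difference. This contributes
  \<open>2 * C\<close>. The truncation may cut through the ball only for \<open>x\<close> within
  \<open>2 * \<delta>\<close> of \<open>c\<close>, where the crude bound by
  \<open>1 / h \<delta>\<close> costs another \<open>C\<close>.\<close>

lemma T_hormander:
  assumes \<delta>: "\<delta> > 0" and \<rho>: "\<rho> > 0" and \<sigma>: "integrable M \<sigma>" "(\<integral>y. \<sigma> y \<partial>M) = 0"
    and supp: "\<And>y. dist c y > \<rho> \<Longrightarrow> \<sigma> y = 0"
  shows "(\<integral>x. indicator {x. 3 * \<rho> \<le> dist c x} x * \<bar>T \<delta> \<sigma> x\<bar> \<partial>M) \<le> 3 * C * (\<integral>y. \<bar>\<sigma> y\<bar> \<partial>M)"
proof -
  define S where "S = (\<integral>y. \<bar>\<sigma> y\<bar> \<partial>M)"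
  have S: "S \<ge> 0" unfolding S_def by (intro integral_nonneg_AE) auto
  have pt: "indicator {x. 3 * \<rho> \<le> dist c x} x * \<bar>T \<delta> \<sigma> x\<bar>
      \<le> S * far \<rho> (dist c x) + S / h \<delta> * indicator (ball c (2 * \<delta>)) x" for x
  proof (cases "3 * \<rho> \<le> dist c x")
    case True
    let ?d = "dist c x"
    have far0: "0 \<le> S * far \<rho> ?d" using S far_nonneg[OF \<rho>] by simp
    have h0: "h \<delta> > 0" using h_pos[OF \<delta>] .
    \<comment> \<open>The support of \<sigma> lies beyond the truncation radius seen from
      \<open>x\<close>, strictly inside it, or possibly across it.\<close>
    consider "\<delta> \<le> ?d - \<rho>" | "?d + \<rho> < \<delta>" | "?d - \<rho> < \<delta>" "\<delta> \<le> ?d + \<rho>" by linarith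
    then have "\<bar>T \<delta> \<sigma> x\<bar> \<le> S * far \<rho> ?d + S / h \<delta> * indicator (ball c (2 * \<delta>)) x"
    proof cases
      case 1
      have "T \<delta> \<sigma> x = (\<integral>y. TK \<delta> x y * \<sigma> y \<partial>M) - (\<integral>y. K x c * \<sigma> y \<partial>M)"
        using \<sigma>(2) by (simp add: T_eq)
      also have "\<dots> = (\<integral>y. TK \<delta> x y * \<sigma> y - K x c * \<sigma> y \<partial>M)"
        using TK_integrable[OF \<delta> \<sigma>(1)] \<sigma>(1) by (subst Bochner_Integration.integral_diff) auto
      also have "\<bar>\<dots>\<bar> \<le> (\<integral>y. far \<rho> ?d * \<bar>\<sigma> y\<bar> \<partial>M)"
      proof (rule abs_integral_le)
        fix y
        show "\<bar>TK \<delta> x y * \<sigma> y - K x c * \<sigma> y\<bar> \<le> far \<rho> ?d * \<bar>\<sigma> y\<bar>"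
        proof (cases "dist c y > \<rho>")
          case False
          have "?d \<le> dist c y + dist x y" using dist_triangle[of c x y] by (simp add: dist_commute)
          then have 2: "\<delta> \<le> dist x y" using 1 False by linarith
          have "\<bar>K x y - K x c\<bar> = \<bar>K x c - K x y\<bar>" by simp
          also have "\<dots> \<le> dist c y / (dist x c * h (dist x c))"
            using True False \<rho> 2 \<delta> by (intro K_smooth) (auto simp: dist_commute)
          also have "\<dots> \<le> \<rho> / (dist x c * h (dist x c))"
            using False h_pos[of "dist x c"] 2
            by (intro divide_right_mono mult_nonneg_nonneg) (use True \<rho> in \<open>auto simp: dist_commute intro!: less_imp_le[OF h_pos]\<close>)
          also have "\<dots> = far \<rho> ?d" using True \<rho> by (simp add: far_def dist_commute)
          finally have "\<bar>K x y - K x c\<bar> * \<bar>\<sigma> y\<bar> \<le> far \<rho> ?d * \<bar>\<sigma> y\<bar>" by (intro mult_right_mono) auto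
          then show ?thesis using 2 by (simp add: TK_def abs_mult flip: left_diff_distrib)
        qed (simp add: supp)
      qed (use \<sigma> in auto)
      also have "\<dots> = S * far \<rho> ?d" by (simp add: S_def)
      finally show ?thesis using S h0 by (simp add: add_increasing2 less_imp_le)
    next
      case 2
      have "TK \<delta> x y * \<sigma> y = 0" for y
      proof (cases "dist c y > \<rho>")
        case False
        have "dist x y \<le> ?d + dist c y" using dist_triangle[of x y c] by (simp add: dist_commute)
        then show ?thesis using 2 False by (simp add: TK_def)
      qed (simp add: supp)
      then have "T \<delta> \<sigma> x = 0" by (simp only: T_eq) simp
      then show ?thesis using far0 S h0 by (simp add: indicator_def less_imp_le)
    next
      case 3
      have "?d < 2 * \<delta>" using 3 True \<rho> by linarith
      then show ?thesis using T_bound[OF \<delta> \<sigma>(1), of x] far0 by (simp add: S_def)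
    qed
    then show ?thesis using True by simp
  next
    case False
    then show ?thesis using S far_nonneg[OF \<rho>] h_pos[OF \<delta>] by (simp add: indicator_def less_imp_le)
  qed
  have I1: "integrable M (\<lambda>x. S * far \<rho> (dist c x))" using far_integral_one(1)[OF \<rho>] by auto
  have I2: "integrable M (\<lambda>x. S / h \<delta> * indicator (ball c (2 * \<delta>)) x)"
    by (intro integrable_mult_right indicator_integrable) auto
  have "(\<integral>x. indicator {x. 3 * \<rho> \<le> dist c x} x * \<bar>T \<delta> \<sigma> x\<bar> \<partial>M)
      \<le> \<bar>\<integral>x. indicator {x. 3 * \<rho> \<le> dist c x} x * \<bar>T \<delta> \<sigma> x\<bar> \<partial>M\<bar>" by simp
  also have "\<dots> \<le> (\<integral>x. S * far \<rho> (dist c x) + S / h \<delta> * indicator (ball c (2 * \<delta>)) x \<partial>M)"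
    using I1 I2 pt by (intro abs_integral_le) auto
  also have "\<dots> = S * (\<integral>x. far \<rho> (dist c x) \<partial>M) + S / h \<delta> * measure M (ball c (2 * \<delta>))"
    using I1 I2 by (subst Bochner_Integration.integral_add) auto
  also have "\<dots> \<le> S * (2 * C) + S / h \<delta> * (C * h \<delta>)"
  proof (intro add_mono mult_left_mono)
    show "(\<integral>x. far \<rho> (dist c x) \<partial>M) \<le> 2 * C" by (rule far_integral_one(2)[OF \<rho>])
    show "measure M (ball c (2 * \<delta>)) \<le> C * h \<delta>"
      using growth[of "2 * \<delta>" c] h_doubling[OF \<delta>] \<delta> by linarith
  qed (use S h_pos[OF \<delta>] in \<open>auto simp: less_imp_le\<close>)
  also have "\<dots> = 3 * C * S" using h_pos[OF \<delta>] by (simp add: field_simps)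
  finally show ?thesis by (simp add: S_def)
qed

end

section \<open>Weak type (1,1) of the truncations\<close>

lemma (in finite_measure) chebyshev_measure:
  assumes "integrable M u" "\<And>x. 0 \<le> u x" "A \<in> sets M" "\<And>x. x \<in> A \<Longrightarrow> t \<le> u x"
  shows "t * measure M A \<le> (\<integral>x. u x \<partial>M)"
proof -
  have "t * measure M A = (\<integral>x. t * indicator A x \<partial>M)" using sets.sets_into_space[OF assms(3)] by (simp add: Int_absorb2)
  also have "\<dots> \<le> (\<integral>x. u x \<partial>M)"
    using assms by (intro integral_mono integrable_mult_right integrable_real_indicator)
      (auto simp: emeasure_eq_measure indicator_def)
  finally show ?thesis .
qed

section \<open>Weights of prescribed mass with total density at most one\<close>

context singular_kernel
begin

lemma bounded_integrable:
  fixes f :: "'a \<Rightarrow> real"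
  assumes "f \<in> borel_measurable M" "\<And>x. \<bar>f x\<bar> \<le> B"
  shows "integrable M f"
  using assms by (intro integrable_const_bound[of _ B]) auto

lemma indicator_mult_integrable:
  fixes f :: "'a \<Rightarrow> real"
  assumes "A \<in> sets M" "integrable M f"
  shows "integrable M (\<lambda>y. indicator A y * f y)"
  using integrable_mult_indicator[OF assms] by simp

text \<open>Fill the density \<open>V\<close> outwards from \<open>c\<close> until the mass
  \<open>a\<close> is reached. The last sphere may carry positive mass; it is then filled only in
  part.\<close>

lemma weight_step:
  fixes V :: "'a \<Rightarrow> real"
  assumes V: "V \<in> borel_measurable M" "\<And>y. 0 \<le> V y" "\<And>y. V y \<le> 1"
    and a: "0 \<le> a" "a < (\<integral>y. V y \<partial>M)"
  obtains w \<rho> where "w \<in> borel_measurable M" "\<And>y. 0 \<le> w y" "\<And>y. w y \<le> V y" "\<rho> \<ge> 0"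
    "\<And>y. dist c y < \<rho> \<Longrightarrow> w y = V y" "\<And>y. \<rho> < dist c y \<Longrightarrow> w y = 0" "(\<integral>y. w y \<partial>M) = a"
proof -
  have IV: "integrable M V" using V by (intro bounded_integrable[of _ 1]) auto
  have IA: "integrable M (\<lambda>y. indicator A y * V y)" if "A \<in> sets M" for A
    using indicator_mult_integrable[OF that IV] .
  define \<phi> where "\<phi> r = (\<integral>y. indicator (ball c r) y * V y \<partial>M)" for r
  have mono: "\<phi> r \<le> \<phi> s" if "r \<le> s" for r s
    unfolding \<phi>_def using that V by (intro integral_mono IA) (auto simp: indicator_def)
  have lim_incr: "(\<lambda>n. \<integral>y. indicator (A n) y * V y \<partial>M) \<longlonglongrightarrow> (\<integral>y. indicator B y * V y \<partial>M)"
    if "\<And>n. A n \<in> sets M" "B \<in> sets M"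
      "\<And>y. (\<lambda>n. indicator (A n) y :: real) \<longlonglongrightarrow> indicator B y" for A B
  proof (rule integral_dominated_convergence[where w=V])
    show "AE y in M. (\<lambda>n. indicator (A n) y * V y) \<longlonglongrightarrow> indicator B y * V y"
      by (intro AE_I2 tendsto_mult that(3) tendsto_const)
    show "AE y in M. norm (indicator (A n) y * V y) \<le> V y" for n
      using V(2) by (intro AE_I2) (simp add: indicator_def)
    show "(\<lambda>y. indicator (B) y * V y) \<in> borel_measurable M" "integrable M V"
      "\<And>n. (\<lambda>y. indicator (A n) y * V y) \<in> borel_measurable M"
      using that(1,2) IV by (auto intro!: borel_measurable_times borel_measurable_indicator V(1))
  qed
  have "(\<lambda>n. \<phi> (real n)) \<longlonglongrightarrow> (\<integral>y. indicator UNIV y * V y \<partial>M)"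
    unfolding \<phi>_def
  proof (rule lim_incr)
    fix y
    have "\<forall>\<^sub>F n in sequentially. dist c y < real n"
      using filterlim_real_sequentially unfolding filterlim_at_top_dense by blast
    then show "(\<lambda>n. indicator (ball c (real n)) y :: real) \<longlonglongrightarrow> indicator UNIV y"
      by (intro tendsto_eventually) (auto elim: eventually_mono)
  qed auto
  then have "\<forall>\<^sub>F n in sequentially. a < \<phi> (real n)" using a by (intro order_tendstoD) auto
  then obtain n0 where n0: "a < \<phi> (real n0)" by (auto simp: eventually_sequentially)
  \<comment> \<open>Since \<open>a\<close> is strictly below the total mass of \<open>V\<close>,
    this set of radii is bounded, and the critical radius is finite.\<close>
  define S where "S = {r. 0 \<le> r \<and> \<phi> r \<le> a}"
  have "\<phi> 0 = 0" by (simp add: \<phi>_def)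
  then have S0: "0 \<in> S" using a by (simp add: S_def)
  have Sb: "r \<le> real n0" if "r \<in> S" for r
  proof (rule ccontr)
    assume "\<not> r \<le> real n0"
    then have "\<phi> (real n0) \<le> \<phi> r" by (intro mono) auto
    then show False using that n0 by (auto simp: S_def)
  qed
  then have bdd: "bdd_above S" by (auto simp: bdd_above_def)
  define \<rho> where "\<rho> = Sup S"
  have \<rho>0: "0 \<le> \<rho>" unfolding \<rho>_def using S0 bdd by (rule cSup_upper)
  have lt: "\<phi> r \<le> a" if r: "r < \<rho>" for r
  proof -
    obtain s where "s \<in> S" "r < s" using less_cSupD[of S r] S0 r unfolding \<rho>_def by auto
    then show ?thesis using mono[of r s] by (auto simp: S_def)
  qed
  have gt: "a \<le> \<phi> r" if r: "\<rho> < r" for r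
  proof (rule ccontr)
    assume "\<not> a \<le> \<phi> r"
    then have "r \<in> S" using r \<rho>0 by (auto simp: S_def)
    then show False using cSup_upper[OF _ bdd] r unfolding \<rho>_def by fastforce
  qed
  have lim1: "(\<lambda>n. \<rho> - inverse (real (Suc n))) \<longlonglongrightarrow> \<rho>" "(\<lambda>n. \<rho> + inverse (real (Suc n))) \<longlonglongrightarrow> \<rho>"
    using tendsto_diff[OF tendsto_const LIMSEQ_inverse_real_of_nat, of \<rho>]
      tendsto_add[OF tendsto_const LIMSEQ_inverse_real_of_nat, of \<rho>] by auto
  have "(\<lambda>n. \<phi> (\<rho> - inverse (real (Suc n)))) \<longlonglongrightarrow> \<phi> \<rho>"
    unfolding \<phi>_def
  proof (rule lim_incr)
    fix y
    have "\<forall>\<^sub>F n in sequentially. (indicator (ball c (\<rho> - inverse (real (Suc n)))) y :: real) = indicator (ball c \<rho>) y"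
    proof (cases "dist c y < \<rho>")
      case True
      then have "\<forall>\<^sub>F n in sequentially. dist c y < \<rho> - inverse (real (Suc n))"
        using lim1(1) by (intro order_tendstoD) auto
      then show ?thesis by eventually_elim (use True in auto)
    next
      case False
      have "0 < inverse (real (Suc n))" for n by simp
      then have "\<not> dist c y < \<rho> - inverse (real (Suc n))" for n using False by (smt (verit))
      then show ?thesis using False by simp
    qed
    then show "(\<lambda>n. indicator (ball c (\<rho> - inverse (real (Suc n)))) y :: real) \<longlonglongrightarrow> indicator (ball c \<rho>) y"
      by (rule tendsto_eventually)
  qed auto
  then have op: "\<phi> \<rho> \<le> a" by (rule LIMSEQ_le_const2) (auto intro!: lt exI[of _ 0])
  define \<psi> where "\<psi> = (\<integral>y. indicator (cball c \<rho>) y * V y \<partial>M)"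
  have "(\<lambda>n. \<phi> (\<rho> + inverse (real (Suc n)))) \<longlonglongrightarrow> \<psi>"
    unfolding \<phi>_def \<psi>_def
  proof (rule lim_incr)
    fix y
    have "\<forall>\<^sub>F n in sequentially. (indicator (ball c (\<rho> + inverse (real (Suc n)))) y :: real) = indicator (cball c \<rho>) y"
    proof (cases "dist c y \<le> \<rho>")
      case False
      then have "\<forall>\<^sub>F n in sequentially. \<rho> + inverse (real (Suc n)) < dist c y"
        using lim1(2) by (intro order_tendstoD) auto
      then show ?thesis by eventually_elim (use False in auto)
    next
      case True
      have "0 < inverse (real (Suc n))" for n by simp
      then have "dist c y < \<rho> + inverse (real (Suc n))" for n using True by (smt (verit))
      then show ?thesis using True by simp
    qed
    then show "(\<lambda>n. indicator (ball c (\<rho> + inverse (real (Suc n)))) y :: real) \<longlonglongrightarrow> indicator (cball c \<rho>) y"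
      by (rule tendsto_eventually)
  qed auto
  then have cl: "a \<le> \<psi>" by (rule LIMSEQ_le_const) (auto intro!: gt exI[of _ 0])
  \<comment> \<open>The open ball of radius \<rho> holds at most the mass \<open>a\<close> and the
    closed one at least \<open>a\<close>, so a constant fraction of \<open>V\<close> on the sphere
    makes up the difference.\<close>
  obtain \<theta> where \<theta>: "0 \<le> \<theta>" "\<theta> \<le> 1" "\<phi> \<rho> + \<theta> * (\<psi> - \<phi> \<rho>) = a"
  proof (cases "\<psi> = \<phi> \<rho>")
    case True
    then show ?thesis using that[of 0] op cl by simp
  next
    case False
    then have "\<psi> - \<phi> \<rho> > 0" using op cl by auto
    then show ?thesis using that[of "(a - \<phi> \<rho>) / (\<psi> - \<phi> \<rho>)"] op cl by (simp add: field_simps)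
  qed
  define w where "w y = indicator (ball c \<rho>) y * V y + \<theta> * (indicator (cball c \<rho>) y * V y - indicator (ball c \<rho>) y * V y)" for y
  show ?thesis
  proof (rule that[of w \<rho>])
    show "w \<in> borel_measurable M" unfolding w_def[abs_def]
      by (intro borel_measurable_add borel_measurable_diff borel_measurable_times borel_measurable_const
          borel_measurable_indicator V(1)) auto
    show "(\<integral>y. w y \<partial>M) = a"
      using IA \<theta>(3) by (simp add: w_def \<phi>_def \<psi>_def)
    fix y
    consider "dist c y < \<rho>" | "dist c y = \<rho>" | "\<rho> < dist c y" by linarith
    then have "w y = V y \<and> dist c y < \<rho> \<or> w y = \<theta> * V y \<and> dist c y = \<rho> \<or> w y = 0 \<and> \<rho> < dist c y"
      by cases (auto simp: w_def)
    moreover have "\<theta> * V y \<le> V y" using \<theta> V by (simp add: mult_left_le_one_le)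
    ultimately show "0 \<le> w y" "w y \<le> V y" "dist c y < \<rho> \<Longrightarrow> w y = V y" "\<rho> < dist c y \<Longrightarrow> w y = 0"
      using \<theta> V(2)[of y] by auto
  qed (rule \<rho>0)
qed

text \<open>These weights spread the mass of the bad part of a function over the smallest balls on
  which density at most one leaves room for it; they replace Calderon-Zygmund cubes in the
  absence of doubling.\<close>

lemma exists_weights:
  fixes c :: "nat \<Rightarrow> 'a" and a :: "nat \<Rightarrow> real"
  assumes "\<And>i. i < n \<Longrightarrow> 0 \<le> a i" "(\<Sum>i<n. a i) < measure M UNIV"
  shows "\<exists>w \<rho>. (\<forall>i<n. w i \<in> borel_measurable M \<and> (\<forall>y. 0 \<le> w i y) \<and> 0 \<le> \<rho> i \<and> (\<integral>y. w i y \<partial>M) = a i \<and>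
       (\<forall>y. \<rho> i < dist (c i) y \<longrightarrow> w i y = 0)) \<and>
     (\<forall>y. (\<Sum>i<n. w i y) \<le> 1) \<and> (\<forall>i<n. \<forall>y. dist (c i) y < \<rho> i \<longrightarrow> (\<Sum>j<n. w j y) = 1)"
  using assms
proof (induction n)
  case 0
  show ?case by (intro exI[of _ "\<lambda>_ _. 0"] exI[of _ "\<lambda>_. 0"]) auto
next
  case (Suc n)
  have "(\<Sum>i<n. a i) < measure M UNIV" using Suc.prems(1)[of n] Suc.prems(2) by simp
  with Suc.IH[OF Suc.prems(1)] obtain w \<rho> where H:
    "\<forall>i<n. w i \<in> borel_measurable M \<and> (\<forall>y. 0 \<le> w i y) \<and> 0 \<le> \<rho> i \<and> (\<integral>y. w i y \<partial>M) = a i \<and>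
       (\<forall>y. \<rho> i < dist (c i) y \<longrightarrow> w i y = 0)"
    "\<forall>y. (\<Sum>i<n. w i y) \<le> 1" "\<forall>i<n. \<forall>y. dist (c i) y < \<rho> i \<longrightarrow> (\<Sum>j<n. w j y) = 1"
    by auto
  have w: "\<And>i. i < n \<Longrightarrow> w i \<in> borel_measurable M" "\<And>i y. i < n \<Longrightarrow> 0 \<le> w i y"
    "\<And>i. i < n \<Longrightarrow> 0 \<le> \<rho> i" "\<And>i. i < n \<Longrightarrow> (\<integral>y. w i y \<partial>M) = a i"
    "\<And>i y. i < n \<Longrightarrow> \<rho> i < dist (c i) y \<Longrightarrow> w i y = 0" "\<And>y. (\<Sum>i<n. w i y) \<le> 1"
    "\<And>i y. i < n \<Longrightarrow> dist (c i) y < \<rho> i \<Longrightarrow> (\<Sum>j<n. w j y) = 1"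
    using H by simp_all
  \<comment> \<open>The room that the earlier weights leave below density one. Its total exceeds
    \<open>a n\<close> because all the masses together stay below the total measure. The new weight
    uses up this room in its open ball, which brings the sum to 1 there.\<close>
  define V where "V y = 1 - (\<Sum>i<n. w i y)" for y
  have V: "V \<in> borel_measurable M" unfolding V_def[abs_def] using w(1) by auto
  have V01: "0 \<le> V y" "V y \<le> 1" for y
    using w(6)[of y] sum_nonneg[of "{..<n}" "\<lambda>i. w i y"] w(2) by (auto simp: V_def)
  have wle: "w i y \<le> 1" if "i < n" for i y
    using member_le_sum[of i "{..<n}" "\<lambda>i. w i y"] w(2) w(6)[of y] that by auto
  have Iw: "integrable M (w i)" if "i < n" for i
    using w(1,2) wle that by (intro bounded_integrable[of _ 1]) auto
  have "(\<integral>y. V y \<partial>M) = measure M UNIV - (\<Sum>i<n. a i)"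
    unfolding V_def using Iw w(4) by (subst Bochner_Integration.integral_diff) (auto simp: Bochner_Integration.integral_sum)
  then have "a n < (\<integral>y. V y \<partial>M)" using Suc.prems(2) by simp
  then obtain w' \<rho>' where w': "w' \<in> borel_measurable M" "\<And>y. 0 \<le> w' y" "\<And>y. w' y \<le> V y" "\<rho>' \<ge> 0"
    "\<And>y. dist (c n) y < \<rho>' \<Longrightarrow> w' y = V y" "\<And>y. \<rho>' < dist (c n) y \<Longrightarrow> w' y = 0" "(\<integral>y. w' y \<partial>M) = a n"
    by (rule weight_step[OF V V01 Suc.prems(1)[OF lessI], of "c n"]) (rule that)
  have sum: "(\<Sum>j<Suc n. (w(n := w')) j y) = (\<Sum>j<n. w j y) + w' y" for y by simp
  show ?case
  proof (intro exI[of _ "w(n := w')"] exI[of _ "\<rho>(n := \<rho>')"] conjI allI impI)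
    fix y show "(\<Sum>i<Suc n. (w(n := w')) i y) \<le> 1"
      unfolding sum using w'(3)[of y] by (simp add: V_def)
  next
    fix i y assume i: "i < Suc n" "dist (c i) y < (\<rho>(n := \<rho>')) i"
    show "(\<Sum>j<Suc n. (w(n := w')) j y) = 1"
    proof (cases "i = n")
      case True
      then show ?thesis unfolding sum using i w'(5)[of y] by (simp add: V_def)
    next
      case False
      then have "(\<Sum>j<n. w j y) = 1" using i w(7)[of i y] by simp
      then show ?thesis unfolding sum using w'(2,3)[of y] by (simp add: V_def)
    qed
  qed (use w w' in \<open>auto simp: less_Suc_eq\<close>)
qed

end

section \<open>Consequences of the L2 bound for the maximal operator\<close>

locale bounded_singular_kernel = singular_kernel +
  fixes C0 :: real
  assumes C0: "C0 \<ge> 0"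
    and maximal_L2: "\<And>f. f \<in> L2 M \<Longrightarrow>
      (\<integral>\<^sup>+x. (maximal_op M K f x)\<^sup>2 \<partial>M) \<le> ennreal (C0 * (\<integral>x. (f x)\<^sup>2 \<partial>M))"
begin

lemma bounded_in_L2:
  fixes f :: "'a \<Rightarrow> real"
  assumes "f \<in> borel_measurable M" "\<And>x. \<bar>f x\<bar> \<le> B"
  shows "f \<in> L2 M"
proof -
  have "(f x)\<^sup>2 \<le> B\<^sup>2" for x using assms(2)[of x] by (simp add: abs_le_square_iff[symmetric] abs_of_nonneg order_trans[OF abs_ge_zero])
  then show ?thesis unfolding L2_def using assms by (auto intro!: bounded_integrable[of _ "B\<^sup>2"])
qed

text \<open>The maximal operator is a supremum over uncountably many truncations. The bound for it,
  in which the nonnegative integral is monotone for arbitrary functions, is therefore used through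
  measurable minorants \<open>V\<close>.\<close>

lemma maximal_countable_L2:
  assumes f: "f \<in> L2 M" and V: "V \<in> borel_measurable M" "\<And>x. 0 \<le> V x"
    "AE x in M. ennreal (V x) \<le> maximal_op M K f x"
  shows "integrable M (\<lambda>x. (V x)\<^sup>2)" "(\<integral>x. (V x)\<^sup>2 \<partial>M) \<le> C0 * (\<integral>x. (f x)\<^sup>2 \<partial>M)"
proof -
  have nn: "0 \<le> (\<integral>x. (f x)\<^sup>2 \<partial>M)" by (intro integral_nonneg_AE) auto
  have "(\<integral>\<^sup>+x. ennreal ((V x)\<^sup>2) \<partial>M) \<le> (\<integral>\<^sup>+x. (maximal_op M K f x)\<^sup>2 \<partial>M)"
    using V(3)
    by (intro nn_integral_mono_AE, eventually_elim) (auto simp: V(2) ennreal_power[symmetric] intro!: power_mono)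
  also have "\<dots> \<le> ennreal (C0 * (\<integral>x. (f x)\<^sup>2 \<partial>M))" by (rule maximal_L2[OF f])
  finally have le: "(\<integral>\<^sup>+x. ennreal ((V x)\<^sup>2) \<partial>M) \<le> ennreal (C0 * (\<integral>x. (f x)\<^sup>2 \<partial>M))" .
  show I: "integrable M (\<lambda>x. (V x)\<^sup>2)"
    using V le by (intro integrableI_bounded) (auto intro: le_less_trans)
  show "(\<integral>x. (V x)\<^sup>2 \<partial>M) \<le> C0 * (\<integral>x. (f x)\<^sup>2 \<partial>M)"
    using le nn_integral_eq_integral[OF I] nn C0 by auto
qed

lemma T_le_maximal: "\<epsilon> > 0 \<Longrightarrow> ennreal \<bar>T \<epsilon> f x\<bar> \<le> maximal_op M K f x"
  unfolding maximal_op_def by (intro SUP_upper) auto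

lemma T_L2:
  assumes "f \<in> L2 M" "\<delta> > 0"
  shows "integrable M (\<lambda>x. (T \<delta> f x)\<^sup>2)" "(\<integral>x. (T \<delta> f x)\<^sup>2 \<partial>M) \<le> C0 * (\<integral>x. (f x)\<^sup>2 \<partial>M)"
  using maximal_countable_L2[OF assms(1), of "\<lambda>x. \<bar>T \<delta> f x\<bar>"] assms T_le_maximal
  by (auto simp: L2_def)

lemma T_L2_measure:
  assumes "f \<in> L2 M" "\<delta> > 0" "t > 0"
  shows "measure M {x. \<bar>T \<delta> f x\<bar> > t} \<le> C0 * (\<integral>x. (f x)\<^sup>2 \<partial>M) / t\<^sup>2"
proof -
  have "t\<^sup>2 * measure M {x. \<bar>T \<delta> f x\<bar> > t} \<le> (\<integral>x. (T \<delta> f x)\<^sup>2 \<partial>M)"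
  proof (rule chebyshev_measure)
    show "{x. \<bar>T \<delta> f x\<bar> > t} \<in> sets M" using assms by (intro T_superlevel_sets) (auto simp: L2_def)
    show "t\<^sup>2 \<le> (T \<delta> f x)\<^sup>2" if "x \<in> {x. \<bar>T \<delta> f x\<bar> > t}" for x
      using that assms(3) by (simp add: abs_le_square_iff[symmetric])
  qed (use T_L2[OF assms(1,2)] in auto)
  also have "\<dots> \<le> C0 * (\<integral>x. (f x)\<^sup>2 \<partial>M)" by (rule T_L2(2)[OF assms(1,2)])
  finally show ?thesis using assms(3) by (simp add: field_simps)
qed

end

section \<open>Localisation to balls and the local part of the weights\<close>

context singular_kernel
begin

text \<open>Cutting \<open>u\<close> down to a ball costs one further truncation. Since
  \<open>y\<close> is within \<open>r\<close> of \<open>c\<close>, the ball of radius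
  \<open>3 * r\<close> at \<open>c\<close> contains the one of radius \<open>2 * r\<close> at
  \<open>y\<close> and is contained in the one of radius \<open>4 * r\<close>. What remains lives at
  distances between \<open>2 * r\<close> and \<open>4 * r\<close> from \<open>y\<close>, where the
  kernel is at most \<open>1 / h (2 * r)\<close> and the measure at most
  \<open>C * h (2 * r)\<close>.\<close>

lemma T_local_part:
  fixes u :: "'a \<Rightarrow> real"
  assumes u: "u \<in> borel_measurable M" "\<And>x. \<bar>u x\<bar> \<le> 1" and r: "r > 0" and \<delta>: "\<delta> > 0"
    and y: "dist c y \<le> r"
  shows "\<bar>T \<delta> (\<lambda>z. indicator (ball c (3 * r)) z * u z) y\<bar> \<le> \<bar>T \<delta> u y\<bar> + \<bar>T (max \<delta> (4 * r)) u y\<bar> + C"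
proof -
  let ?B = "ball c (3 * r)" and ?R = "max \<delta> (4 * r)"
  have Iu: "integrable M u" using bounded_integrable[OF u] .
  have IB: "integrable M (\<lambda>z. indicator ?B z * u z)"
    using indicator_mult_integrable[of ?B u] Iu by simp
  have R: "?R > 0" using \<delta> by simp
  have eq: "T \<delta> u y - T \<delta> (\<lambda>z. indicator ?B z * u z) y - T ?R u y
      = (\<integral>z. TK \<delta> y z * u z - TK \<delta> y z * (indicator ?B z * u z) - TK ?R y z * u z \<partial>M)"
    unfolding T_eq
    by (simp only: Bochner_Integration.integral_diff Bochner_Integration.integrable_diff
        TK_integrable[OF \<delta> Iu] TK_integrable[OF \<delta> IB] TK_integrable[OF R Iu])
  have "\<bar>T \<delta> u y - T \<delta> (\<lambda>z. indicator ?B z * u z) y - T ?R u y\<bar>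
      \<le> (\<integral>z. 1 / h (2 * r) * indicator (ball y (4 * r)) z \<partial>M)"
    unfolding eq
  proof (rule abs_integral_le)
    show "integrable M (\<lambda>z. 1 / h (2 * r) * indicator (ball y (4 * r)) z)"
      by (intro integrable_mult_right indicator_integrable) auto
    fix z
    have tri: "dist c z \<le> dist c y + dist y z" "dist y z \<le> dist c y + dist c z"
      using dist_triangle[of c z y] dist_triangle[of y z c] by (auto simp: dist_commute)
    have h2: "h (2 * r) > 0" using r by (intro h_pos) auto
    show "\<bar>TK \<delta> y z * u z - TK \<delta> y z * (indicator ?B z * u z) - TK ?R y z * u z\<bar>
        \<le> 1 / h (2 * r) * indicator (ball y (4 * r)) z"
    proof (cases "?R \<le> dist y z")
      case True
      then have "3 * r \<le> dist c z" using y tri(2) by linarith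
      then have "z \<notin> ?B" by simp
      then show ?thesis using True h2 by (simp add: TK_def indicator_def)
    next
      case False
      show ?thesis
      proof (cases "\<delta> \<le> dist y z \<and> z \<notin> ?B")
        case True
        then have "3 * r \<le> dist c z" by simp
        then have "2 * r \<le> dist y z" using y tri(1) by linarith
        moreover have "dist y z < 4 * r" using True False by linarith
        moreover have "\<bar>TK (2 * r) y z\<bar> * \<bar>u z\<bar> \<le> 1 / h (2 * r) * 1"
          using TK_bound[of "2 * r" y z] r u(2)[of z] h2 by (intro mult_mono) auto
        ultimately show ?thesis using True False by (simp add: TK_def abs_mult)
      next
        case 2: False
        then have "TK \<delta> y z * u z - TK \<delta> y z * (indicator ?B z * u z) - TK ?R y z * u z = 0"
          using False by (auto simp: TK_def)
        then show ?thesis using h2 by (simp add: less_imp_le)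
      qed
    qed
  qed
  also have "\<dots> = measure M (ball y (4 * r)) / h (2 * r)" by simp
  also have "\<dots> \<le> C"
  proof -
    have h2: "h (2 * r) > 0" using r by (intro h_pos) auto
    have "measure M (ball y (4 * r)) \<le> h (4 * r)" using r by (intro growth) auto
    also have "\<dots> \<le> C * h (2 * r)" using h_doubling[of "2 * r"] r by simp
    finally show ?thesis using h2 by (simp add: divide_le_eq)
  qed
  finally show ?thesis by linarith
qed

end

context bounded_singular_kernel
begin

text \<open>The operator is moved from the weights to a function \<open>u\<close> of modulus at most one on the
  exceptional set, where the \<open>L\<^sup>2\<close> bound for finitely many truncations of \<open>u\<close> applies.\<close>

lemma weights_local_part:
  fixes w :: "nat \<Rightarrow> 'a \<Rightarrow> real"
  assumes w: "\<And>i. i < n \<Longrightarrow> w i \<in> borel_measurable M" "\<And>i y. i < n \<Longrightarrow> 0 \<le> w i y"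
    and W: "\<And>y. (\<Sum>i<n. w i y) \<le> 1"
    and r: "\<And>i. i < n \<Longrightarrow> 0 < r i" and supp: "\<And>i y. i < n \<Longrightarrow> r i < dist (c i) y \<Longrightarrow> w i y = 0"
    and \<delta>: "\<delta> > 0"
  shows "measure M {x. 1 < \<bar>\<Sum>i<n. indicator (ball (c i) (3 * r i)) x * T \<delta> (w i) x\<bar>}
    \<le> (4 * C0 + 4 + 2 * C) * (\<Sum>i<n. \<integral>y. w i y \<partial>M)"
proof -
  define N where "N x = (\<Sum>i<n. indicator (ball (c i) (3 * r i)) x * T \<delta> (w i) x)" for x
  define F where "F = {x. 1 < \<bar>N x\<bar>}"
  have wle: "w i y \<le> 1" if "i < n" for i y
    using member_le_sum[of i "{..<n}" "\<lambda>i. w i y"] w(2) W[of y] that by auto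
  have Iw: "integrable M (w i)" if "i < n" for i
    using w wle that by (intro bounded_integrable[of _ 1]) auto
  have Nm [measurable]: "N \<in> borel_measurable M" unfolding N_def[abs_def] using w \<delta>
    by (intro borel_measurable_sum borel_measurable_times borel_measurable_indicator T_meas) auto
  have "{x \<in> space M. 1 < \<bar>N x\<bar>} \<in> sets M" by measurable
  then have Fm [measurable]: "F \<in> sets M" by (simp add: F_def)
  \<comment> \<open>With the sign of \<open>N\<close> on \<open>F\<close>, the integral of
    \<open>u * N\<close> dominates the measure of \<open>F\<close>.\<close>
  define u where "u x = indicator F x * sgn (N x)" for x
  have u [measurable]: "u \<in> borel_measurable M" unfolding u_def[abs_def] by measurable
  have u1: "\<bar>u x\<bar> \<le> 1" for x by (auto simp: u_def indicator_def sgn_real_def)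
  have u2: "(u x)\<^sup>2 = indicator F x" for x
    by (auto simp: u_def indicator_def F_def sgn_real_def)
  have uL2: "u \<in> L2 M" using bounded_in_L2[OF u u1] .
  have Iu: "integrable M u" using bounded_integrable[OF u u1] .
  \<comment> \<open>The maximum over exactly those radii that \<open>T_local_part\<close> asks for:
    a finite maximum is measurable and lies below the maximal operator.\<close>
  define V where "V y = Max ((\<lambda>\<epsilon>. \<bar>T \<epsilon> u y\<bar>) ` insert \<delta> ((\<lambda>i. max \<delta> (4 * r i)) ` {..<n}))" for y
  have VE: "\<bar>T \<epsilon> u y\<bar> \<le> V y" if "\<epsilon> \<in> insert \<delta> ((\<lambda>i. max \<delta> (4 * r i)) ` {..<n})" for \<epsilon> y
    unfolding V_def using that by (intro Max_ge) auto
  have Vin: "\<exists>\<epsilon>>0. V y = \<bar>T \<epsilon> u y\<bar>" for y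
  proof -
    have "V y \<in> (\<lambda>\<epsilon>. \<bar>T \<epsilon> u y\<bar>) ` insert \<delta> ((\<lambda>i. max \<delta> (4 * r i)) ` {..<n})"
      unfolding V_def by (intro Max_in) auto
    then obtain \<epsilon> where \<epsilon>: "\<epsilon> \<in> insert \<delta> ((\<lambda>i. max \<delta> (4 * r i)) ` {..<n})" "V y = \<bar>T \<epsilon> u y\<bar>"
      by auto
    then have "\<epsilon> > 0" using \<delta> by (auto simp: less_max_iff_disj)
    then show ?thesis using \<epsilon>(2) by blast
  qed
  have Vm [measurable]: "V \<in> borel_measurable M"
  proof -
    have "(\<lambda>x. Max ((\<lambda>\<epsilon>. \<bar>T \<epsilon> u x\<bar>) ` insert \<delta> ((\<lambda>i. max \<delta> (4 * r i)) ` {..<n}))) \<in> borel_measurable M"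
      using \<delta> u by (intro borel_measurable_Max borel_measurable_abs T_meas) (auto simp: less_max_iff_disj)
    then show ?thesis by (simp add: V_def[abs_def])
  qed
  have V0: "0 \<le> V x" for x using Vin[of x] by auto
  have "ennreal (V x) \<le> maximal_op M K u x" for x
    using Vin[of x] T_le_maximal[of _ u x] by auto
  note VL2 = maximal_countable_L2[OF uL2 Vm V0 AE_I2[OF this]]
  have "(\<integral>x. (u x)\<^sup>2 \<partial>M) = measure M F" by (simp add: u2)
  then have VL2': "(\<integral>x. (V x)\<^sup>2 \<partial>M) \<le> C0 * measure M F" using VL2 by simp
  define Wf where "Wf y = (\<Sum>i<n. w i y)" for y
  have Wm: "Wf \<in> borel_measurable M" unfolding Wf_def[abs_def] using w by auto
  have W0: "0 \<le> Wf y" for y unfolding Wf_def using w by (intro sum_nonneg) auto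
  have W1: "Wf y \<le> 1" for y using W by (simp add: Wf_def)
  have IW: "integrable M Wf" using Wm W0 W1 by (intro bounded_integrable[of _ 1]) auto
  have intW: "(\<integral>y. Wf y \<partial>M) = (\<Sum>i<n. \<integral>y. w i y \<partial>M)"
    unfolding Wf_def using Iw by (subst Bochner_Integration.integral_sum) auto
  have IwV: "integrable M (\<lambda>y. w i y * (2 * V y + C))" if "i < n" for i
  proof (rule Bochner_Integration.integrable_bound)
    show "integrable M (\<lambda>y. 2 * (1 + (V y)\<^sup>2) + C)" using VL2(1) by auto
    show "AE y in M. norm (w i y * (2 * V y + C)) \<le> norm (2 * (1 + (V y)\<^sup>2) + C)"
    proof (intro AE_I2)
      fix y
      have "w i y * (2 * V y + C) \<le> 1 * (2 * V y + C)"
        using wle[OF that] V0[of y] C_ge_1 by (intro mult_right_mono) auto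
      also have "\<dots> \<le> 2 * (1 + (V y)\<^sup>2) + C"
        using sum_squares_bound[of 1 "V y"] V0[of y] zero_le_power2[of "V y"] by simp
      finally show "norm (w i y * (2 * V y + C)) \<le> norm (2 * (1 + (V y)\<^sup>2) + C)"
        using w(2)[OF that] V0[of y] C_ge_1 by simp
    qed
  qed (use w that in auto)
  have Iuw: "integrable M (\<lambda>x. u x * (indicator (ball (c i) (3 * r i)) x * T \<delta> (w i) x))" if "i < n" for i
  proof -
    have "integrable M (\<lambda>x. (indicator (ball (c i) (3 * r i)) x * u x) * T \<delta> (w i) x)"
      using that Iu Iw \<delta> by (intro T_mult_integrable indicator_mult_integrable) auto
    then show ?thesis by (simp add: mult_ac)
  qed
  have IN: "integrable M (\<lambda>x. u x * N x)"
    unfolding N_def sum_distrib_left using Iuw by (intro Bochner_Integration.integrable_sum) auto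
  have "measure M F \<le> (\<integral>x. u x * N x \<partial>M)"
  proof -
    have uN: "u x * N x = indicator F x * \<bar>N x\<bar>" for x
      by (simp add: u_def abs_sgn mult_ac)
    have "1 * measure M F \<le> (\<integral>x. u x * N x \<partial>M)"
      by (rule chebyshev_measure[OF IN _ Fm]) (auto simp: uN F_def)
    then show ?thesis by simp
  qed
  also have "\<dots> = (\<Sum>i<n. \<integral>x. u x * (indicator (ball (c i) (3 * r i)) x * T \<delta> (w i) x) \<partial>M)"
    unfolding N_def sum_distrib_left using Iuw by (subst Bochner_Integration.integral_sum) auto
  also have "\<dots> \<le> (\<Sum>i<n. \<integral>y. w i y * (2 * V y + C) \<partial>M)"
  proof (rule sum_mono)
    fix i assume "i \<in> {..<n}"
    then have i: "i < n" by simp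
    have "(\<integral>x. u x * (indicator (ball (c i) (3 * r i)) x * T \<delta> (w i) x) \<partial>M)
        = (\<integral>x. (indicator (ball (c i) (3 * r i)) x * u x) * T \<delta> (w i) x \<partial>M)"
      by (simp add: mult_ac)
    also have "\<dots> = - (\<integral>y. w i y * T \<delta> (\<lambda>z. indicator (ball (c i) (3 * r i)) z * u z) y \<partial>M)"
      using i Iu Iw \<delta> by (intro T_antisym indicator_mult_integrable) auto
    also have "\<dots> \<le> \<bar>\<integral>y. w i y * T \<delta> (\<lambda>z. indicator (ball (c i) (3 * r i)) z * u z) y \<partial>M\<bar>" by simp
    also have "\<dots> \<le> (\<integral>y. w i y * (2 * V y + C) \<partial>M)"
    proof (rule abs_integral_le)
      show "integrable M (\<lambda>y. w i y * (2 * V y + C))" by (rule IwV[OF i])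
      fix y
      show "\<bar>w i y * T \<delta> (\<lambda>z. indicator (ball (c i) (3 * r i)) z * u z) y\<bar> \<le> w i y * (2 * V y + C)"
      proof (cases "r i < dist (c i) y")
        case False
        have "\<bar>T \<delta> (\<lambda>z. indicator (ball (c i) (3 * r i)) z * u z) y\<bar>
            \<le> \<bar>T \<delta> u y\<bar> + \<bar>T (max \<delta> (4 * r i)) u y\<bar> + C"
          using False by (intro T_local_part[OF u u1 r[OF i] \<delta>]) auto
        also have "\<dots> \<le> 2 * V y + C" using VE[of \<delta> y] VE[of "max \<delta> (4 * r i)" y] i by auto
        finally show ?thesis using w(2)[OF i] by (simp add: abs_mult mult_left_mono)
      qed (use supp[OF i] in simp)
    qed
    finally show "(\<integral>x. u x * (indicator (ball (c i) (3 * r i)) x * T \<delta> (w i) x) \<partial>M)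
      \<le> (\<integral>y. w i y * (2 * V y + C) \<partial>M)" .
  qed
  also have "\<dots> \<le> (\<integral>y. (V y)\<^sup>2 / (2 * (C0 + 1)) + (2 * (C0 + 1) + C) * Wf y \<partial>M)"
  proof -
    note I = IwV
    have "(\<Sum>i<n. \<integral>y. w i y * (2 * V y + C) \<partial>M) = (\<integral>y. (\<Sum>i<n. w i y * (2 * V y + C)) \<partial>M)"
      using I by (subst Bochner_Integration.integral_sum) auto
    also have "\<dots> \<le> (\<integral>y. (V y)\<^sup>2 / (2 * (C0 + 1)) + (2 * (C0 + 1) + C) * Wf y \<partial>M)"
    proof (rule integral_mono)
      fix y
      \<comment> \<open>The weight in Young's inequality is chosen for absorption: the integral of
        the square of \<open>V\<close> is at most \<open>C0 * measure M F\<close>, so after division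
        by \<open>k\<close> it is at most half the measure of \<open>F\<close>.\<close>
      define k where "k = 2 * (C0 + 1)"
      have k: "k > 0" using C0 by (simp add: k_def)
      have "2 * (Wf y * V y) \<le> (V y)\<^sup>2 / k + k * (Wf y)\<^sup>2"
      proof -
        have "0 \<le> (V y - k * Wf y)\<^sup>2 / k" using k by simp
        also have "\<dots> = (V y)\<^sup>2 / k + k * (Wf y)\<^sup>2 - 2 * (Wf y * V y)"
          using k by (simp add: power2_eq_square field_simps)
        finally show ?thesis by simp
      qed
      also have "k * (Wf y)\<^sup>2 \<le> k * Wf y"
        using k W0[of y] W1[of y] by (intro mult_left_mono) (auto simp: power2_eq_square mult_left_le)
      finally have "2 * (Wf y * V y) \<le> (V y)\<^sup>2 / k + k * Wf y" by simp
      moreover have "(\<Sum>i<n. w i y * (2 * V y + C)) = 2 * (Wf y * V y) + C * Wf y"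
        by (simp add: Wf_def flip: sum_distrib_right) (simp add: algebra_simps)
      ultimately show "(\<Sum>i<n. w i y * (2 * V y + C)) \<le> (V y)\<^sup>2 / (2 * (C0 + 1)) + (2 * (C0 + 1) + C) * Wf y"
        unfolding k_def by (simp add: algebra_simps)
    qed (use I VL2(1) IW in auto)
    finally show ?thesis .
  qed
  also have "\<dots> = (\<integral>y. (V y)\<^sup>2 \<partial>M) / (2 * (C0 + 1)) + (2 * (C0 + 1) + C) * (\<integral>y. Wf y \<partial>M)"
    using VL2(1) IW by (subst Bochner_Integration.integral_add) auto
  also have "\<dots> \<le> measure M F / 2 + (2 * (C0 + 1) + C) * (\<integral>y. Wf y \<partial>M)"
  proof -
    have "C0 * measure M F \<le> (C0 + 1) * measure M F" by (intro mult_right_mono) auto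
    then have "(\<integral>y. (V y)\<^sup>2 \<partial>M) \<le> (C0 + 1) * measure M F" using VL2' by linarith
    then have "(\<integral>y. (V y)\<^sup>2 \<partial>M) / (2 * (C0 + 1)) \<le> measure M F / 2"
      using C0 by (simp add: field_simps)
    then show ?thesis by simp
  qed
  finally have "measure M F \<le> measure M F / 2 + (2 * (C0 + 1) + C) * (\<integral>y. Wf y \<partial>M)" .
  then have "measure M F \<le> (4 * C0 + 4 + 2 * C) * (\<integral>y. Wf y \<partial>M)" by (simp add: algebra_simps)
  then show ?thesis by (simp add: F_def N_def intW)
qed

end

section \<open>Replacing a bad piece by its weight\<close>

context singular_kernel
begin

text \<open>Away from \<open>ball c (3 * r)\<close> the function \<open>b - t * w\<close> has mean
  zero and \<open>T_hormander\<close> applies; its L1 norm is at most twice that of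
  \<open>b\<close>, which gives \<open>6 * C\<close>. Between \<open>Q\<close> and that ball the
  weight is cut out, and \<open>b\<close>, which lives within \<open>r / 2\<close> of
  \<open>c\<close>, is at distance at least \<open>r / 2\<close>. There the kernel is at most
  \<open>1 / h (r / 2)\<close>, while the measure of the ball is at most
  \<open>C^3 * h (r / 2)\<close>, since \<open>3 * r\<close> is below
  \<open>2^3 * (r / 2)\<close>.\<close>

lemma bad_part_estimate:
  fixes b w :: "'a \<Rightarrow> real"
  assumes b: "integrable M b" "\<And>y. 0 \<le> b y" and w: "integrable M w" "\<And>y. 0 \<le> w y"
    and bw: "(\<integral>y. b y \<partial>M) = t * (\<integral>y. w y \<partial>M)" and t: "t \<ge> 0"
    and r: "r > 0" and \<delta>: "\<delta> > 0"
    and bs: "\<And>y. r / 2 \<le> dist c y \<Longrightarrow> b y = 0" and ws: "\<And>y. r < dist c y \<Longrightarrow> w y = 0"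
    and Q: "Q \<in> sets M" "ball c r \<subseteq> Q"
  shows "(\<integral>x. indicator (- Q) x * \<bar>T \<delta> b x - t * (indicator (- ball c (3 * r)) x * T \<delta> w x)\<bar> \<partial>M)
    \<le> (6 * C + C ^ 3) * (\<integral>y. b y \<partial>M)"
    "integrable M (\<lambda>x. indicator (- Q) x * \<bar>T \<delta> b x - t * (indicator (- ball c (3 * r)) x * T \<delta> w x)\<bar>)"
proof -
  let ?B = "ball c (3 * r)"
  define \<alpha> where "\<alpha> = (\<integral>y. b y \<partial>M)"
  have \<alpha>: "\<alpha> \<ge> 0" unfolding \<alpha>_def using b by (intro integral_nonneg_AE) auto
  define \<sigma> where "\<sigma> y = b y - t * w y" for y
  have \<sigma>: "integrable M \<sigma>" "(\<integral>y. \<sigma> y \<partial>M) = 0" unfolding \<sigma>_def[abs_def] using b w bw by auto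
  have \<sigma>0: "\<sigma> y = 0" if "dist c y > r" for y using that r bs[of y] ws[of y] by (simp add: \<sigma>_def)
  have T\<sigma>: "T \<delta> \<sigma> x = T \<delta> b x - t * T \<delta> w x" for x
    unfolding \<sigma>_def[abs_def] using T_diff[OF \<delta> b(1), of "\<lambda>y. t * w y"] w(1) T_scale by simp
  have \<sigma>n: "(\<integral>y. \<bar>\<sigma> y\<bar> \<partial>M) \<le> 2 * \<alpha>"
  proof -
    have "(\<integral>y. \<bar>\<sigma> y\<bar> \<partial>M) \<le> (\<integral>y. b y + t * w y \<partial>M)"
    proof (intro integral_mono)
      fix y show "\<bar>\<sigma> y\<bar> \<le> b y + t * w y"
        using b(2)[of y] mult_nonneg_nonneg[OF t w(2)[of y]] by (simp add: \<sigma>_def)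
    qed (use \<sigma> b w in auto)
    also have "\<dots> = 2 * \<alpha>" using b w bw by (simp add: \<alpha>_def)
    finally show ?thesis .
  qed
  have h2: "h (r / 2) > 0" using r by (intro h_pos) auto
  have I\<sigma>: "integrable M (\<lambda>x. indicator {x. 3 * r \<le> dist c x} x * \<bar>T \<delta> \<sigma> x\<bar>)"
    using T_integrable[OF \<delta> \<sigma>(1)] by (intro indicator_mult_integrable) auto
  have Ib: "integrable M (\<lambda>x. \<alpha> / h (r / 2) * indicator ?B x)"
    by (intro integrable_mult_right indicator_integrable) auto
  have IB: "integrable M (\<lambda>x. indicator (- ?B) x * T \<delta> w x)"
    using T_integrable[OF \<delta> w(1)] by (intro indicator_mult_integrable) auto
  show I: "integrable M (\<lambda>x. indicator (- Q) x * \<bar>T \<delta> b x - t * (indicator (- ?B) x * T \<delta> w x)\<bar>)"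
  proof (rule indicator_mult_integrable)
    show "- Q \<in> sets M" using sets.compl_sets[OF Q(1)] by (simp add: Compl_eq_Diff_UNIV)
    show "integrable M (\<lambda>x. \<bar>T \<delta> b x - t * (indicator (- ?B) x * T \<delta> w x)\<bar>)"
      using T_integrable[OF \<delta> b(1)] IB by auto
  qed
  have "(\<integral>x. indicator (- Q) x * \<bar>T \<delta> b x - t * (indicator (- ?B) x * T \<delta> w x)\<bar> \<partial>M)
      \<le> (\<integral>x. indicator {x. 3 * r \<le> dist c x} x * \<bar>T \<delta> \<sigma> x\<bar> + \<alpha> / h (r / 2) * indicator ?B x \<partial>M)"
  proof (rule integral_mono)
    fix x
    show "indicator (- Q) x * \<bar>T \<delta> b x - t * (indicator (- ?B) x * T \<delta> w x)\<bar>
      \<le> indicator {x. 3 * r \<le> dist c x} x * \<bar>T \<delta> \<sigma> x\<bar> + \<alpha> / h (r / 2) * indicator ?B x"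
    proof (cases "x \<in> Q")
      case True then show ?thesis using \<alpha> h2 by (simp add: indicator_def less_imp_le)
    next
      case False
      then have dx: "r \<le> dist c x" using Q(2) by (meson mem_ball not_le subsetD)
      show ?thesis
      proof (cases "3 * r \<le> dist c x")
        case True then show ?thesis using False by (simp add: T\<sigma>)
      next
        case 2: False
        have "\<bar>T \<delta> b x\<bar> \<le> (\<integral>y. 1 / h (r / 2) * b y \<partial>M)"
          unfolding T_eq
        proof (rule abs_integral_le)
          fix y
          show "\<bar>TK \<delta> x y * b y\<bar> \<le> 1 / h (r / 2) * b y"
          proof (cases "r / 2 \<le> dist c y")
            case False
            have "dist c x \<le> dist c y + dist x y" using dist_triangle[of c x y] by (simp add: dist_commute)
            then have d: "r / 2 \<le> dist x y" using False dx by linarith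
            have "\<bar>TK \<delta> x y\<bar> \<le> \<bar>TK (r/2) x y\<bar>" using d by (simp add: TK_def)
            also have "\<dots> \<le> 1 / h (r / 2)" using r by (intro TK_bound) auto
            finally show ?thesis using b(2)[of y] by (simp add: abs_mult mult_right_mono del: times_divide_eq_left)
          qed (simp add: bs)
        qed (use b in auto)
        then show ?thesis using False 2 by (simp add: \<alpha>_def)
      qed
    qed
  qed (use I I\<sigma> Ib in auto)
  also have "\<dots> = (\<integral>x. indicator {x. 3 * r \<le> dist c x} x * \<bar>T \<delta> \<sigma> x\<bar> \<partial>M) + \<alpha> / h (r / 2) * measure M ?B"
    using I\<sigma> Ib by (subst Bochner_Integration.integral_add) auto
  also have "\<dots> \<le> 3 * C * (2 * \<alpha>) + \<alpha> / h (r / 2) * (C ^ 3 * h (r / 2))"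
  proof (intro add_mono mult_left_mono)
    have "3 * C * (\<integral>y. \<bar>\<sigma> y\<bar> \<partial>M) \<le> 3 * C * (2 * \<alpha>)" using \<sigma>n C_ge_1 by (intro mult_left_mono) auto
    then show "(\<integral>x. indicator {x. 3 * r \<le> dist c x} x * \<bar>T \<delta> \<sigma> x\<bar> \<partial>M) \<le> 3 * C * (2 * \<alpha>)"
      using T_hormander[OF \<delta> r \<sigma>, of c] \<sigma>0 by force
    have "measure M ?B \<le> h (3 * r)" using growth[of "3 * r" c] r by auto
    also have "\<dots> \<le> h (2 ^ 3 * (r / 2))" using r by (intro h_mono) auto
    also have "\<dots> \<le> C ^ 3 * h (r / 2)" using h_pow2[of "r / 2" 3] r by simp
    finally show "measure M ?B \<le> C ^ 3 * h (r / 2)" .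
  qed (use \<alpha> h2 in auto)
  also have "\<dots> = (6 * C + C ^ 3) * \<alpha>" using h2 by (simp add: field_simps)
  finally show "(\<integral>x. indicator (- Q) x * \<bar>T \<delta> b x - t * (indicator (- ?B) x * T \<delta> w x)\<bar> \<partial>M)
    \<le> (6 * C + C ^ 3) * (\<integral>y. b y \<partial>M)" by (simp add: \<alpha>_def)
qed

end

text \<open>A Lindelof cover. The doubled balls stay in \<open>G\<close>, which later separates the
  supports of the bad pieces from the points where they are estimated.\<close>

lemma open_ball_sequence:
  fixes G :: "'a::{metric_space,second_countable_topology} set"
  assumes "open G" "G \<noteq> {}"
  obtains c \<eta> where "\<And>n::nat. \<eta> n > 0" "\<And>n. ball (c n) (2 * \<eta> n) \<subseteq> G" "G = (\<Union>n. ball (c n) (\<eta> n))"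
proof -
  have "\<forall>x\<in>G. \<exists>r>0. ball x (2 * r) \<subseteq> G"
  proof
    fix x assume "x \<in> G"
    then obtain r where "r > 0" "ball x r \<subseteq> G" using assms(1) openE by blast
    then show "\<exists>r>0. ball x (2 * r) \<subseteq> G" by (intro exI[of _ "r/2"]) auto
  qed
  then obtain r where r: "\<And>x. x \<in> G \<Longrightarrow> r x > 0" "\<And>x. x \<in> G \<Longrightarrow> ball x (2 * r x) \<subseteq> G" by metis
  define F where "F = (\<lambda>x. ball x (r x)) ` G"
  have "\<And>A. A \<in> F \<Longrightarrow> open A" by (auto simp: F_def)
  from Lindelof[OF this] obtain F' where F': "F' \<subseteq> F" "countable F'" "\<Union>F' = \<Union>F" by blast
  have "\<Union>F \<subseteq> G"
  proof
    fix y assume "y \<in> \<Union>F"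
    then obtain x where x: "x \<in> G" "dist x y < r x" by (auto simp: F_def)
    have "dist x y < 2 * r x" using x(2) r(1)[OF x(1)] by linarith
    then show "y \<in> G" using r(2)[OF x(1)] by (metis mem_ball subsetD)
  qed
  moreover have "G \<subseteq> \<Union>F" using r(1) by (force simp: F_def)
  ultimately have FG: "\<Union>F = G" by (rule subset_antisym)
  have ne: "F' \<noteq> {}" using F'(3) FG assms(2) by auto
  have "\<exists>x\<in>G. from_nat_into F' n = ball x (r x)" for n
    using from_nat_into[OF ne, of n] F'(1) by (auto simp: F_def)
  then obtain c where c: "\<And>n. c n \<in> G" "\<And>n. from_nat_into F' n = ball (c n) (r (c n))" by metis
  have "(\<Union>n. ball (c n) (r (c n))) = \<Union>(range (from_nat_into F'))"
    unfolding c(2)[symmetric] ..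
  also have "\<dots> = G" using range_from_nat_into[OF ne F'(2)] F'(3) FG by simp
  finally have "G = (\<Union>n. ball (c n) (r (c n)))" by (rule sym)
  then show ?thesis by (rule that[of "\<lambda>n. r (c n)" c, OF r(1)[OF c(1)] r(2)[OF c(1)]])
qed

lemma indicator_disjointed_sum:
  fixes n :: nat
  shows "indicator (\<Union>i<n. B i) x = (\<Sum>i<n. indicator (B i - (\<Union>j<i. B j)) x :: real)"
proof (induction n)
  case (Suc n)
  have "indicator (\<Union>i<Suc n. B i) x = indicator (\<Union>i<n. B i) x + (indicator (B n - (\<Union>j<n. B j)) x :: real)"
    by (auto simp: indicator_def lessThan_Suc)
  then show ?case using Suc by simp
qed simp

section \<open>Assembly of the weak type bound for a single truncation\<close>

context bounded_singular_kernel
begin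

text \<open>The sum of the bounds for five exceptional sets in \<open>weak_type_lipschitz\<close>:
  \<open>C0\<close> for the bounded part, 2 for the set \<open>Q\<close>, \<open>6 * C + C^3\<close>
  for the bad pieces, \<open>C0\<close> for the sum of the weights and
  \<open>4 * C0 + 4 + 2 * C\<close> for their local parts.\<close>

definition weak_const :: real where "weak_const = 6 + 6 * C0 + 8 * C + C ^ 3"

lemma weak_const_ge_1: "weak_const \<ge> 1"
  unfolding weak_const_def using C0 C_ge_1 one_le_power[OF C_ge_1, of 3] by linarith

text \<open>For continuous \<open>f\<close> the set above height \<open>t\<close> is open and hence
  a union of balls. The level \<open>5 * t\<close> is the sum of \<open>t\<close> for the bounded
  part, \<open>t\<close> for the tail left after finitely many balls, \<open>t\<close> for the bad
  pieces minus the far parts of their weights, and \<open>2 * t\<close> for the weights, which enter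
  as \<open>T \<delta> Wf - N\<close> with both terms at most 1 in modulus.\<close>

lemma weak_type_lipschitz:
  assumes \<delta>: "\<delta> > 0" and f: "bounded_lipschitz f" "\<And>x. 0 \<le> f x" and t: "t > 0"
  shows "measure M {x. \<bar>T \<delta> f x\<bar> > 5 * t} \<le> weak_const * ((\<integral>x. f x \<partial>M) / t)"
proof -
  define m where "m = (\<integral>x. f x \<partial>M) / t"
  have If: "integrable M f" using bounded_lipschitz_integrable[OF _ sets_M f(1)] finite_measure_axioms by blast
  have fm [measurable]: "f \<in> borel_measurable M" using If by auto
  have m0: "0 \<le> m" unfolding m_def using f t by (intro divide_nonneg_pos integral_nonneg_AE) auto
  have tm: "t * m = (\<integral>x. f x \<partial>M)" using t by (simp add: m_def)
  show ?thesis
  \<comment> \<open>If the whole space has measure at most \<open>m\<close>, the claim is trivial;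
    otherwise there is strictly enough room for weights of total mass at most
    \<open>m\<close>.\<close>
  proof (cases "measure M UNIV \<le> m")
    case True
    have "measure M {x. \<bar>T \<delta> f x\<bar> > 5 * t} \<le> measure M UNIV"
      using bounded_measure by simp
    also have "\<dots> \<le> 1 * m" using True by simp
    also have "\<dots> \<le> weak_const * m" using weak_const_ge_1 m0 by (intro mult_right_mono) auto
    finally show ?thesis by (simp add: m_def)
  next
    case False
    then have m_less: "m < measure M UNIV" by simp
    define G where "G = {x. t < f x}"
    have G: "open G"
      unfolding G_def using bounded_lipschitz_continuous[OF f(1)]
      by (intro open_Collect_less continuous_on_const) auto
    have Gm: "G \<in> sets M" using G by simp
    have muG: "measure M G \<le> m"
      using chebyshev_measure[OF If f(2) Gm, of t] t tm by (simp add: G_def mult.commute le_divide_eq m_def)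
    define g where "g x = indicator (- G) x * f x" for x
    have gm: "g \<in> borel_measurable M" unfolding g_def[abs_def] using Gm
      by (intro borel_measurable_times borel_measurable_indicator fm) auto
    have g: "0 \<le> g x" "g x \<le> t" "g x \<le> f x" for x
      using f(2)[of x] t by (auto simp: g_def G_def indicator_def)
    have Ig: "integrable M g" using g gm by (intro bounded_integrable[of _ t]) auto
    have gL2: "g \<in> L2 M" using g gm by (intro bounded_in_L2[of _ t]) auto
    define A1 where "A1 = {x. \<bar>T \<delta> g x\<bar> > t}"
    have A1: "measure M A1 \<le> C0 * m"
    proof -
      have "(\<integral>x. (g x)\<^sup>2 \<partial>M) \<le> (\<integral>x. t * f x \<partial>M)"
      proof (rule integral_mono)
        show "(g x)\<^sup>2 \<le> t * f x" for x
          unfolding power2_eq_square using g[of x] t by (intro mult_mono) auto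
      qed (use gL2 If in \<open>auto simp: L2_def\<close>)
      then have "C0 * (\<integral>x. (g x)\<^sup>2 \<partial>M) / t\<^sup>2 \<le> C0 * (t * (t * m)) / t\<^sup>2"
        using C0 t tm by (intro divide_right_mono mult_left_mono) auto
      also have "\<dots> = C0 * m" using t by (simp add: power2_eq_square)
      finally show ?thesis unfolding A1_def using T_L2_measure[OF gL2 \<delta> t] by linarith
    qed
    have A1m: "A1 \<in> sets M"
      unfolding A1_def by (rule T_superlevel_sets[OF \<delta> gm])
    show ?thesis
    proof (cases "G = {}")
      case True
      then have "g = f" by (auto simp: g_def)
      then have "{x. \<bar>T \<delta> f x\<bar> > 5 * t} \<subseteq> A1" using t by (auto simp: A1_def)
      then have "measure M {x. \<bar>T \<delta> f x\<bar> > 5 * t} \<le> C0 * m"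
        using A1 finite_measure_mono[OF _ A1m] by (meson order_trans)
      also have "\<dots> \<le> weak_const * m"
        using C0 C_ge_1 m0 one_le_power[OF C_ge_1, of 3] by (intro mult_right_mono) (auto simp: weak_const_def)
      finally show ?thesis by (simp add: m_def)
    next
      case False
      obtain c \<eta> where c: "\<And>n::nat. \<eta> n > 0" "\<And>n. ball (c n) (2 * \<eta> n) \<subseteq> G" "G = (\<Union>n. ball (c n) (\<eta> n))"
        by (rule open_ball_sequence[OF G False]) (rule that)
      define B where "B i = ball (c i) (\<eta> i)" for i
      define U where "U n = (\<Union>i<n. B i)" for n
      define P where "P i = B i - U i" for i
      have Bm [simp]: "B i \<in> sets borel" for i by (simp add: B_def)
      have Um [simp]: "U i \<in> sets borel" for i unfolding U_def by (intro sets.finite_UN) auto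
      have Pm [simp]: "P i \<in> sets borel" for i unfolding P_def by (intro sets.Diff) auto
      have UG: "U i \<subseteq> G" for i unfolding U_def B_def c(3) by auto
      obtain L where L: "\<And>x. \<bar>f x\<bar> \<le> L" "L \<ge> 0" using bounded_lipschitzE[OF f(1)] by metis
      \<comment> \<open>The number of balls depends on \<delta>: an L1 norm of at most
        \<open>t * h \<delta>\<close> keeps the truncation of the tail below \<open>t\<close>
        everywhere. The final constant does not depend on it.\<close>
      obtain n where n: "(\<integral>x. \<bar>indicator (G - U n) x * f x\<bar> \<partial>M) \<le> t * h \<delta>"
      proof -
        have "(\<lambda>n. measure M (G - U n)) \<longlonglongrightarrow> measure M (\<Inter>n. G - U n)"
        proof (rule finite_Lim_measure_decseq)
          show "range (\<lambda>n. G - U n) \<subseteq> sets M" using Gm Um by auto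
          show "decseq (\<lambda>n. G - U n)" by (force simp: decseq_def U_def)
        qed
        also have "(\<Inter>n. G - U n) = {}" using c(3) by (auto simp: U_def B_def)
        finally have "(\<lambda>n. L * measure M (G - U n)) \<longlonglongrightarrow> L * 0" by (intro tendsto_mult_left) simp
        moreover have "t * h \<delta> > 0" using t h_pos[OF \<delta>] by simp
        ultimately have "\<forall>\<^sub>F n in sequentially. L * measure M (G - U n) < t * h \<delta>"
          by (intro order_tendstoD) auto
        then obtain n where n: "L * measure M (G - U n) < t * h \<delta>" by (auto simp: eventually_sequentially)
        have "(\<integral>x. \<bar>indicator (G - U n) x * f x\<bar> \<partial>M) \<le> (\<integral>x. L * indicator (G - U n) x \<partial>M)"
        proof (rule integral_mono)
          show "integrable M (\<lambda>x. L * indicator (G - U n) x)"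
            using Gm by (intro integrable_mult_right indicator_integrable) auto
          show "integrable M (\<lambda>x. \<bar>indicator (G - U n) x * f x\<bar>)"
            using Gm by (intro integrable_abs indicator_mult_integrable If) auto
        qed (use L in \<open>auto simp: indicator_def\<close>)
        also have "\<dots> = L * measure M (G - U n)" by simp
        finally show ?thesis using that[of n] n by linarith
      qed
      define b where "b i x = indicator (P i) x * f x" for i x
      have b: "integrable M (b i)" "0 \<le> b i x" for i x
        unfolding b_def[abs_def] using If f(2) by (auto intro!: indicator_mult_integrable)
      have bsum: "(\<Sum>i<n. b i x) = indicator (U n) x * f x" for x
        unfolding b_def U_def P_def indicator_disjointed_sum[of B n x] by (simp add: sum_distrib_right)
      define a where "a i = (\<integral>x. b i x \<partial>M) / t" for i
      have a0: "0 \<le> a i" for i unfolding a_def using b t by (intro divide_nonneg_pos integral_nonneg_AE) auto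
      have aint: "(\<Sum>i<n. \<integral>x. b i x \<partial>M) \<le> t * m"
      proof -
        have "(\<Sum>i<n. \<integral>x. b i x \<partial>M) = (\<integral>x. indicator (U n) x * f x \<partial>M)"
          unfolding bsum[symmetric] using b by (subst Bochner_Integration.integral_sum) auto
        also have "\<dots> \<le> (\<integral>x. f x \<partial>M)"
          using If f(2) by (intro integral_mono indicator_mult_integrable) (auto simp: indicator_def)
        finally show ?thesis by (simp add: tm)
      qed
      have asum: "(\<Sum>i<n. a i) \<le> m"
        unfolding a_def sum_divide_distrib[symmetric] using aint t by (simp add: divide_le_eq mult.commute)
      have asum': "(\<Sum>i<n. a i) < measure M UNIV" using asum m_less by linarith
      obtain w \<rho> where w: "\<And>i. i < n \<Longrightarrow> w i \<in> borel_measurable M" "\<And>i y. i < n \<Longrightarrow> 0 \<le> w i y"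
        "\<And>i. i < n \<Longrightarrow> 0 \<le> \<rho> i" "\<And>i. i < n \<Longrightarrow> (\<integral>y. w i y \<partial>M) = a i"
        "\<And>i y. i < n \<Longrightarrow> \<rho> i < dist (c i) y \<Longrightarrow> w i y = 0" "\<And>y. (\<Sum>i<n. w i y) \<le> 1"
        "\<And>i y. i < n \<Longrightarrow> dist (c i) y < \<rho> i \<Longrightarrow> (\<Sum>j<n. w j y) = 1"
      proof -
        obtain w \<rho> where H:
          "\<forall>i<n. w i \<in> borel_measurable M \<and> (\<forall>y. 0 \<le> w i y) \<and> 0 \<le> \<rho> i \<and> (\<integral>y. w i y \<partial>M) = a i \<and>
             (\<forall>y. \<rho> i < dist (c i) y \<longrightarrow> w i y = 0)"
          "\<forall>y. (\<Sum>i<n. w i y) \<le> 1" "\<forall>i<n. \<forall>y. dist (c i) y < \<rho> i \<longrightarrow> (\<Sum>j<n. w j y) = 1"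
          using exists_weights[of n a c, OF a0 asum'] by auto
        show ?thesis by (rule that[of w \<rho>]) (use H in simp_all)
      qed
      have wle: "w i y \<le> 1" if "i < n" for i y
        using member_le_sum[of i "{..<n}" "\<lambda>i. w i y"] w(2) w(6)[of y] that by auto
      have Iw: "integrable M (w i)" if "i < n" for i
        using w(1,2) wle that by (intro bounded_integrable[of _ 1]) auto
      define Wf where "Wf y = (\<Sum>i<n. w i y)" for y
      have Wm [measurable]: "Wf \<in> borel_measurable M" unfolding Wf_def[abs_def] using w by auto
      have W01: "0 \<le> Wf y" "Wf y \<le> 1" for y
        unfolding Wf_def using w by (auto intro: sum_nonneg)
      have IW: "integrable M Wf" using Wm W01 by (intro bounded_integrable[of _ 1]) auto
      have intW: "(\<integral>y. Wf y \<partial>M) \<le> m"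
        unfolding Wf_def using Iw w(4) asum by (subst Bochner_Integration.integral_sum) auto
      \<comment> \<open>Where the weights saturate. This set contains every open ball of radius
        \<open>\<rho> i\<close> about \<open>c i\<close>, and Chebyshev's inequality bounds its
        measure.\<close>
      define E where "E = {y. 1 \<le> Wf y}"
      have "{y \<in> space M. 1 \<le> Wf y} \<in> sets M" by measurable
      then have Em: "E \<in> sets M" by (simp add: E_def)
      have muE: "measure M E \<le> m"
        using chebyshev_measure[OF IW W01(1) Em, of 1] intW by (auto simp: E_def)
      define Q where "Q = G \<union> E"
      have Qm: "Q \<in> sets M" unfolding Q_def by (intro sets.Un Gm Em)
      have muQ: "measure M Q \<le> 2 * m"
        using measure_Un_le[OF Gm Em] muG muE by (simp add: Q_def)
      \<comment> \<open>At least \<open>\<rho> i\<close>, so that the weight vanishes beyond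
        \<open>r i\<close>, and at least \<open>2 * \<eta> i\<close>, so that the bad piece vanishes
        beyond half of it. In either case the open ball of this radius lies in
        \<open>Q\<close>.\<close>
      define r where "r i = max (\<rho> i) (2 * \<eta> i)" for i
      have r: "r i > 0" for i using c(1)[of i] by (simp add: r_def less_max_iff_disj)
      define D where "D i x = T \<delta> (b i) x - t * (indicator (- ball (c i) (3 * r i)) x * T \<delta> (w i) x)" for i x
      have bad: "(\<integral>x. indicator (- Q) x * \<bar>D i x\<bar> \<partial>M) \<le> (6 * C + C ^ 3) * (\<integral>y. b i y \<partial>M)
          \<and> integrable M (\<lambda>x. indicator (- Q) x * \<bar>D i x\<bar>)" if i: "i < n" for i
      proof -
        have bw: "(\<integral>y. b i y \<partial>M) = t * (\<integral>y. w i y \<partial>M)" using w(4)[OF i] t by (simp add: a_def)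
        have bs: "b i y = 0" if "r i / 2 \<le> dist (c i) y" for y
        proof -
          have "\<eta> i \<le> dist (c i) y" using that by (simp add: r_def)
          then show ?thesis by (simp add: b_def P_def B_def)
        qed
        have ws: "w i y = 0" if "r i < dist (c i) y" for y using that w(5)[OF i] by (simp add: r_def)
        have ball: "ball (c i) (r i) \<subseteq> Q"
        proof
          fix y assume "y \<in> ball (c i) (r i)"
          then have "dist (c i) y < \<rho> i \<or> dist (c i) y < 2 * \<eta> i" by (auto simp: r_def less_max_iff_disj)
          then show "y \<in> Q"
          proof
            assume "dist (c i) y < \<rho> i"
            then show ?thesis using w(7)[OF i] by (simp add: Q_def E_def Wf_def)
          next
            assume "dist (c i) y < 2 * \<eta> i"
            then have "y \<in> ball (c i) (2 * \<eta> i)" by simp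
            then show ?thesis using c(2)[of i] unfolding Q_def by blast
          qed
        qed
        show ?thesis
          unfolding D_def
          using bad_part_estimate[OF b(1) b(2) Iw[OF i] w(2)[OF i] bw less_imp_le[OF t] r \<delta> bs ws Qm ball]
          by blast
      qed
      define A2 where "A2 = {x. x \<notin> Q \<and> t < \<bar>\<Sum>i<n. D i x\<bar>}"
      have Dm: "D i \<in> borel_measurable M" if "i < n" for i
        unfolding D_def[abs_def] using b(1) w(1)[OF that] \<delta>
        by (intro borel_measurable_diff borel_measurable_times borel_measurable_indicator borel_measurable_const T_meas) auto
      have A2m: "A2 \<in> sets M"
      proof -
        have [measurable]: "(\<lambda>x. \<Sum>i<n. D i x) \<in> borel_measurable M" using Dm by (intro borel_measurable_sum) auto
        have "{x \<in> space M. t < \<bar>\<Sum>i<n. D i x\<bar>} \<in> sets M" by measurable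
        then have "{x. t < \<bar>\<Sum>i<n. D i x\<bar>} - Q \<in> sets M" using Qm by auto
        also have "{x. t < \<bar>\<Sum>i<n. D i x\<bar>} - Q = A2" by (auto simp: A2_def)
        finally show ?thesis .
      qed
      have A2: "measure M A2 \<le> (6 * C + C ^ 3) * m"
      proof -
        have "t * measure M A2 \<le> (\<integral>x. (\<Sum>i<n. indicator (- Q) x * \<bar>D i x\<bar>) \<partial>M)"
        proof (rule chebyshev_measure)
          show "integrable M (\<lambda>x. \<Sum>i<n. indicator (- Q) x * \<bar>D i x\<bar>)"
            using bad by (intro Bochner_Integration.integrable_sum) auto
          show "t \<le> (\<Sum>i<n. indicator (- Q) x * \<bar>D i x\<bar>)" if "x \<in> A2" for x
          proof -
            have "\<bar>\<Sum>i<n. D i x\<bar> \<le> (\<Sum>i<n. \<bar>D i x\<bar>)" by (rule sum_abs)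
            moreover have x: "x \<notin> Q" "t < \<bar>\<Sum>i<n. D i x\<bar>" using that by (auto simp: A2_def)
            ultimately have "t \<le> (\<Sum>i<n. \<bar>D i x\<bar>)" by linarith
            then show ?thesis using x(1) by simp
          qed
        qed (use A2m in \<open>auto intro: sum_nonneg\<close>)
        also have "\<dots> = (\<Sum>i<n. \<integral>x. indicator (- Q) x * \<bar>D i x\<bar> \<partial>M)"
          using bad by (subst Bochner_Integration.integral_sum) auto
        also have "\<dots> \<le> (\<Sum>i<n. (6 * C + C ^ 3) * (\<integral>y. b i y \<partial>M))"
          using bad by (intro sum_mono) auto
        also have "\<dots> \<le> (6 * C + C ^ 3) * (t * m)"
          unfolding sum_distrib_left[symmetric] using aint C_ge_1 by (intro mult_left_mono) auto
        finally have "t * measure M A2 \<le> t * ((6 * C + C ^ 3) * m)" by (simp add: mult_ac)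
        then show ?thesis using t by simp
      qed
      define A3 where "A3 = {x. 1 < \<bar>T \<delta> Wf x\<bar>}"
      have A3m: "A3 \<in> sets M"
        unfolding A3_def by (rule T_superlevel_sets[OF \<delta> Wm])
      have A3: "measure M A3 \<le> C0 * m"
      proof -
        have WL2: "Wf \<in> L2 M" using Wm W01 by (intro bounded_in_L2[of _ 1]) auto
        have "(\<integral>x. (Wf x)\<^sup>2 \<partial>M) \<le> (\<integral>x. Wf x \<partial>M)"
        proof (rule integral_mono)
          show "(Wf x)\<^sup>2 \<le> Wf x" for x using W01[of x] by (simp add: power2_eq_square mult_left_le)
        qed (use WL2 IW in \<open>auto simp: L2_def\<close>)
        then have "C0 * (\<integral>x. (Wf x)\<^sup>2 \<partial>M) / 1\<^sup>2 \<le> C0 * m" using C0 intW by (simp add: mult_left_mono)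
        then show ?thesis unfolding A3_def using T_L2_measure[OF WL2 \<delta>, of 1] by linarith
      qed
      define N where "N x = (\<Sum>i<n. indicator (ball (c i) (3 * r i)) x * T \<delta> (w i) x)" for x
      define A4 where "A4 = {x. 1 < \<bar>N x\<bar>}"
      have A4m: "A4 \<in> sets M"
      proof -
        have [measurable]: "N \<in> borel_measurable M" unfolding N_def[abs_def] using w \<delta>
          by (intro borel_measurable_sum borel_measurable_times borel_measurable_indicator T_meas) auto
        have "{x \<in> space M. 1 < \<bar>N x\<bar>} \<in> sets M" by measurable
        then show ?thesis by (simp add: A4_def)
      qed
      have A4: "measure M A4 \<le> (4 * C0 + 4 + 2 * C) * m"
      proof -
        have "measure M A4 \<le> (4 * C0 + 4 + 2 * C) * (\<Sum>i<n. \<integral>y. w i y \<partial>M)"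
          unfolding A4_def N_def
        proof (rule weights_local_part)
          show "w i y = 0" if "i < n" "r i < dist (c i) y" for i y
            using that w(5) by (simp add: r_def)
        qed (use w r \<delta> in auto)
        also have "\<dots> \<le> (4 * C0 + 4 + 2 * C) * m"
          using asum w(4) C0 C_ge_1 by (intro mult_left_mono) auto
        finally show ?thesis .
      qed
      have sub: "{x. \<bar>T \<delta> f x\<bar> > 5 * t} \<subseteq> A1 \<union> Q \<union> A2 \<union> A3 \<union> A4"
      proof (rule subsetI, rule ccontr)
        fix x assume x: "x \<in> {x. \<bar>T \<delta> f x\<bar> > 5 * t}" and nx: "x \<notin> A1 \<union> Q \<union> A2 \<union> A3 \<union> A4"
        define d where "d x = indicator (G - U n) x * f x" for x
        have Id: "integrable M d" unfolding d_def[abs_def] using If Gm by (intro indicator_mult_integrable) auto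
        have Ib: "integrable M (\<lambda>x. \<Sum>i<n. b i x)" using b by auto
        have "f = (\<lambda>x. (g x + d x) + (\<Sum>i<n. b i x))"
          unfolding bsum using UG[of n] by (auto simp: g_def d_def indicator_def fun_eq_iff)
        then have "T \<delta> f x = T \<delta> (\<lambda>x. (g x + d x) + (\<Sum>i<n. b i x)) x" by simp
        also have "\<dots> = T \<delta> (\<lambda>x. g x + d x) x + T \<delta> (\<lambda>x. \<Sum>i<n. b i x) x"
          using Ig Id Ib by (intro T_add \<delta>) auto
        also have "T \<delta> (\<lambda>x. g x + d x) x = T \<delta> g x + T \<delta> d x"
          using Ig Id by (intro T_add \<delta>) auto
        also have "T \<delta> (\<lambda>x. \<Sum>i<n. b i x) x = (\<Sum>i<n. T \<delta> (b i) x)"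
          using b by (intro T_sum \<delta>) auto
        \<comment> \<open>What was subtracted in \<open>D\<close> is added back: the far parts of
          the weights, which amount to the operator on their sum minus the local parts.\<close>
        also have "\<dots> = (\<Sum>i<n. D i x) + t * (\<Sum>i<n. indicator (- ball (c i) (3 * r i)) x * T \<delta> (w i) x)"
          unfolding D_def sum_subtractf sum_distrib_left by (rule diff_add_cancel[symmetric])
        also have "(\<Sum>i<n. indicator (- ball (c i) (3 * r i)) x * T \<delta> (w i) x) = T \<delta> Wf x - N x"
        proof -
          have "T \<delta> Wf x = (\<Sum>i<n. T \<delta> (w i) x)"
            unfolding Wf_def[abs_def] using Iw by (intro T_sum \<delta>) auto
          moreover have "indicator (- ball (c i) (3 * r i)) x * T \<delta> (w i) x
              = T \<delta> (w i) x - indicator (ball (c i) (3 * r i)) x * T \<delta> (w i) x" for i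
            by (auto simp: indicator_def)
          ultimately show ?thesis unfolding N_def by (simp only: sum_subtractf)
        qed
        finally have eq: "T \<delta> f x = T \<delta> g x + T \<delta> d x + ((\<Sum>i<n. D i x) + t * (T \<delta> Wf x - N x))" .
        have "\<bar>T \<delta> d x\<bar> \<le> (\<integral>y. \<bar>d y\<bar> \<partial>M) / h \<delta>" by (rule T_bound[OF \<delta> Id])
        also have "\<dots> \<le> t" using n h_pos[OF \<delta>] by (simp add: divide_le_eq d_def)
        finally have 1: "\<bar>T \<delta> d x\<bar> \<le> t" .
        have 2: "\<bar>T \<delta> g x\<bar> \<le> t" "\<bar>\<Sum>i<n. D i x\<bar> \<le> t" "\<bar>T \<delta> Wf x\<bar> \<le> 1" "\<bar>N x\<bar> \<le> 1"
          using nx by (auto simp: A1_def A2_def A3_def A4_def)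
        have "\<bar>t * (T \<delta> Wf x - N x)\<bar> = t * \<bar>T \<delta> Wf x - N x\<bar>" using t by (simp add: abs_mult)
        also have "\<dots> \<le> t * 2" using 2(3,4) t by (intro mult_left_mono) linarith+
        finally have "\<bar>t * (T \<delta> Wf x - N x)\<bar> \<le> 2 * t" by simp
        then have "\<bar>T \<delta> f x\<bar> \<le> 5 * t" unfolding eq using 1 2(1,2) by linarith
        then show False using x by simp
      qed
      have ms: "A1 \<union> Q \<union> A2 \<union> A3 \<in> sets M" "A1 \<union> Q \<union> A2 \<in> sets M" "A1 \<union> Q \<in> sets M"
        using A1m Qm A2m A3m by (intro sets.Un; simp)+
      have "measure M {x. \<bar>T \<delta> f x\<bar> > 5 * t} \<le> measure M (A1 \<union> Q \<union> A2 \<union> A3 \<union> A4)"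
        by (rule finite_measure_mono[OF sub sets.Un[OF ms(1) A4m]])
      also have "\<dots> \<le> measure M A1 + measure M Q + measure M A2 + measure M A3 + measure M A4"
        using measure_Un_le[OF ms(1) A4m] measure_Un_le[OF ms(2) A3m] measure_Un_le[OF ms(3) A2m]
          measure_Un_le[OF A1m Qm] by linarith
      also have "\<dots> \<le> weak_const * m"
        using A1 muQ A2 A3 A4 by (simp add: weak_const_def algebra_simps)
      finally show ?thesis by (simp add: m_def)
    qed
  qed
qed

text \<open>L1 approximation at the fixed truncation \<delta>: an error of at most
  \<open>t * h \<delta>\<close> becomes at most \<open>t\<close> pointwise, which raises the level
  from \<open>5 * t\<close> to \<open>6 * t\<close>. The second entry of the minimum keeps the loss
  on the right below \<open>e\<close>.\<close>

lemma weak_type_nonneg: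
  assumes \<delta>: "\<delta> > 0" and f: "integrable M f" "\<And>x. 0 \<le> f x" and t: "t > 0"
  shows "measure M {x. \<bar>T \<delta> f x\<bar> > 6 * t} \<le> weak_const * ((\<integral>x. f x \<partial>M) / t)"
proof (rule field_le_epsilon)
  fix e :: real assume e: "e > 0"
  define e' where "e' = min (t * h \<delta>) (e * t / weak_const)"
  have wc: "weak_const > 0" using weak_const_ge_1 by linarith
  have e': "e' > 0" using t h_pos[OF \<delta>] e wc by (simp add: e'_def)
  obtain g where g: "bounded_lipschitz g" "\<And>x. g x \<ge> 0" "(\<integral>x. \<bar>f x - g x\<bar> \<partial>M) < e'"
    by (rule bounded_lipschitz_dense_L1_nonneg[OF finite_measure_axioms sets_M f e']) (rule that)
  have Ig: "integrable M g" using bounded_lipschitz_integrable[OF finite_measure_axioms sets_M g(1)] .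
  have "{x. \<bar>T \<delta> f x\<bar> > 6 * t} \<subseteq> {x. \<bar>T \<delta> g x\<bar> > 5 * t}"
  proof
    fix x assume "x \<in> {x. \<bar>T \<delta> f x\<bar> > 6 * t}"
    moreover have "\<bar>T \<delta> f x - T \<delta> g x\<bar> \<le> t"
    proof -
      have "\<bar>T \<delta> (\<lambda>y. f y - g y) x\<bar> \<le> (\<integral>y. \<bar>f y - g y\<bar> \<partial>M) / h \<delta>"
        using f Ig by (intro T_bound \<delta>) auto
      also have "\<dots> \<le> t" using g(3) h_pos[OF \<delta>] by (simp add: e'_def divide_le_eq)
      finally show ?thesis using T_diff[OF \<delta> f(1) Ig] by simp
    qed
    ultimately show "x \<in> {x. \<bar>T \<delta> g x\<bar> > 5 * t}" by auto
  qed
  moreover have "{x. \<bar>T \<delta> g x\<bar> > 5 * t} \<in> sets M"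
    using Ig by (intro T_superlevel_sets \<delta>) auto
  ultimately have "measure M {x. \<bar>T \<delta> f x\<bar> > 6 * t} \<le> measure M {x. \<bar>T \<delta> g x\<bar> > 5 * t}"
    by (intro finite_measure_mono)
  also have "\<dots> \<le> weak_const * ((\<integral>x. g x \<partial>M) / t)" by (rule weak_type_lipschitz[OF \<delta> g(1,2) t])
  also have "\<dots> \<le> weak_const * (((\<integral>x. f x \<partial>M) + e') / t)"
  proof -
    have "(\<integral>x. g x \<partial>M) - (\<integral>x. f x \<partial>M) = (\<integral>x. g x - f x \<partial>M)" using Ig f by simp
    also have "\<dots> \<le> (\<integral>x. \<bar>f x - g x\<bar> \<partial>M)" using Ig f by (intro integral_mono) auto
    finally show ?thesis using g(3) wc t by (intro mult_left_mono divide_right_mono) auto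
  qed
  also have "\<dots> \<le> weak_const * ((\<integral>x. f x \<partial>M) / t) + e"
  proof -
    have "weak_const * e' / t \<le> e" using wc t by (simp add: e'_def field_simps min_def)
    then show ?thesis by (simp add: add_divide_distrib distrib_left)
  qed
  finally show "measure M {x. \<bar>T \<delta> f x\<bar> > 6 * t} \<le> weak_const * ((\<integral>x. f x \<partial>M) / t) + e" .
qed

text \<open>The positive or the negative part must contribute more than
  \<open>t / 2 = 6 * (t / 12)\<close>, whence the factor 12.\<close>

lemma weak_type:
  assumes \<delta>: "\<delta> > 0" and f: "integrable M f" and t: "t > 0"
  shows "measure M {x. \<bar>T \<delta> f x\<bar> > t} \<le> 12 * weak_const * ((\<integral>x. \<bar>f x\<bar> \<partial>M) / t)"
proof -
  define p n where "p x = max 0 (f x)" and "n x = max 0 (- f x)" for x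
  have I: "integrable M p" "integrable M n" unfolding p_def[abs_def] n_def[abs_def] using f by auto
  have pos: "0 \<le> p x" "0 \<le> n x" for x by (auto simp: p_def n_def)
  have "f = (\<lambda>x. p x - n x)" by (auto simp: p_def n_def)
  then have Tf: "T \<delta> f x = T \<delta> p x - T \<delta> n x" for x using T_diff[OF \<delta> I] by simp
  have ms: "{x. \<bar>T \<delta> g x\<bar> > 6 * (t / 12)} \<in> sets M" if "integrable M g" for g
    using that by (intro T_superlevel_sets \<delta>) auto
  have "measure M {x. \<bar>T \<delta> f x\<bar> > t}
      \<le> measure M ({x. \<bar>T \<delta> p x\<bar> > 6 * (t / 12)} \<union> {x. \<bar>T \<delta> n x\<bar> > 6 * (t / 12)})"
    using ms[OF I(1)] ms[OF I(2)] by (intro finite_measure_mono) (auto simp: Tf)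
  also have "\<dots> \<le> measure M {x. \<bar>T \<delta> p x\<bar> > 6 * (t / 12)} + measure M {x. \<bar>T \<delta> n x\<bar> > 6 * (t / 12)}"
    by (rule measure_Un_le[OF ms[OF I(1)] ms[OF I(2)]])
  also have "\<dots> \<le> weak_const * ((\<integral>x. p x \<partial>M) / (t / 12)) + weak_const * ((\<integral>x. n x \<partial>M) / (t / 12))"
    using t by (intro add_mono weak_type_nonneg \<delta> I pos) auto
  also have "\<dots> = 12 * weak_const * (((\<integral>x. p x \<partial>M) + (\<integral>x. n x \<partial>M)) / t)"
    using t by (simp add: field_simps)
  also have "(\<integral>x. p x \<partial>M) + (\<integral>x. n x \<partial>M) = (\<integral>x. p x + n x \<partial>M)" using I by simp
  also have "(\<lambda>x. p x + n x) = (\<lambda>x. \<bar>f x\<bar>)" by (auto simp: p_def n_def)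
  finally show ?thesis .
qed

end

section \<open>Cotlar's inequality\<close>

context singular_kernel
begin

text \<open>Twice the growth of \<open>h\<close> over a factor 32. At a scale that is not doubling
  the measure grows by more than this, so its ratio to \<open>h\<close> at least doubles. The factor
  \<open>32 = 2^5\<close> leaves room for the threefold dilation of a ball of radius
  \<open>4 * R\<close>.\<close>

definition dbl :: real where "dbl = 2 * C ^ 5"

lemma dbl_ge: "dbl \<ge> 2"
  unfolding dbl_def using one_le_power[OF C_ge_1, of 5] by simp

lemma h_32: "r > 0 \<Longrightarrow> h (32 * r) \<le> C ^ 5 * h r"
  using h_pow2[of r 5] by simp

lemma maximal_mass:
  assumes f: "integrable M f" and t: "t > 0"
  shows "outer_le M {x. \<exists>r>0. mass f x r > t * measure M (ball x (3 * r))} ((\<integral>y. \<bar>f y\<bar> \<partial>M) / t)"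
  using maximal_function_weak_type[OF finite_measure_axioms sets_M integrable_abs[OF f] _ t]
  by (simp add: mass_def set_lebesgue_integral_def)

text \<open>The points outside the support are centres of null balls, to which the covering lemma
  applies with the bound 0; \<open>P\<close> speaks of the tripled ball because those are the balls
  that are summed.\<close>

lemma AE_support: "AE x in M. \<forall>r>0. measure M (ball x r) > 0"
proof (rule AE_outer_le)
  fix e :: real assume e: "e > 0"
  have "outer_le M {x. \<exists>r>0. measure M (ball x (3 * r)) = 0} 0"
    by (rule outer_le_of_ball_cover[OF finite_measure_axioms sets_M, where
          P="\<lambda>x r. measure M (ball x (3 * r)) = 0"]) (auto intro!: sum_nonpos)
  moreover have "{x \<in> space M. \<not> (\<forall>r>0. measure M (ball x r) > 0)}
      \<subseteq> {x. \<exists>r>0. measure M (ball x (3 * r)) = 0}"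
  proof
    fix x assume "x \<in> {x \<in> space M. \<not> (\<forall>r>0. measure M (ball x r) > 0)}"
    then obtain r where "r > 0" "measure M (ball x r) = 0" by (auto simp: zero_less_measure_iff)
    then show "x \<in> {x. \<exists>r>0. measure M (ball x (3 * r)) = 0}" by (intro CollectI exI[of _ "r/3"]) auto
  qed
  ultimately show "outer_le M {x \<in> space M. \<not> (\<forall>r>0. measure M (ball x r) > 0)} e"
    using e by (auto intro: outer_le_mono)
qed

text \<open>Telescoping along the scales \<open>32^j * \<epsilon>\<close>: a step from
  \<open>s\<close> to \<open>32 * s\<close> costs at most \<open>A\<close> times the measure at
  \<open>32 * (32 * s)\<close> over \<open>h s\<close>. The two-term bound is made for the
  induction. By the choice of \<open>dbl\<close> its second term is at most
  \<open>C^5 * measure M (ball x (32 * s))\<close>, just like its first, and passing from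
  \<open>h s\<close> to \<open>h (32 * s)\<close> turns both into the second term of the next bound.
  So the whole sum is controlled by the last two measures, however long the chain.\<close>

lemma T_nondoubling_chain:
  assumes f: "integrable M f" and A: "A \<ge> 0" "\<And>s. s > 0 \<Longrightarrow> mass f x s \<le> A * measure M (ball x (32 * s))"
    and \<epsilon>: "\<epsilon> > 0"
    and nd: "\<And>j. j < k \<Longrightarrow> dbl * measure M (ball x (32 ^ j * \<epsilon>)) \<le> measure M (ball x (32 * (32 ^ j * \<epsilon>)))"
  shows "\<bar>T \<epsilon> f x - T (32 ^ k * \<epsilon>) f x\<bar>
    \<le> A * (C ^ 5 * measure M (ball x (32 * (32 ^ k * \<epsilon>))) + 2 * C ^ 10 * measure M (ball x (32 ^ k * \<epsilon>)))
        / h (32 ^ k * \<epsilon>)"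
  using nd
proof (induction k)
  case 0
  have "0 \<le> A * (C ^ 5 * measure M (ball x (32 * \<epsilon>)) + 2 * C ^ 10 * measure M (ball x \<epsilon>)) / h \<epsilon>"
    using A C_ge_1 h_pos[OF \<epsilon>] by (intro divide_nonneg_pos mult_nonneg_nonneg add_nonneg_nonneg) auto
  then show ?case by simp
next
  case (Suc k)
  define s where "s = 32 ^ k * \<epsilon>"
  have s: "s > 0" using \<epsilon> by (simp add: s_def)
  have Suc_s: "32 ^ Suc k * \<epsilon> = 32 * s" by (simp add: s_def)
  let ?m0 = "measure M (ball x s)" and ?m1 = "measure M (ball x (32 * s))"
    and ?m2 = "measure M (ball x (32 * (32 * s)))"
  have IH: "\<bar>T \<epsilon> f x - T s f x\<bar> \<le> A * (C ^ 5 * ?m1 + 2 * C ^ 10 * ?m0) / h s"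
    using Suc by (simp add: s_def)
  have st: "\<bar>T s f x - T (32 * s) f x\<bar> \<le> A * ?m2 / h s"
  proof -
    have "\<bar>T s f x - T (32 * s) f x\<bar> \<le> mass f x (32 * s) / h s"
      using s by (intro T_cut_diff f) auto
    also have "\<dots> \<le> A * ?m2 / h s"
      using A(2)[of "32 * s"] s h_pos[OF s] by (intro divide_right_mono) auto
    finally show ?thesis .
  qed
  have d: "2 * C ^ 5 * ?m0 \<le> ?m1" using Suc.prems[of k] by (simp add: s_def dbl_def)
  have "\<bar>T \<epsilon> f x - T (32 * s) f x\<bar> \<le> \<bar>T \<epsilon> f x - T s f x\<bar> + \<bar>T s f x - T (32 * s) f x\<bar>" by simp
  also have "\<dots> \<le> A * (C ^ 5 * ?m1 + 2 * C ^ 10 * ?m0) / h s + A * ?m2 / h s" using IH st by linarith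
  also have "\<dots> = A * (?m2 + C ^ 5 * ?m1 + C ^ 5 * (2 * C ^ 5 * ?m0)) / h s"
  proof -
    have "2 * C ^ 10 * ?m0 = C ^ 5 * (2 * C ^ 5 * ?m0)" by (simp flip: power_add)
    then show ?thesis by (simp add: add_divide_distrib[symmetric] distrib_left add_ac)
  qed
  also have "\<dots> \<le> A * (?m2 + C ^ 5 * ?m1 + C ^ 5 * ?m1) / h s"
    using d A C_ge_1 h_pos[OF s] by (intro divide_right_mono mult_left_mono add_mono) auto
  also have "\<dots> = A * (C ^ 5 * ?m2 + 2 * C ^ 10 * ?m1) / (C ^ 5 * h s)"
  proof -
    have "C ^ 5 * ?m2 + 2 * C ^ 10 * ?m1 = C ^ 5 * (?m2 + C ^ 5 * ?m1 + C ^ 5 * ?m1)"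
      by (simp add: algebra_simps flip: power_add)
    moreover have "C ^ 5 \<noteq> 0" using C_ge_1 by auto
    ultimately show ?thesis by (simp add: mult.left_commute[of A])
  qed
  also have "\<dots> \<le> A * (C ^ 5 * ?m2 + 2 * C ^ 10 * ?m1) / h (32 * s)"
    using h_32[OF s] h_pos[of "32 * s"] h_pos[OF s] s A C_ge_1
    by (intro divide_left_mono mult_nonneg_nonneg add_nonneg_nonneg mult_pos_pos) auto
  finally show ?case unfolding Suc_s .
qed

lemma T_nondoubling_chain':
  assumes "integrable M f" and "A \<ge> 0" "\<And>s. s > 0 \<Longrightarrow> mass f x s \<le> A * measure M (ball x (32 * s))"
    and "\<epsilon> > 0"
    and "\<And>j. j < k \<Longrightarrow> dbl * measure M (ball x (32 ^ j * \<epsilon>)) \<le> measure M (ball x (32 * (32 ^ j * \<epsilon>)))"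
  shows "\<bar>T \<epsilon> f x - T (32 ^ k * \<epsilon>) f x\<bar>
    \<le> A * (3 * C ^ 10 * measure M (ball x (32 * (32 ^ k * \<epsilon>)))) / h (32 ^ k * \<epsilon>)"
proof -
  let ?s = "32 ^ k * \<epsilon>"
  have s: "?s > 0" using assms(4) by simp
  have "\<bar>T \<epsilon> f x - T ?s f x\<bar> \<le> A * (C ^ 5 * measure M (ball x (32 * ?s)) + 2 * C ^ 10 * measure M (ball x ?s)) / h ?s"
    by (rule T_nondoubling_chain[OF assms])
  also have "\<dots> \<le> A * (C ^ 10 * measure M (ball x (32 * ?s)) + 2 * C ^ 10 * measure M (ball x (32 * ?s))) / h ?s"
    using assms(2) h_pos[OF s] C_ge_1 s less_imp_le[OF assms(4)]
    by (intro divide_right_mono mult_left_mono add_mono mult_right_mono power_increasing finite_measure_mono subset_ball) auto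
  finally show ?thesis by (simp add: algebra_simps)
qed

end

context bounded_singular_kernel
begin

text \<open>Small enough for two purposes in \<open>cotlar\<close>. With
  \<open>A = cotlar_const * t\<close>, five errors of size \<open>C^15 * A\<close> stay below
  \<open>t / 3\<close>; and the weak type bound for the part of \<open>f\<close> near
  \<open>x\<close> carries the factor
  \<open>12 * 3 * weak_const * dbl * cotlar_const = 1 / (60 * C^15)\<close>, at most a
  quarter.\<close>

definition cotlar_const :: real where "cotlar_const = 1 / (2160 * C ^ 15 * weak_const * dbl)"

lemma cotlar_const_pos: "cotlar_const > 0"
  unfolding cotlar_const_def using C_ge_1 weak_const_ge_1 dbl_ge
  by (intro divide_pos_pos mult_pos_pos zero_less_power) linarith+

text \<open>If the truncation at \<open>\<epsilon>\<close> were large at \<open>x\<close>, then so would be the one at \<open>\<delta>\<close>, or its part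
  coming from \<open>B(x, 4 R)\<close>, on all of \<open>B(x, R)\<close>, where \<open>R\<close> is the first of the scales \<open>32\<^sup>k \<epsilon>\<close> that is
  doubling at \<open>x\<close>.\<close>

lemma cotlar:
  assumes f: "integrable M f" and t: "t > 0" and \<delta>: "0 < \<delta>" "\<delta> \<le> \<epsilon>"
    and x: "\<And>r. r > 0 \<Longrightarrow> measure M (ball x r) > 0"
    and A: "\<And>s. s > 0 \<Longrightarrow> mass f x s \<le> cotlar_const * t * measure M (ball x (3 * s))"
    and L: "\<And>s. s > 0 \<Longrightarrow> mass (indicator {z. t / 3 < \<bar>T \<delta> f z\<bar>}) x s \<le> 1 / (4 * dbl) * measure M (ball x (3 * s))"
  shows "\<bar>T \<epsilon> f x\<bar> \<le> t"
proof (rule ccontr)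
  assume "\<not> \<bar>T \<epsilon> f x\<bar> \<le> t"
  then have gt: "\<bar>T \<epsilon> f x\<bar> > t" by simp
  define A where "A = cotlar_const * t"
  have A0: "A \<ge> 0" using cotlar_const_pos t by (simp add: A_def)
  have \<epsilon>: "\<epsilon> > 0" using \<delta> by simp
  have A3: "mass f x s \<le> A * measure M (ball x (3 * s))" if "s > 0" for s
    using assms(6)[OF that] by (simp add: A_def)
  have A32: "mass f x s \<le> A * measure M (ball x (32 * s))" if "s > 0" for s
  proof -
    have "measure M (ball x (3 * s)) \<le> measure M (ball x (32 * s))"
      using that by (intro finite_measure_mono subset_ball) auto
    then show ?thesis using A3[OF that] A0 by (meson mult_left_mono order_trans)
  qed
  define nd where "nd j \<longleftrightarrow> dbl * measure M (ball x (32 ^ j * \<epsilon>)) \<le> measure M (ball x (32 * (32 ^ j * \<epsilon>)))" for j :: nat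
  \<comment> \<open>If no scale were doubling, the measures of the balls would at least double at
    every step and exceed the total mass.\<close>
  have "\<exists>j. \<not> nd j"
  proof (rule ccontr)
    assume "\<not> (\<exists>j. \<not> nd j)"
    then have nd: "nd j" for j by blast
    have "2 ^ j * measure M (ball x \<epsilon>) \<le> measure M (ball x (32 ^ j * \<epsilon>))" for j
    proof (induction j)
      case (Suc j)
      have "2 ^ Suc j * measure M (ball x \<epsilon>) \<le> 2 * measure M (ball x (32 ^ j * \<epsilon>))" using Suc by simp
      also have "\<dots> \<le> dbl * measure M (ball x (32 ^ j * \<epsilon>))" using dbl_ge by (intro mult_right_mono) auto
      also have "\<dots> \<le> measure M (ball x (32 ^ Suc j * \<epsilon>))" using nd[of j] by (simp add: nd_def mult.assoc)
      finally show ?case .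
    qed simp
    then have le: "2 ^ j * measure M (ball x \<epsilon>) \<le> measure M UNIV" for j
      using bounded_measure[of "ball x (32 ^ j * \<epsilon>)"] by (auto intro: order_trans)
    obtain j where "measure M UNIV / measure M (ball x \<epsilon>) < 2 ^ j" using real_arch_pow[of 2] by auto
    then show False using le[of j] x[OF \<epsilon>] by (simp add: divide_less_eq)
  qed
  define k where "k = (LEAST j. \<not> nd j)"
  have k: "\<not> nd k" unfolding k_def using \<open>\<exists>j. \<not> nd j\<close> by (rule LeastI_ex)
  have less_k: "nd j" if "j < k" for j using not_less_Least[of j "\<lambda>j. \<not> nd j"] that by (auto simp: k_def)
  define R where "R = 32 ^ k * \<epsilon>"
  have R\<epsilon>: "\<epsilon> \<le> R" using \<epsilon> by (simp add: R_def)
  have R: "R > 0" using R\<epsilon> \<epsilon> by simp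
  have dR: "measure M (ball x (32 * R)) \<le> dbl * measure M (ball x R)" using k by (simp add: nd_def R_def)
  have growth': "measure M (ball x (2 ^ n * s)) \<le> C ^ n * h s" if "s > 0" for n s
    using growth[of "2 ^ n * s" x] h_pow2[OF that, of n] that by (auto intro: order_trans)
  have 1: "\<bar>T \<epsilon> f x - T R f x\<bar> \<le> 3 * C ^ 15 * A"
  proof -
    have "\<bar>T \<epsilon> f x - T R f x\<bar> \<le> A * (3 * C ^ 10 * measure M (ball x (32 * R))) / h R"
      unfolding R_def using less_k by (intro T_nondoubling_chain' f A0 A32 \<epsilon>) (auto simp: nd_def)
    also have "\<dots> \<le> A * (3 * C ^ 10 * (C ^ 5 * h R)) / h R"
      using growth'[OF R, of 5] h_pos[OF R] A0 C_ge_1 by (intro divide_right_mono mult_left_mono) auto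
    also have "\<dots> = 3 * C ^ 15 * A" using h_pos[OF R] by (simp flip: power_add)
    finally show ?thesis .
  qed
  have 2: "\<bar>T R f x - T (4 * R) f x\<bar> \<le> C ^ 15 * A"
  proof -
    have "\<bar>T R f x - T (4 * R) f x\<bar> \<le> mass f x (4 * R) / h R" using R by (intro T_cut_diff f) auto
    also have "\<dots> \<le> A * (C ^ 7 * h R) / h R"
    proof (intro divide_right_mono)
      have "mass f x (4 * R) \<le> A * measure M (ball x (32 * (4 * R)))" using R by (intro A32) auto
      also have "\<dots> \<le> A * (C ^ 7 * h R)" using growth'[OF R, of 7] A0 by (intro mult_left_mono) auto
      finally show "mass f x (4 * R) \<le> A * (C ^ 7 * h R)" .
    qed (use h_pos[OF R] in simp)
    also have "\<dots> = C ^ 7 * A" using h_pos[OF R] by simp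
    also have "\<dots> \<le> C ^ 15 * A" using C_ge_1 A0 by (intro mult_right_mono power_increasing) auto
    finally show ?thesis .
  qed
  let ?B = "ball x (4 * R)"
  have 3: "\<bar>T (4 * R) f x - T \<delta> (\<lambda>y. indicator (- ?B) y * f y) z\<bar> \<le> C ^ 15 * A" if z: "z \<in> ball x R" for z
  proof -
    have "mass f x s \<le> C ^ 5 * A * h s" if "s \<ge> 4 * R" for s
    proof -
      have s: "s > 0" using that R by simp
      have "mass f x s \<le> A * (C ^ 5 * h s)"
        using A32[OF s] growth'[OF s, of 5] A0 by (auto intro: order_trans mult_left_mono)
      then show ?thesis by (simp add: mult_ac)
    qed
    then have "\<bar>T (4 * R) f x - T \<delta> (\<lambda>y. indicator (- ?B) y * f y) z\<bar>
        \<le> dist x z / (4 * R) * (2 * (C * (C ^ 5 * A)))"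
      using z \<delta> R\<epsilon> R A0 C_ge_1 by (intro T_smooth_diff f) auto
    also have "\<dots> \<le> 1 / 2 * (2 * (C * (C ^ 5 * A)))"
      using z R A0 C_ge_1 by (intro mult_right_mono) (auto simp: divide_le_eq)
    also have "\<dots> = C ^ 6 * A" by (simp add: numeral_eq_Suc)
    also have "\<dots> \<le> C ^ 15 * A" using C_ge_1 A0 by (intro mult_right_mono power_increasing) auto
    finally show ?thesis .
  qed
  \<comment> \<open>The errors of the three comparisons above add up to \<open>3 + 1 + 1\<close>
    times \<open>C^15 * A\<close>.\<close>
  have A_small: "5 * (C ^ 15 * A) \<le> t / 3"
  proof -
    define p where "p = weak_const * dbl"
    have "1 * 2 \<le> p" unfolding p_def using weak_const_ge_1 dbl_ge by (intro mult_mono) auto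
    then have p: "p \<ge> 2" by simp
    define q where "q = C ^ 15"
    have q: "q > 0" using C_ge_1 by (simp add: q_def)
    have "A = t / (2160 * q * p)" by (simp add: A_def cotlar_const_def p_def q_def mult.assoc)
    then have "5 * (q * A) = t * (5 / (2160 * p))" using q p by simp
    also have "\<dots> \<le> t * (1 / 3)" using t p by (intro mult_left_mono) (auto simp: divide_le_eq)
    finally show ?thesis by (simp add: q_def)
  qed
  define f1 where "f1 y = indicator ?B y * f y" for y
  have f1: "integrable M f1" unfolding f1_def[abs_def] using f by (intro indicator_mult_integrable) auto
  have f2: "integrable M (\<lambda>y. indicator (- ?B) y * f y)" using f by (intro indicator_mult_integrable) auto
  let ?L = "{z. t / 3 < \<bar>T \<delta> f z\<bar>}" and ?L1 = "{z. t / 3 < \<bar>T \<delta> f1 z\<bar>}"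
  have split: "T \<delta> f z = T \<delta> f1 z + T \<delta> (\<lambda>y. indicator (- ?B) y * f y) z" for z
  proof -
    have "f = (\<lambda>y. f1 y + indicator (- ?B) y * f y)" by (auto simp: f1_def indicator_def fun_eq_iff)
    then have "T \<delta> f z = T \<delta> (\<lambda>y. f1 y + indicator (- ?B) y * f y) z" by simp
    then show ?thesis using T_add[OF \<delta>(1) f1 f2] by simp
  qed
  \<comment> \<open>The contradiction: one of two functions exceeds \<open>t / 3\<close> at every
    point of this ball, although each does so on at most a quarter of its measure.\<close>
  have sub: "ball x R \<subseteq> (?L \<inter> ball x R) \<union> ?L1"
  proof
    fix z assume z: "z \<in> ball x R"
    have "t < \<bar>T \<delta> f z\<bar> + \<bar>T \<delta> f1 z\<bar> + 5 * (C ^ 15 * A)"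
      using gt 1 2 3[OF z] split[of z] by linarith
    then show "z \<in> (?L \<inter> ball x R) \<union> ?L1" using A_small z by auto
  qed
  have ms: "{z. t / 3 < \<bar>T \<delta> g z\<bar>} \<in> sets M" if "integrable M g" for g
    using that \<delta> by (intro T_superlevel_sets) auto
  have LB: "?L \<inter> ball x R \<in> sets M" using ms[OF f] by auto
  have "measure M (ball x R) \<le> measure M (?L \<inter> ball x R) + measure M ?L1"
    using finite_measure_mono[OF sub] measure_Un_le[OF LB ms[OF f1]] LB ms[OF f1]
    by (meson order_trans sets.Un)
  moreover have "measure M (?L \<inter> ball x R) \<le> measure M (ball x R) / 4"
  proof -
    have "measure M (?L \<inter> ball x R) = mass (indicator ?L) x R"
      unfolding mass_def using LB
      by (simp add: indicator_inter_arith[symmetric] Int_commute flip: indicator_inter_arith)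
    also have "\<dots> \<le> 1 / (4 * dbl) * measure M (ball x (3 * R))" by (rule L[OF R])
    also have "\<dots> \<le> 1 / (4 * dbl) * (dbl * measure M (ball x R))"
    proof (intro mult_left_mono)
      have "measure M (ball x (3 * R)) \<le> measure M (ball x (32 * R))"
        using R by (intro finite_measure_mono subset_ball) auto
      then show "measure M (ball x (3 * R)) \<le> dbl * measure M (ball x R)" using dR by linarith
    qed (use dbl_ge in auto)
    also have "\<dots> = measure M (ball x R) / 4" using dbl_ge by simp
    finally show ?thesis .
  qed
  moreover have "measure M ?L1 \<le> measure M (ball x R) / 4"
  proof -
    have "measure M ?L1 \<le> 12 * weak_const * ((\<integral>y. \<bar>f1 y\<bar> \<partial>M) / (t / 3))"
      using t by (intro weak_type \<delta> f1) auto
    also have "(\<integral>y. \<bar>f1 y\<bar> \<partial>M) = mass f x (4 * R)" by (simp add: mass_def f1_def abs_mult)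
    also have "12 * weak_const * (mass f x (4 * R) / (t / 3))
        \<le> 12 * weak_const * (A * (dbl * measure M (ball x R)) / (t / 3))"
    proof (intro mult_left_mono divide_right_mono)
      have "measure M (ball x (3 * (4 * R))) \<le> measure M (ball x (32 * R))"
        using R by (intro finite_measure_mono subset_ball) auto
      then have "measure M (ball x (3 * (4 * R))) \<le> dbl * measure M (ball x R)" using dR by linarith
      then show "mass f x (4 * R) \<le> A * (dbl * measure M (ball x R))"
        using A3[of "4 * R"] R A0 by (auto intro: order_trans mult_left_mono)
    qed (use t weak_const_ge_1 in auto)
    also have "\<dots> = measure M (ball x R) / (60 * C ^ 15)"
      using t weak_const_ge_1 dbl_ge C_ge_1 by (simp add: A_def cotlar_const_def)
    also have "\<dots> \<le> measure M (ball x R) / 4"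
    proof (intro divide_left_mono)
      show "4 \<le> 60 * C ^ 15" using one_le_power[OF C_ge_1, of 15] by linarith
    qed (use C_ge_1 in auto)
    finally show ?thesis .
  qed
  ultimately show False using x[OF R] by linarith
qed

text \<open>The first term comes from the maximal function of \<open>f\<close> at level
  \<open>cotlar_const * t\<close>. In the second, \<open>144 = 12 * 3 * 4\<close>: the weak type
  bound at level \<open>t / 3\<close>, followed by the maximal function of that level set at level
  \<open>1 / (4 * dbl)\<close>.\<close>

definition max_const :: real where "max_const = 1 / cotlar_const + 144 * dbl * weak_const"

lemma max_const_pos: "max_const > 0"
  unfolding max_const_def using cotlar_const_pos dbl_ge weak_const_ge_1
  by (intro add_pos_pos divide_pos_pos mult_pos_pos) auto

text \<open>Cotlar's inequality compares all truncations at radii above \<delta> with the one at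
  \<delta>, off three exceptional sets whose measures are bounded independently of \<delta>. The
  sets \<open>S n\<close> increase as \<delta> tends to 0, so the bound survives in the
  limit.\<close>

lemma maximal_weak_type:
  assumes f: "integrable M f" and t: "t > 0"
  shows "outer_le M {x. \<exists>\<epsilon>>0. t < \<bar>T \<epsilon> f x\<bar>} (max_const * ((\<integral>y. \<bar>f y\<bar> \<partial>M) / t))"
proof -
  define \<delta> where "\<delta> n = inverse (real (Suc n))" for n
  define S where "S n = {x. \<exists>\<epsilon>\<ge>\<delta> n. t < \<bar>T \<epsilon> f x\<bar>}" for n
  let ?N = "\<integral>y. \<bar>f y\<bar> \<partial>M"
  have "outer_le M (S n) (max_const * (?N / t))" for n
  proof -
    have \<delta>: "\<delta> n > 0" by (simp add: \<delta>_def)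
    define L where "L = {z. t / 3 < \<bar>T (\<delta> n) f z\<bar>}"
    have Lm: "L \<in> sets M"
      unfolding L_def using f by (intro T_superlevel_sets \<delta>) auto
    have IL: "integrable M (indicator L :: 'a \<Rightarrow> real)"
      using Lm by (intro indicator_integrable) auto
    define Z where "Z = {x. \<not> (\<forall>r>0. measure M (ball x r) > 0)}"
    define S1 where "S1 = {x. \<exists>r>0. mass f x r > cotlar_const * t * measure M (ball x (3 * r))}"
    define S2 where "S2 = {x. \<exists>r>0. mass (indicator L) x r > 1 / (4 * dbl) * measure M (ball x (3 * r))}"
    have Z: "outer_le M Z 0" using AE_support by (intro outer_le_AE) (auto simp: Z_def)
    have 1: "outer_le M S1 (?N / (cotlar_const * t))"
      unfolding S1_def using cotlar_const_pos t by (intro maximal_mass f) auto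
    have "outer_le M S2 ((\<integral>y. \<bar>indicator L y\<bar> \<partial>M) / (1 / (4 * dbl)))"
      unfolding S2_def using dbl_ge by (intro maximal_mass IL) auto
    moreover have "(\<integral>y. \<bar>indicator L y :: real\<bar> \<partial>M) / (1 / (4 * dbl)) \<le> 144 * dbl * weak_const * (?N / t)"
    proof -
      have "measure M L \<le> 12 * weak_const * (?N / (t / 3))"
        unfolding L_def using t by (intro weak_type \<delta> f) auto
      then have "measure M L * (4 * dbl) \<le> 12 * weak_const * (?N / (t / 3)) * (4 * dbl)"
        using dbl_ge by (intro mult_right_mono) auto
      then show ?thesis using Lm by (simp add: mult_ac)
    qed
    ultimately have 2: "outer_le M S2 (144 * dbl * weak_const * (?N / t))"
      by (rule outer_le_mono[OF _ subset_refl])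
    have "S n \<subseteq> (Z \<union> S1) \<union> S2"
    proof (rule subsetI, rule ccontr)
      fix x assume x: "x \<in> S n" and nx: "x \<notin> (Z \<union> S1) \<union> S2"
      from x obtain \<epsilon> where \<epsilon>: "\<delta> n \<le> \<epsilon>" "t < \<bar>T \<epsilon> f x\<bar>" by (auto simp: S_def)
      have "\<bar>T \<epsilon> f x\<bar> \<le> t"
      proof (rule cotlar[OF f t \<delta> \<epsilon>(1)])
        show "measure M (ball x r) > 0" if "r > 0" for r using nx that by (auto simp: Z_def)
        show "mass f x s \<le> cotlar_const * t * measure M (ball x (3 * s))" if "s > 0" for s
          using nx that by (force simp: S1_def not_less)
        show "mass (indicator {z. t / 3 < \<bar>T (\<delta> n) f z\<bar>}) x s \<le> 1 / (4 * dbl) * measure M (ball x (3 * s))" if "s > 0" for s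
        proof -
          have "x \<notin> S2" using nx by blast
          then have "\<not> (\<exists>r>0. mass (indicator L) x r > 1 / (4 * dbl) * measure M (ball x (3 * r)))"
            unfolding S2_def by blast
          then have "\<not> mass (indicator L) x s > 1 / (4 * dbl) * measure M (ball x (3 * s))" using that by blast
          then show ?thesis unfolding L_def by (rule leI)
        qed
      qed
      then show False using \<epsilon> by simp
    qed
    moreover have "0 + ?N / (cotlar_const * t) + 144 * dbl * weak_const * (?N / t) = max_const * (?N / t)"
      using cotlar_const_pos t by (simp add: max_const_def field_simps)
    ultimately show ?thesis
      using outer_le_Un[OF outer_le_Un[OF Z 1] 2] by (metis order_refl outer_le_mono)
  qed
  moreover have "incseq S"
  proof (rule incseq_SucI)
    fix n
    have "\<delta> (Suc n) \<le> \<delta> n" by (simp add: \<delta>_def field_simps)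
    then show "S n \<subseteq> S (Suc n)" by (auto simp: S_def intro: order_trans)
  qed
  ultimately have "outer_le M (\<Union>n. S n) (max_const * (?N / t))" by (rule outer_le_incseq)
  moreover have "{x. \<exists>\<epsilon>>0. t < \<bar>T \<epsilon> f x\<bar>} \<subseteq> (\<Union>n. S n)"
  proof
    fix x assume "x \<in> {x. \<exists>\<epsilon>>0. t < \<bar>T \<epsilon> f x\<bar>}"
    then obtain \<epsilon> where \<epsilon>: "\<epsilon> > 0" "t < \<bar>T \<epsilon> f x\<bar>" by auto
    obtain n where "\<delta> n < \<epsilon>" using reals_Archimedean[OF \<epsilon>(1)] by (auto simp: \<delta>_def)
    then show "x \<in> (\<Union>n. S n)" using \<epsilon> by (auto simp: S_def intro!: exI[of _ n] exI[of _ \<epsilon>])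
  qed
  ultimately show ?thesis by (rule outer_le_mono) simp
qed

end

section \<open>Convergence for the constant function\<close>

lemma filterlim_at_right_0_sequence:
  fixes S :: "nat \<Rightarrow> real"
  assumes "\<And>n. 0 < S n" "S \<longlonglongrightarrow> 0"
  shows "filterlim S (at_right 0) sequentially"
  using assms(2) less_imp_neq[OF assms(1)] assms(1)
  by (auto simp: filterlim_at intro!: always_eventually)

lemma dominated_convergence_at_right:
  fixes s :: "real \<Rightarrow> 'a \<Rightarrow> real"
  assumes "f \<in> borel_measurable M" "\<And>\<epsilon>. \<epsilon> > 0 \<Longrightarrow> s \<epsilon> \<in> borel_measurable M" "integrable M w"
    and "\<And>\<epsilon>. \<epsilon> > 0 \<Longrightarrow> AE x in M. \<bar>s \<epsilon> x\<bar> \<le> w x"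
    and "AE x in M. ((\<lambda>\<epsilon>. s \<epsilon> x) \<longlongrightarrow> f x) (at_right 0)"
  shows "((\<lambda>\<epsilon>. \<integral>x. s \<epsilon> x \<partial>M) \<longlongrightarrow> (\<integral>x. f x \<partial>M)) (at_right 0)"
proof (rule tendsto_at_right_sequentially[of 0 1])
  fix S :: "nat \<Rightarrow> real" assume S: "\<And>n. 0 < S n" "S \<longlonglongrightarrow> 0"
  note fl = filterlim_at_right_0_sequence[OF S]
  show "(\<lambda>n. \<integral>x. s (S n) x \<partial>M) \<longlonglongrightarrow> (\<integral>x. f x \<partial>M)"
  proof (rule integral_dominated_convergence[where w=w])
    show "AE x in M. (\<lambda>n. s (S n) x) \<longlonglongrightarrow> f x"
      using assms(5) by eventually_elim (rule filterlim_compose[OF _ fl])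
  qed (use assms S in auto)
qed simp

lemma filterlim_inverse_Suc: "filterlim (\<lambda>n. inverse (real (Suc n))) (at_right 0) sequentially"
  using LIMSEQ_inverse_real_of_nat by (auto simp: filterlim_at intro!: always_eventually)

lemma convergent_at_right_Cauchy:
  fixes F :: "real \<Rightarrow> real"
  assumes "\<And>e. e > 0 \<Longrightarrow> \<exists>d>0. \<forall>a b. 0 < a \<and> a < d \<and> 0 < b \<and> b < d \<longrightarrow> \<bar>F a - F b\<bar> \<le> e"
  shows "\<exists>l. (F \<longlongrightarrow> l) (at_right 0)"
proof -
  define S where "S n = inverse (real (Suc n))" for n
  have S: "S n > 0" "S \<longlonglongrightarrow> 0" for n
    using LIMSEQ_inverse_real_of_nat by (simp_all add: S_def[abs_def])
  have "Cauchy (\<lambda>n. F (S n))"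
  proof (rule metric_CauchyI)
    fix e :: real assume "e > 0"
    then obtain d where d: "d > 0" "\<And>a b. 0 < a \<Longrightarrow> a < d \<Longrightarrow> 0 < b \<Longrightarrow> b < d \<Longrightarrow> \<bar>F a - F b\<bar> \<le> e/2"
      using assms[of "e/2"] by auto
    have "\<forall>\<^sub>F n in sequentially. S n < d" using S(2) d(1) by (rule order_tendstoD)
    then obtain N where "\<And>n. n \<ge> N \<Longrightarrow> S n < d" by (auto simp: eventually_sequentially)
    then have "dist (F (S m)) (F (S n)) < e" if "m \<ge> N" "n \<ge> N" for m n
      using d(2)[OF S(1)[of m] _ S(1)[of n]] that \<open>e > 0\<close> by (simp add: dist_real_def)
    then show "\<exists>N. \<forall>m\<ge>N. \<forall>n\<ge>N. dist (F (S m)) (F (S n)) < e" by blast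
  qed
  then obtain l where l: "(\<lambda>n. F (S n)) \<longlonglongrightarrow> l" using Cauchy_convergent convergent_def by blast
  have "(F \<longlongrightarrow> l) (at_right 0)"
  proof (rule tendstoI)
    fix e :: real assume "e > 0"
    then obtain d where d: "d > 0" "\<And>a b. 0 < a \<Longrightarrow> a < d \<Longrightarrow> 0 < b \<Longrightarrow> b < d \<Longrightarrow> \<bar>F a - F b\<bar> \<le> e/2"
      using assms[of "e/2"] by auto
    have "\<forall>\<^sub>F n in sequentially. S n < d" using S(2) d(1) by (rule order_tendstoD)
    then have ev: "\<forall>\<^sub>F n in sequentially. \<bar>F a - F (S n)\<bar> \<le> e/2" if "0 < a" "a < d" for a
      by eventually_elim (use that S(1) d(2) in auto)
    have "\<bar>F a - l\<bar> \<le> e/2" if "0 < a" "a < d" for a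
      by (rule tendsto_upperbound[OF _ ev[OF that]]) (auto intro!: tendsto_intros l)
    then have "dist (F a) l < e" if "0 < a" "a < d" for a
      using that \<open>e > 0\<close> unfolding dist_real_def by (smt (verit) field_sum_of_halves)
    then show "\<forall>\<^sub>F a in at_right 0. dist (F a) l < e"
      using d(1) by (auto simp: eventually_at_right_field)
  qed
  then show ?thesis by blast
qed

definition bump :: "'a::metric_space \<Rightarrow> real \<Rightarrow> 'a \<Rightarrow> real" where
  "bump x R z = max 0 (min 1 (2 - dist x z / R))"

lemma bump_bounds: "0 \<le> bump x R z" "bump x R z \<le> 1"
  by (auto simp: bump_def)

lemma bump_1: "R > 0 \<Longrightarrow> dist x z \<le> R \<Longrightarrow> bump x R z = 1"
proof -
  assume "R > 0" "dist x z \<le> R"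
  then have "dist x z / R \<le> 1" by simp
  then show ?thesis by (simp add: bump_def)
qed

lemma bump_0: "R > 0 \<Longrightarrow> 2 * R \<le> dist x z \<Longrightarrow> bump x R z = 0"
proof -
  assume "R > 0" "2 * R \<le> dist x z"
  then have "2 \<le> dist x z / R" by (simp add: field_simps)
  then show ?thesis by (simp add: bump_def)
qed

lemma bump_lip: "R > 0 \<Longrightarrow> \<bar>bump x R y - bump x R z\<bar> \<le> dist y z / R"
proof -
  assume R: "R > 0"
  have "\<bar>bump x R y - bump x R z\<bar> \<le> \<bar>dist x y / R - dist x z / R\<bar>"
    unfolding bump_def by linarith
  also have "\<dots> = \<bar>dist x y - dist x z\<bar> / R" using R by (simp flip: diff_divide_distrib)
  also have "\<dots> \<le> dist y z / R"
    using R dist_triangle[of x y z] dist_triangle[of x z y]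
    by (intro divide_right_mono) (auto simp: dist_commute abs_le_iff)
  finally show ?thesis .
qed

lemma bounded_lipschitz_bump: "R > 0 \<Longrightarrow> bounded_lipschitz (bump x R)"
  using bump_lip[of R x] bump_bounds[of x R]
  by (intro bounded_lipschitzI[of _ 1 "1 / R"]) (auto simp: abs_of_nonneg)

section \<open>The limit of \<open>T \<epsilon> 1\<close> as a functional on Lipschitz
  functions\<close>

context singular_kernel
begin

lemma lipschitz_integrable: "bounded_lipschitz f \<Longrightarrow> integrable M f"
  using bounded_lipschitz_integrable[OF finite_measure_axioms sets_M] .

lemma bump_mass:
  assumes R: "R > 0"
  shows "measure M (ball x R) \<le> (\<integral>z. bump x R z \<partial>M)"
proof -
  have "1 * measure M (ball x R) \<le> (\<integral>z. bump x R z \<partial>M)"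
  proof (rule chebyshev_measure)
    show "1 \<le> bump x R z" if "z \<in> ball x R" for z using that R by (simp add: bump_1)
  qed (use lipschitz_integrable[OF bounded_lipschitz_bump[OF R]] bump_bounds in auto)
  then show ?thesis by simp
qed

lemma lipschitz_mult_integrable:
  assumes "bounded_lipschitz f" "integrable M g"
  shows "integrable M (\<lambda>x. f x * g x)"
proof -
  obtain L where L: "\<And>x. \<bar>f x\<bar> \<le> L" using bounded_lipschitzE[OF assms(1)] by metis
  have [measurable]: "f \<in> borel_measurable M" using lipschitz_integrable[OF assms(1)] by auto
  show ?thesis
  proof (rule Bochner_Integration.integrable_bound)
    show "integrable M (\<lambda>x. L * \<bar>g x\<bar>)" using assms(2) by auto
    show "AE x in M. norm (f x * g x) \<le> norm (L * \<bar>g x\<bar>)"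
    proof (intro AE_I2)
      fix x
      have "\<bar>f x\<bar> * \<bar>g x\<bar> \<le> L * \<bar>g x\<bar>" using L by (intro mult_right_mono) auto
      also have "\<dots> \<le> \<bar>L\<bar> * \<bar>g x\<bar>" by (intro mult_right_mono) auto
      finally show "norm (f x * g x) \<le> norm (L * \<bar>g x\<bar>)" by (simp add: abs_mult)
    qed
  qed (use assms in auto)
qed

abbreviation (input) T1 where "T1 \<epsilon> x \<equiv> T \<epsilon> (\<lambda>_. 1) x"

lemma commutator_eq:
  assumes "\<epsilon> > 0" "integrable M \<phi>"
  shows "T \<epsilon> \<phi> x - \<phi> x * T1 \<epsilon> x = (\<integral>y. TK \<epsilon> x y * (\<phi> y - \<phi> x) \<partial>M)"
proof -
  have "(\<integral>y. TK \<epsilon> x y * (\<phi> y - \<phi> x) \<partial>M) = (\<integral>y. TK \<epsilon> x y * \<phi> y - \<phi> x * (TK \<epsilon> x y * 1) \<partial>M)"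
    by (intro Bochner_Integration.integral_cong) (auto simp: algebra_simps)
  also have "\<dots> = (\<integral>y. TK \<epsilon> x y * \<phi> y \<partial>M) - (\<integral>y. \<phi> x * (TK \<epsilon> x y * 1) \<partial>M)"
    using TK_integrable[OF assms] TK_integrable[OF assms(1), of "\<lambda>_. 1"]
    by (intro Bochner_Integration.integral_diff) auto
  finally show ?thesis unfolding T_eq by simp
qed

text \<open>The increment of \<phi> cancels the singularity: at distance below 1 the integrand is at
  most \<open>L * near 1 d\<close>, beyond it at most \<open>2 * L / h 1\<close>. This majorant does
  not depend on \<epsilon>, and its integral is bounded uniformly in \<open>x\<close>.\<close>

lemma commutator_bound_convergence:
  assumes \<phi>: "bounded_lipschitz \<phi>"
  obtains B where "\<And>\<epsilon> x. \<epsilon> > 0 \<Longrightarrow> \<bar>T \<epsilon> \<phi> x - \<phi> x * T1 \<epsilon> x\<bar> \<le> B"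
    "\<And>x. \<exists>l. ((\<lambda>\<epsilon>. T \<epsilon> \<phi> x - \<phi> x * T1 \<epsilon> x) \<longlongrightarrow> l) (at_right 0)"
proof -
  obtain L where L: "L \<ge> 0" "\<And>x. \<bar>\<phi> x\<bar> \<le> L" "\<And>x y. \<bar>\<phi> x - \<phi> y\<bar> \<le> L * dist x y"
    using bounded_lipschitzE[OF \<phi>] by metis
  have I\<phi>: "integrable M \<phi>" using lipschitz_integrable[OF \<phi>] .
  have h1: "h 1 > 0" by (intro h_pos) auto
  define w where "w x y = L * near 1 (dist x y) + 2 * L / h 1" for x y :: 'a
  have Iw: "integrable M (w x)" "(\<integral>y. w x y \<partial>M) \<le> L * (2 * C) + 2 * L / h 1 * measure M UNIV" for x
  proof -
    have g: "\<And>s. 0 < s \<Longrightarrow> s \<le> 1 \<Longrightarrow> measure M (ball x s) \<le> 1 * h s" using growth by auto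
    note n = near_integral[OF zero_less_one g]
    show "integrable M (w x)" unfolding w_def[abs_def] using n(1) by auto
    have "(\<integral>y. w x y \<partial>M) = L * (\<integral>y. near 1 (dist x y) \<partial>M) + 2 * L / h 1 * measure M UNIV"
      unfolding w_def using n(1) by (subst Bochner_Integration.integral_add) auto
    also have "\<dots> \<le> L * (2 * C) + 2 * L / h 1 * measure M UNIV"
      using n(2) L(1) by (intro add_right_mono mult_left_mono) auto
    finally show "(\<integral>y. w x y \<partial>M) \<le> L * (2 * C) + 2 * L / h 1 * measure M UNIV" .
  qed
  have bd: "\<bar>TK \<epsilon> x y * (\<phi> y - \<phi> x)\<bar> \<le> w x y" if \<epsilon>: "\<epsilon> > 0" for \<epsilon> x y
  proof -
    have nn: "0 \<le> L * near 1 (dist x y)" "0 \<le> 2 * L / h 1" using L(1) near_nonneg h1 by auto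
    show ?thesis
    proof (cases "\<epsilon> \<le> dist x y")
      case True
      then have d: "dist x y > 0" using \<epsilon> by linarith
      then have xy: "x \<noteq> y" by auto
      have eq: "\<bar>TK \<epsilon> x y * (\<phi> y - \<phi> x)\<bar> = \<bar>K x y\<bar> * \<bar>\<phi> y - \<phi> x\<bar>" using True by (simp add: TK_def abs_mult)
      show ?thesis
      proof (cases "dist x y < 1")
        case True
        have "\<bar>K x y\<bar> * \<bar>\<phi> y - \<phi> x\<bar> \<le> 1 / h (dist x y) * (L * dist x y)"
          using K_size[OF xy] L(3)[of y x] h_pos[OF d]
          by (intro mult_mono) (auto simp: dist_commute)
        also have "\<dots> = L * near 1 (dist x y)" using True d by (simp add: near_def)
        finally show ?thesis unfolding eq w_def using nn by linarith
      next
        case False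
        have "\<bar>K x y\<bar> \<le> 1 / h 1" using TK_bound[of 1 x y] False by (simp add: TK_def)
        moreover have "\<bar>\<phi> y - \<phi> x\<bar> \<le> 2 * L" using L(2)[of x] L(2)[of y] by linarith
        ultimately have "\<bar>K x y\<bar> * \<bar>\<phi> y - \<phi> x\<bar> \<le> 1 / h 1 * (2 * L)" using h1 by (intro mult_mono) auto
        then show ?thesis unfolding eq w_def using nn by simp
      qed
    qed (use nn in \<open>simp add: TK_def w_def\<close>)
  qed
  show ?thesis
  proof (rule that)
    fix \<epsilon> :: real and x assume \<epsilon>: "\<epsilon> > 0"
    show "\<bar>T \<epsilon> \<phi> x - \<phi> x * T1 \<epsilon> x\<bar> \<le> L * (2 * C) + 2 * L / h 1 * measure M UNIV"
      unfolding commutator_eq[OF \<epsilon> I\<phi>]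
      using abs_integral_le[OF Iw(1) bd[OF \<epsilon>]] Iw(2) by (meson order_trans)
  next
    fix x
    define q where "q y = (if x = y then 0 else K x y * (\<phi> y - \<phi> x))" for y
    have lim: "((\<lambda>\<epsilon>. TK \<epsilon> x y * (\<phi> y - \<phi> x)) \<longlongrightarrow> q y) (at_right 0)" for y
    proof (cases "x = y")
      case False
      then have "\<forall>\<^sub>F \<epsilon> in at_right 0. \<epsilon> < dist x y"
        by (auto simp: eventually_at_right_field intro!: exI[of _ "dist x y"])
      then have "\<forall>\<^sub>F \<epsilon> in at_right 0. TK \<epsilon> x y * (\<phi> y - \<phi> x) = q y"
        by eventually_elim (use False in \<open>auto simp: TK_def q_def\<close>)
      then show ?thesis by (rule tendsto_eventually)
    qed (simp add: q_def)
    have m: "(\<lambda>y. TK \<epsilon> x y * (\<phi> y - \<phi> x)) \<in> borel_measurable M" if "\<epsilon> > 0" for \<epsilon>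
      using TK_meas[OF that] I\<phi> by auto
    have qm: "q \<in> borel_measurable M"
    proof (rule borel_measurable_LIMSEQ_real)
      note fl = filterlim_inverse_Suc
      show "(\<lambda>n. TK (inverse (real (Suc n))) x y * (\<phi> y - \<phi> x)) \<longlonglongrightarrow> q y" for y
        by (rule filterlim_compose[OF lim fl])
    qed (use m in auto)
    have "((\<lambda>\<epsilon>. \<integral>y. TK \<epsilon> x y * (\<phi> y - \<phi> x) \<partial>M) \<longlongrightarrow> (\<integral>y. q y \<partial>M)) (at_right 0)"
      by (rule dominated_convergence_at_right[OF qm m Iw(1)]) (use bd lim in auto)
    moreover have "\<forall>\<^sub>F \<epsilon> in at_right 0. (\<integral>y. TK \<epsilon> x y * (\<phi> y - \<phi> x) \<partial>M) = T \<epsilon> \<phi> x - \<phi> x * T1 \<epsilon> x"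
      unfolding eventually_at_right_field
      by (intro exI[of _ 1]) (use commutator_eq[OF _ I\<phi>] in auto)
    ultimately have "((\<lambda>\<epsilon>. T \<epsilon> \<phi> x - \<phi> x * T1 \<epsilon> x) \<longlongrightarrow> (\<integral>y. q y \<partial>M)) (at_right 0)"
      by (rule Lim_transform_eventually)
    then show "\<exists>l. ((\<lambda>\<epsilon>. T \<epsilon> \<phi> x - \<phi> x * T1 \<epsilon> x) \<longlongrightarrow> l) (at_right 0)" by blast
  qed
qed

text \<open>The weak limit of \<open>T \<epsilon> 1\<close>, tested with \<phi>. The value carries
  information once the limit is known to exist, which is proved for bounded Lipschitz
  \<phi>.\<close>

definition pairing :: "('a \<Rightarrow> real) \<Rightarrow> real" where
  "pairing \<phi> = Lim (at_right 0) (\<lambda>\<epsilon>. \<integral>x. \<phi> x * T1 \<epsilon> x \<partial>M)"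

text \<open>By antisymmetry the integral of \<open>T \<epsilon> \<phi>\<close> is minus that of
  \<open>\<phi> * T1 \<epsilon>\<close>. So the integral of the commutator is -2 times the quantity
  in question, and it converges by bounded convergence.\<close>

lemma pairing_tendsto:
  assumes \<phi>: "bounded_lipschitz \<phi>"
  shows "((\<lambda>\<epsilon>. \<integral>x. \<phi> x * T1 \<epsilon> x \<partial>M) \<longlongrightarrow> pairing \<phi>) (at_right 0)"
proof -
  obtain B where B: "\<And>\<epsilon> x. \<epsilon> > 0 \<Longrightarrow> \<bar>T \<epsilon> \<phi> x - \<phi> x * T1 \<epsilon> x\<bar> \<le> B"
    "\<And>x. \<exists>l. ((\<lambda>\<epsilon>. T \<epsilon> \<phi> x - \<phi> x * T1 \<epsilon> x) \<longlongrightarrow> l) (at_right 0)"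
    by (rule commutator_bound_convergence[OF \<phi>]) (rule that)
  then obtain l where l: "\<And>x. ((\<lambda>\<epsilon>. T \<epsilon> \<phi> x - \<phi> x * T1 \<epsilon> x) \<longlongrightarrow> l x) (at_right 0)" by metis
  have I\<phi>: "integrable M \<phi>" using lipschitz_integrable[OF \<phi>] .
  have m: "(\<lambda>x. T \<epsilon> \<phi> x - \<phi> x * T1 \<epsilon> x) \<in> borel_measurable M" if "\<epsilon> > 0" for \<epsilon>
  proof -
    have [measurable]: "T \<epsilon> \<phi> \<in> borel_measurable M" "T \<epsilon> (\<lambda>_. 1) \<in> borel_measurable M" "\<phi> \<in> borel_measurable M"
      using that I\<phi> by (auto intro: T_meas)
    show ?thesis by measurable
  qed
  have lm: "l \<in> borel_measurable M"
  proof (rule borel_measurable_LIMSEQ_real)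
    note fl = filterlim_inverse_Suc
    show "(\<lambda>n. T (inverse (real (Suc n))) \<phi> x - \<phi> x * T1 (inverse (real (Suc n))) x) \<longlonglongrightarrow> l x" for x
      by (rule filterlim_compose[OF l fl])
  qed (use m in auto)
  have "((\<lambda>\<epsilon>. \<integral>x. T \<epsilon> \<phi> x - \<phi> x * T1 \<epsilon> x \<partial>M) \<longlongrightarrow> (\<integral>x. l x \<partial>M)) (at_right 0)"
    by (rule dominated_convergence_at_right[OF lm m, where w="\<lambda>_. B"]) (use B(1) l in auto)
  then have "((\<lambda>\<epsilon>. (\<integral>x. T \<epsilon> \<phi> x - \<phi> x * T1 \<epsilon> x \<partial>M) * (-1/2)) \<longlongrightarrow> (\<integral>x. l x \<partial>M) * (-1/2)) (at_right 0)"
    by (intro tendsto_mult_right)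
  moreover have "\<forall>\<^sub>F \<epsilon> in at_right 0. (\<integral>x. T \<epsilon> \<phi> x - \<phi> x * T1 \<epsilon> x \<partial>M) * (-1/2) = (\<integral>x. \<phi> x * T1 \<epsilon> x \<partial>M)"
    unfolding eventually_at_right_field
  proof (intro exI[of _ 1] conjI allI impI)
    fix \<epsilon> :: real assume \<epsilon>: "0 < \<epsilon>"
    have I1: "integrable M (\<lambda>_. 1 :: real)" by simp
    have "(\<integral>x. 1 * T \<epsilon> \<phi> x \<partial>M) = - (\<integral>x. \<phi> x * T1 \<epsilon> x \<partial>M)"
      by (rule T_antisym[OF \<epsilon> I\<phi> I1])
    moreover have "(\<integral>x. T \<epsilon> \<phi> x - \<phi> x * T1 \<epsilon> x \<partial>M) = (\<integral>x. T \<epsilon> \<phi> x \<partial>M) - (\<integral>x. \<phi> x * T1 \<epsilon> x \<partial>M)"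
      using T_integrable[OF \<epsilon> I\<phi>] T_mult_integrable[OF \<epsilon> I1 I\<phi>] by (intro Bochner_Integration.integral_diff)
    ultimately show "(\<integral>x. T \<epsilon> \<phi> x - \<phi> x * T1 \<epsilon> x \<partial>M) * (-1/2) = (\<integral>x. \<phi> x * T1 \<epsilon> x \<partial>M)" by simp
  qed simp
  ultimately have lim: "((\<lambda>\<epsilon>. \<integral>x. \<phi> x * T1 \<epsilon> x \<partial>M) \<longlongrightarrow> (\<integral>x. l x \<partial>M) * (-1/2)) (at_right 0)"
    by (rule Lim_transform_eventually)
  then have "pairing \<phi> = (\<integral>x. l x \<partial>M) * (-1/2)"
    unfolding pairing_def by (intro tendsto_Lim) auto
  then show ?thesis using lim by simp
qed

lemma pairing_eqI:
  "bounded_lipschitz \<phi> \<Longrightarrow> ((\<lambda>\<epsilon>. \<integral>x. \<phi> x * T1 \<epsilon> x \<partial>M) \<longlongrightarrow> l) (at_right 0) \<Longrightarrow> pairing \<phi> = l"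
  using tendsto_unique[OF _ pairing_tendsto] by auto

lemma pairing_add:
  assumes "bounded_lipschitz \<phi>" "bounded_lipschitz \<psi>"
  shows "pairing (\<lambda>x. \<phi> x + \<psi> x) = pairing \<phi> + pairing \<psi>"
proof (rule pairing_eqI)
  show "bounded_lipschitz (\<lambda>x. \<phi> x + \<psi> x)" using assms by (rule bounded_lipschitz_add)
  have "((\<lambda>\<epsilon>. (\<integral>x. \<phi> x * T1 \<epsilon> x \<partial>M) + (\<integral>x. \<psi> x * T1 \<epsilon> x \<partial>M)) \<longlongrightarrow> pairing \<phi> + pairing \<psi>) (at_right 0)"
    using assms by (intro tendsto_add pairing_tendsto)
  moreover have "\<forall>\<^sub>F \<epsilon> in at_right 0. (\<integral>x. \<phi> x * T1 \<epsilon> x \<partial>M) + (\<integral>x. \<psi> x * T1 \<epsilon> x \<partial>M) = (\<integral>x. (\<phi> x + \<psi> x) * T1 \<epsilon> x \<partial>M)"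
    unfolding eventually_at_right_field
  proof (intro exI[of _ 1] conjI allI impI)
    fix \<epsilon> :: real assume \<epsilon>: "0 < \<epsilon>"
    have I1: "integrable M (\<lambda>_. 1 :: real)" by simp
    show "(\<integral>x. \<phi> x * T1 \<epsilon> x \<partial>M) + (\<integral>x. \<psi> x * T1 \<epsilon> x \<partial>M) = (\<integral>x. (\<phi> x + \<psi> x) * T1 \<epsilon> x \<partial>M)"
      unfolding distrib_right using assms lipschitz_integrable
      by (intro Bochner_Integration.integral_add[symmetric] T_mult_integrable[OF \<epsilon> I1]) auto
  qed simp
  ultimately show "((\<lambda>\<epsilon>. \<integral>x. (\<phi> x + \<psi> x) * T1 \<epsilon> x \<partial>M) \<longlongrightarrow> pairing \<phi> + pairing \<psi>) (at_right 0)"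
    by (rule Lim_transform_eventually)
qed

lemma pairing_scale:
  assumes "bounded_lipschitz \<phi>"
  shows "pairing (\<lambda>x. c * \<phi> x) = c * pairing \<phi>"
proof (rule pairing_eqI)
  show "bounded_lipschitz (\<lambda>x. c * \<phi> x)" using assms by (rule bounded_lipschitz_scale)
  show "((\<lambda>\<epsilon>. \<integral>x. c * \<phi> x * T1 \<epsilon> x \<partial>M) \<longlongrightarrow> c * pairing \<phi>) (at_right 0)"
    using tendsto_mult_left[OF pairing_tendsto[OF assms], of c] by (simp add: mult.assoc)
qed

end

context bounded_singular_kernel
begin

lemma one_in_L2: "(\<lambda>_. 1) \<in> L2 M"
  by (rule bounded_in_L2[of _ 1]) auto

lemma lipschitz_sq_integrable: "bounded_lipschitz \<phi> \<Longrightarrow> integrable M (\<lambda>x. (\<phi> x)\<^sup>2)"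
  unfolding power2_eq_square by (intro lipschitz_mult_integrable lipschitz_integrable)

text \<open>The inequality \<open>2 * a * b \<le> a^2 + b^2\<close>, with the L2 bound for
  \<open>T \<epsilon> 1\<close> uniform in \<epsilon>. It bounds from below the functional that is
  minimised next.\<close>

lemma pairing_energy:
  assumes \<phi>: "bounded_lipschitz \<phi>"
  shows "2 * pairing \<phi> \<le> (\<integral>x. (\<phi> x)\<^sup>2 \<partial>M) + C0 * measure M UNIV"
proof (rule tendsto_upperbound)
  show "((\<lambda>\<epsilon>. 2 * (\<integral>x. \<phi> x * T1 \<epsilon> x \<partial>M)) \<longlongrightarrow> 2 * pairing \<phi>) (at_right 0)"
    by (intro tendsto_mult_left pairing_tendsto \<phi>)
  show "\<forall>\<^sub>F \<epsilon> in at_right 0. 2 * (\<integral>x. \<phi> x * T1 \<epsilon> x \<partial>M) \<le> (\<integral>x. (\<phi> x)\<^sup>2 \<partial>M) + C0 * measure M UNIV"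
    unfolding eventually_at_right_field
  proof (intro exI[of _ 1] conjI allI impI)
    fix \<epsilon> :: real assume \<epsilon>: "0 < \<epsilon>"
    note L2 = T_L2[OF one_in_L2 \<epsilon>]
    have I: "integrable M (\<lambda>x. \<phi> x * T1 \<epsilon> x)"
      using \<phi> by (intro lipschitz_mult_integrable T_integrable \<epsilon>) auto
    have "(\<integral>x. 2 * (\<phi> x * T1 \<epsilon> x) \<partial>M) \<le> (\<integral>x. (\<phi> x)\<^sup>2 + (T1 \<epsilon> x)\<^sup>2 \<partial>M)"
    proof (rule integral_mono)
      show "2 * (\<phi> x * T1 \<epsilon> x) \<le> (\<phi> x)\<^sup>2 + (T1 \<epsilon> x)\<^sup>2" for x
        using sum_squares_bound[of "\<phi> x" "T1 \<epsilon> x"] by simp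
    qed (use I L2(1) lipschitz_sq_integrable[OF \<phi>] in auto)
    also have "\<dots> = (\<integral>x. (\<phi> x)\<^sup>2 \<partial>M) + (\<integral>x. (T1 \<epsilon> x)\<^sup>2 \<partial>M)"
      using L2(1) lipschitz_sq_integrable[OF \<phi>] by (intro Bochner_Integration.integral_add)
    also have "\<dots> \<le> (\<integral>x. (\<phi> x)\<^sup>2 \<partial>M) + C0 * measure M UNIV" using L2(2) by simp
    finally show "2 * (\<integral>x. \<phi> x * T1 \<epsilon> x \<partial>M) \<le> (\<integral>x. (\<phi> x)\<^sup>2 \<partial>M) + C0 * measure M UNIV" by simp
  qed simp
qed simp

text \<open>Minimising \<open>\<integral>\<phi>\<^sup>2 - 2 * pairing \<phi>\<close> up to \<open>\<gamma>\<close> replaces the Riesz representation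
  of the weak limit of the \<open>T\<^sub>\<epsilon> 1\<close>.\<close>

lemma pairing_almost_represented:
  assumes \<gamma>: "\<gamma> > 0"
  obtains g where "bounded_lipschitz g"
    "\<And>\<psi>. bounded_lipschitz \<psi> \<Longrightarrow> (pairing \<psi> - (\<integral>x. g x * \<psi> x \<partial>M))\<^sup>2 \<le> \<gamma> * (\<integral>x. (\<psi> x)\<^sup>2 \<partial>M)"
proof -
  define J where "J \<phi> = (\<integral>x. (\<phi> x)\<^sup>2 \<partial>M) - 2 * pairing \<phi>" for \<phi>
  define S where "S = J ` {\<phi>. bounded_lipschitz \<phi>}"
  have bdd: "bdd_below S"
    using pairing_energy by (intro bdd_belowI[of _ "- (C0 * measure M UNIV)"]) (force simp: S_def J_def)
  have ne: "S \<noteq> {}" using bounded_lipschitz_const[of 0] by (auto simp: S_def)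
  have "Inf S < Inf S + \<gamma>" using \<gamma> by simp
  then obtain j where "j \<in> S" "j < Inf S + \<gamma>" using cInf_lessD[OF ne] by blast
  then obtain g where g: "bounded_lipschitz g" "J g < Inf S + \<gamma>" by (auto simp: S_def)
  show ?thesis
  proof (rule that[OF g(1)])
    fix \<psi> :: "'a \<Rightarrow> real" assume \<psi>: "bounded_lipschitz \<psi>"
    define d where "d = (\<integral>x. g x * \<psi> x \<partial>M) - pairing \<psi>"
    define n where "n = (\<integral>x. (\<psi> x)\<^sup>2 \<partial>M)"
    have n0: "n \<ge> 0" unfolding n_def by (intro integral_nonneg_AE) auto
    have Igp: "integrable M (\<lambda>x. g x * \<psi> x)" by (intro lipschitz_mult_integrable lipschitz_integrable g \<psi>)
    \<comment> \<open>Since \<open>g\<close> minimises up to \<gamma>, the quadratic polynomial by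
      which \<open>J\<close> changes along \<open>g + c * \<psi>\<close> stays above
      \<open>- \<gamma>\<close>. Its minimum, at \<open>c = - d / n\<close>, gives the claim; for
      \<open>n = 0\<close> the polynomial is linear, so \<open>d\<close> must vanish.\<close>
    have quad: "0 \<le> 2 * c * d + c\<^sup>2 * n + \<gamma>" for c
    proof -
      have bl: "bounded_lipschitz (\<lambda>x. g x + c * \<psi> x)"
        by (intro bounded_lipschitz_add bounded_lipschitz_scale g \<psi>)
      have "J (\<lambda>x. g x + c * \<psi> x) = J g + 2 * c * d + c\<^sup>2 * n"
      proof -
        have "(\<integral>x. (g x + c * \<psi> x)\<^sup>2 \<partial>M) = (\<integral>x. (g x)\<^sup>2 + (2 * c) * (g x * \<psi> x) + c\<^sup>2 * (\<psi> x)\<^sup>2 \<partial>M)"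
          by (intro Bochner_Integration.integral_cong) (auto simp: power2_eq_square algebra_simps)
        also have "\<dots> = (\<integral>x. (g x)\<^sup>2 \<partial>M) + 2 * c * (\<integral>x. g x * \<psi> x \<partial>M) + c\<^sup>2 * n"
          using Igp lipschitz_sq_integrable[OF \<psi>] lipschitz_sq_integrable[OF g(1)] by (simp add: n_def)
        finally show ?thesis
          using pairing_add[OF g(1) bounded_lipschitz_scale[OF \<psi>], of c] pairing_scale[OF \<psi>, of c]
          by (simp add: J_def d_def algebra_simps)
      qed
      moreover have "Inf S \<le> J (\<lambda>x. g x + c * \<psi> x)"
        using bl by (intro cInf_lower bdd) (auto simp: S_def)
      ultimately show ?thesis using g(2) by linarith
    qed
    have "d\<^sup>2 \<le> \<gamma> * n"
    proof (cases "n = 0")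
      case True
      have "d = 0"
      proof (rule ccontr)
        assume "d \<noteq> 0"
        then show False using quad[of "- \<gamma> / d"] True \<gamma> by simp
      qed
      then show ?thesis using True by simp
    next
      case False
      then have n: "n > 0" using n0 by simp
      have "0 \<le> (2 * (- d / n) * d + (- d / n)\<^sup>2 * n + \<gamma>) * n"
        using quad[of "- d / n"] n by (intro mult_nonneg_nonneg) auto
      also have "\<dots> = - d\<^sup>2 + \<gamma> * n" using n by (simp add: power2_eq_square field_simps)
      finally show ?thesis by simp
    qed
    then show "(pairing \<psi> - (\<integral>x. g x * \<psi> x \<partial>M))\<^sup>2 \<le> \<gamma> * (\<integral>x. (\<psi> x)\<^sup>2 \<partial>M)"
      by (simp add: d_def n_def power2_commute)
  qed
qed

definition doubling_at :: "'a \<Rightarrow> real \<Rightarrow> bool" where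
  "doubling_at x R \<longleftrightarrow> measure M (ball x (32 * R)) \<le> dbl * measure M (ball x R)"

text \<open>For a disjoint family, test the functional with the sum of the bumps, each multiplied by
  the sign of its own value. The values add up to at least \<eta> times the total mass of the bumps,
  whereas the square of the sum integrates to at most that mass, because the bumps do not overlap.
  Hence the mass is at most \<open>\<gamma> / \<eta>\<^sup>2\<close>, and doubling lets it pay for
  the dilated balls.\<close>

lemma functional_maximal:
  assumes \<eta>: "\<eta> > 0" and \<gamma>: "\<gamma> \<ge> 0" and g: "bounded_lipschitz g"
    and L: "\<And>\<psi>. bounded_lipschitz \<psi> \<Longrightarrow> (pairing \<psi> - (\<integral>x. g x * \<psi> x \<partial>M))\<^sup>2 \<le> \<gamma> * (\<integral>x. (\<psi> x)\<^sup>2 \<partial>M)"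
  shows "outer_le M {x. \<exists>R>0. doubling_at x R \<and>
      \<eta> * (\<integral>z. bump x R z \<partial>M) < \<bar>pairing (bump x R) - (\<integral>z. g z * bump x R z \<partial>M)\<bar>} (dbl * (\<gamma> / \<eta>\<^sup>2))"
\<comment> \<open>The covering radius is twice the scale of the bump, so that each bump vanishes
  outside its covering ball.\<close>
proof (rule outer_le_of_ball_cover[OF finite_measure_axioms sets_M, where
      P="\<lambda>x r. doubling_at x (r/2) \<and>
        \<eta> * (\<integral>z. bump x (r/2) z \<partial>M) < \<bar>pairing (bump x (r/2)) - (\<integral>z. g z * bump x (r/2) z \<partial>M)\<bar>"])
  fix x assume "x \<in> {x. \<exists>R>0. doubling_at x R \<and>
      \<eta> * (\<integral>z. bump x R z \<partial>M) < \<bar>pairing (bump x R) - (\<integral>z. g z * bump x R z \<partial>M)\<bar>}"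
  then obtain R where "R > 0" "doubling_at x R"
    "\<eta> * (\<integral>z. bump x R z \<partial>M) < \<bar>pairing (bump x R) - (\<integral>z. g z * bump x R z \<partial>M)\<bar>" by blast
  then show "\<exists>r>0. doubling_at x (r/2) \<and>
      \<eta> * (\<integral>z. bump x (r/2) z \<partial>M) < \<bar>pairing (bump x (r/2)) - (\<integral>z. g z * bump x (r/2) z \<partial>M)\<bar>"
    by (intro exI[of _ "2 * R"]) simp
next
  fix I :: "('a \<times> real) set"
  let ?b = "\<lambda>p. bump (fst p) (snd p / 2)"
  define \<Lambda> where "\<Lambda> \<phi> = pairing \<phi> - (\<integral>z. g z * \<phi> z \<partial>M)" for \<phi>
  define m where "m p = (\<integral>z. ?b p z \<partial>M)" for p
  assume I: "finite I"
    and P: "\<And>x r. (x, r) \<in> I \<Longrightarrow> r > 0 \<and> doubling_at x (r/2) \<and>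
      \<eta> * (\<integral>z. bump x (r/2) z \<partial>M) < \<bar>pairing (bump x (r/2)) - (\<integral>z. g z * bump x (r/2) z \<partial>M)\<bar>"
    and disj: "pairwise (\<lambda>p q. disjnt (ball (fst p) (snd p)) (ball (fst q) (snd q))) I"
  have r: "snd p > 0" if "p \<in> I" for p using P[of "fst p" "snd p"] that by simp
  have blb: "bounded_lipschitz (?b p)" if "p \<in> I" for p using r[OF that] by (intro bounded_lipschitz_bump) auto
  have \<Lambda>b: "\<eta> * m p < \<bar>\<Lambda> (?b p)\<bar>" if "p \<in> I" for p
    using P[of "fst p" "snd p"] that by (simp add: m_def \<Lambda>_def)
  have m0: "0 \<le> m p" for p unfolding m_def using bump_bounds by (intro integral_nonneg_AE) auto
  have mb: "measure M (ball (fst p) (snd p / 2)) \<le> m p" if "p \<in> I" for p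
    unfolding m_def using r[OF that] by (intro bump_mass) auto
  have meas: "measure M (ball (fst p) (3 * snd p)) \<le> dbl * m p" if "p \<in> I" for p
  proof -
    have "measure M (ball (fst p) (3 * snd p)) \<le> measure M (ball (fst p) (32 * (snd p / 2)))"
      using r[OF that] by (intro finite_measure_mono subset_ball) auto
    also have "\<dots> \<le> dbl * measure M (ball (fst p) (snd p / 2))"
      using P[of "fst p" "snd p"] that by (simp add: doubling_at_def)
    also have "\<dots> \<le> dbl * m p" using mb[OF that] dbl_ge by (intro mult_left_mono) auto
    finally show ?thesis .
  qed
  define s where "s p = sgn (\<Lambda> (?b p))" for p
  define \<Phi> where "\<Phi> J z = (\<Sum>p\<in>J. s p * ?b p z)" for J z
  have bl\<Phi>: "bounded_lipschitz (\<Phi> J)" if "J \<subseteq> I" for J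
    unfolding \<Phi>_def[abs_def] using blb that by (intro bounded_lipschitz_sum bounded_lipschitz_scale) auto
  have I\<Lambda>: "integrable M (\<lambda>z. g z * \<phi> z)" if "bounded_lipschitz \<phi>" for \<phi>
    using that g by (intro lipschitz_mult_integrable lipschitz_integrable)
  have \<Lambda>\<Phi>: "\<Lambda> (\<Phi> J) = (\<Sum>p\<in>J. \<bar>\<Lambda> (?b p)\<bar>)" if "J \<subseteq> I" for J
  proof -
    have "finite J" using that I by (rule finite_subset)
    then show ?thesis using that
    proof (induction J rule: finite_induct)
      case empty
      have "pairing (\<lambda>x. 0 * 1) = 0 * pairing (\<lambda>x. 1)" by (intro pairing_scale bounded_lipschitz_const)
      then show ?case by (simp add: \<Lambda>_def \<Phi>_def[abs_def])
    next
      case (insert p J)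
      then have p: "p \<in> I" "J \<subseteq> I" by auto
      have eq: "\<Phi> (insert p J) = (\<lambda>z. s p * ?b p z + \<Phi> J z)" using insert by (auto simp: \<Phi>_def)
      have "pairing (\<Phi> (insert p J)) = s p * pairing (?b p) + pairing (\<Phi> J)"
        unfolding eq using blb[OF p(1)] bl\<Phi>[OF p(2)]
        by (subst pairing_add) (auto intro: bounded_lipschitz_scale simp: pairing_scale)
      moreover have "(\<integral>z. g z * \<Phi> (insert p J) z \<partial>M) = s p * (\<integral>z. g z * ?b p z \<partial>M) + (\<integral>z. g z * \<Phi> J z \<partial>M)"
      proof -
        have "(\<integral>z. g z * \<Phi> (insert p J) z \<partial>M) = (\<integral>z. s p * (g z * ?b p z) + g z * \<Phi> J z \<partial>M)"
          unfolding eq by (intro Bochner_Integration.integral_cong) (auto simp: algebra_simps)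
        then show ?thesis using I\<Lambda>[OF blb[OF p(1)]] I\<Lambda>[OF bl\<Phi>[OF p(2)]] by simp
      qed
      ultimately have "\<Lambda> (\<Phi> (insert p J)) = s p * \<Lambda> (?b p) + \<Lambda> (\<Phi> J)"
        by (simp add: \<Lambda>_def algebra_simps)
      then show ?case using insert p by (simp add: s_def abs_sgn mult.commute)
    qed
  qed
  have sq: "(\<Phi> I z)\<^sup>2 \<le> (\<Sum>p\<in>I. ?b p z)" for z
  proof (cases "\<exists>p\<in>I. dist (fst p) z < snd p")
    case True
    then obtain p where p: "p \<in> I" "dist (fst p) z < snd p" by blast
    have 0: "?b q z = 0" if "q \<in> I" "q \<noteq> p" for q
    proof -
      have "disjnt (ball (fst q) (snd q)) (ball (fst p) (snd p))"
        using disj that p by (auto simp: pairwise_def)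
      moreover have "z \<in> ball (fst p) (snd p)" using p(2) by simp
      ultimately have "z \<notin> ball (fst q) (snd q)" by (meson disjnt_iff)
      then have "snd q \<le> dist (fst q) z" by simp
      then show ?thesis using r[OF that(1)] by (intro bump_0) auto
    qed
    have "\<Phi> I z = s p * ?b p z"
      unfolding \<Phi>_def using I p 0 by (subst sum.remove[of _ p]) auto
    moreover have "(\<Sum>p\<in>I. ?b p z) = ?b p z"
      using I p 0 by (subst sum.remove[of _ p]) auto
    moreover have "(s p * ?b p z)\<^sup>2 \<le> ?b p z"
    proof -
      have "(s p)\<^sup>2 \<le> 1" by (auto simp: s_def sgn_real_def)
      then have "(s p)\<^sup>2 * (?b p z)\<^sup>2 \<le> 1 * (?b p z)\<^sup>2" by (intro mult_right_mono) auto
      also have "\<dots> \<le> ?b p z"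
        using bump_bounds[of "fst p" "snd p / 2" z] by (simp add: power2_eq_square mult_left_le)
      finally show ?thesis by (simp add: power_mult_distrib)
    qed
    ultimately show ?thesis by simp
  next
    case False
    then have "?b p z = 0" if "p \<in> I" for p
      using that r[OF that] by (intro bump_0) (auto simp: not_less)
    then show ?thesis by (simp add: \<Phi>_def)
  qed
  define S where "S = (\<Sum>p\<in>I. m p)"
  have S0: "S \<ge> 0" unfolding S_def using m0 by (intro sum_nonneg) auto
  have "\<eta> * S \<le> \<Lambda> (\<Phi> I)"
    unfolding \<Lambda>\<Phi>[OF subset_refl] S_def sum_distrib_left using \<Lambda>b by (intro sum_mono) (auto intro: less_imp_le)
  then have "(\<eta> * S)\<^sup>2 \<le> (\<Lambda> (\<Phi> I))\<^sup>2" using \<eta> S0 by (intro power_mono) auto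
  also have "\<dots> \<le> \<gamma> * (\<integral>z. (\<Phi> I z)\<^sup>2 \<partial>M)" unfolding \<Lambda>_def by (rule L[OF bl\<Phi>[OF subset_refl]])
  finally have 1: "(\<eta> * S)\<^sup>2 \<le> \<gamma> * (\<integral>z. (\<Phi> I z)\<^sup>2 \<partial>M)" .
  have "(\<integral>z. (\<Phi> I z)\<^sup>2 \<partial>M) \<le> (\<integral>z. (\<Sum>p\<in>I. ?b p z) \<partial>M)"
    using blb lipschitz_integrable lipschitz_sq_integrable[OF bl\<Phi>[OF subset_refl]] sq
    by (intro integral_mono Bochner_Integration.integrable_sum) auto
  also have "\<dots> = S" unfolding S_def m_def using blb lipschitz_integrable
    by (intro Bochner_Integration.integral_sum) auto
  finally have 2: "(\<integral>z. (\<Phi> I z)\<^sup>2 \<partial>M) \<le> S" .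
  have \<gamma>_S: "S \<le> \<gamma> / \<eta>\<^sup>2"
  proof (cases "S = 0")
    case False
    then have S: "S > 0" using S0 by simp
    have "(\<eta> * S)\<^sup>2 \<le> \<gamma> * S" using 1 2 \<gamma> by (meson mult_left_mono order_trans)
    then have "\<eta>\<^sup>2 * S * S \<le> \<gamma> * S" by (simp add: power2_eq_square mult_ac)
    then have "\<eta>\<^sup>2 * S \<le> \<gamma>" using S by simp
    then show ?thesis using \<eta> by (simp add: field_simps)
  qed (use \<gamma> in simp)
  have "(\<Sum>p\<in>I. measure M (ball (fst p) (3 * snd p))) \<le> (\<Sum>p\<in>I. dbl * m p)"
    using meas by (intro sum_mono)
  also have "\<dots> = dbl * S" by (simp add: S_def sum_distrib_left)
  also have "\<dots> \<le> dbl * (\<gamma> / \<eta>\<^sup>2)" using \<gamma>_S dbl_ge by (intro mult_left_mono) auto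
  finally show "(\<Sum>p\<in>I. measure M (ball (fst p) (3 * snd p))) \<le> dbl * (\<gamma> / \<eta>\<^sup>2)" .
qed

end

text \<open>Lower semicontinuity of the measure of balls in the centre: a slightly smaller ball
  about \<open>z\<close> still has measure above \<open>c\<close>, and every ball of radius
  \<open>r\<close> with centre near \<open>z\<close> contains it.\<close>

lemma open_ball_measure_greater:
  fixes M' :: "'a::metric_space measure"
  assumes "finite_measure M'" "sets M' = sets borel"
  shows "open {z. c < measure M' (ball z r)}"
  unfolding open_contains_ball
proof
  interpret M': finite_measure M' by fact
  fix z assume "z \<in> {z. c < measure M' (ball z r)}"
  then have z: "c < measure M' (ball z r)" by simp
  define A where "A n = ball z (r - inverse (real (Suc n)))" for n
  have "(\<lambda>n. measure M' (A n)) \<longlonglongrightarrow> measure M' (\<Union>n. A n)"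
  proof (rule M'.finite_Lim_measure_incseq)
    show "range A \<subseteq> sets M'"
    proof (rule image_subsetI)
      show "A n \<in> sets M'" for n unfolding A_def assms(2) by (rule borel_open[OF open_ball])
    qed
    show "incseq A"
    proof (rule incseq_SucI)
      fix n
      have "inverse (real (Suc (Suc n))) \<le> inverse (real (Suc n))" by (intro le_imp_inverse_le) auto
      then show "A n \<subseteq> A (Suc n)" unfolding A_def by (intro subset_ball) simp
    qed
  qed
  moreover have "(\<Union>n. A n) = ball z r"
  proof
    show "(\<Union>n. A n) \<subseteq> ball z r" unfolding A_def by (intro UN_least subset_ball) simp
    show "ball z r \<subseteq> (\<Union>n. A n)"
    proof
      fix y assume "y \<in> ball z r"
      then have "0 < r - dist z y" by simp
      from reals_Archimedean[OF this] obtain n where "inverse (real (Suc n)) < r - dist z y" by blast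
      then have "y \<in> A n" by (simp add: A_def)
      then show "y \<in> (\<Union>n. A n)" by blast
    qed
  qed
  ultimately have "(\<lambda>n. measure M' (A n)) \<longlonglongrightarrow> measure M' (ball z r)" by (simp only:)
  from order_tendstoD(1)[OF this z] obtain n where n: "c < measure M' (A n)"
    using eventually_happens'[OF sequentially_bot] by blast
  define e where "e = inverse (real (Suc n))"
  have "ball z e \<subseteq> {z. c < measure M' (ball z r)}"
  proof
    fix y assume y: "y \<in> ball z e"
    have "A n \<subseteq> ball y r"
    proof
      fix w assume w: "w \<in> A n"
      have "dist y w \<le> dist z y + dist z w" using dist_triangle[of y w z] by (simp add: dist_commute)
      also have "\<dots> < r" using w y by (simp add: A_def e_def)
      finally show "w \<in> ball y r" by simp
    qed
    then have "measure M' (A n) \<le> measure M' (ball y r)"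
      using assms(2) by (intro M'.finite_measure_mono) auto
    then show "y \<in> {z. c < measure M' (ball z r)}" using n by simp
  qed
  moreover have "e > 0" by (simp add: e_def)
  ultimately show "\<exists>e>0. ball z e \<subseteq> {z. c < measure M' (ball z r)}" by blast
qed

section \<open>Tests with bumps at points of uniformly small density\<close>

context bounded_singular_kernel
begin

text \<open>An argument in the manner of Egorov. The set where the density bound fails at some
  radius up to \<open>1 / (n + 1)\<close> is an uncountable union, but of open sets; these sets
  decrease to a null set, and one of them serves as \<open>N\<close>.\<close>

lemma exceptional_density_set:
  assumes dens: "AE x in M. ((\<lambda>r. measure M (ball x r) / h r) \<longlongrightarrow> 0) (at_right 0)"
    and \<eta>: "\<eta> > 0" and \<kappa>: "\<kappa> > 0"
  obtains N s where "N \<in> sets M" "measure M N < \<kappa>" "s > 0"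
    "\<And>z r. z \<notin> N \<Longrightarrow> 0 < r \<Longrightarrow> r \<le> s \<Longrightarrow> measure M (ball z r) \<le> \<eta> * h r"
proof -
  define U where "U n = (\<Union>r\<in>{r. 0 < r \<and> r \<le> inverse (real (Suc n))}. {z. \<eta> * h r < measure M (ball z r)})" for n
  have op: "open (U n)" for n
    unfolding U_def by (intro open_UN ballI open_ball_measure_greater finite_measure_axioms sets_M)
  have Um: "U n \<in> sets M" for n using op by simp
  have dec: "decseq U"
  proof (rule decseq_SucI)
    fix n
    have "inverse (real (Suc (Suc n))) \<le> inverse (real (Suc n))" by (intro le_imp_inverse_le) auto
    then have "{r. 0 < r \<and> r \<le> inverse (real (Suc (Suc n)))} \<subseteq> {r. 0 < r \<and> r \<le> inverse (real (Suc n))}"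
      by (intro Collect_mono impI conjI) (auto simp del: of_nat_Suc elim: order_trans)
    then show "U (Suc n) \<subseteq> U n" unfolding U_def by (rule UN_mono) (rule subset_refl)
  qed
  have Im: "(\<Inter>n. U n) \<in> sets M" using Um by auto
  have "AE x in M. x \<notin> (\<Inter>n. U n)"
    using dens
  proof eventually_elim
    case (elim x)
    then have "\<forall>\<^sub>F r in at_right 0. measure M (ball x r) / h r < \<eta>" using \<eta> by (rule order_tendstoD)
    then obtain b where b: "b > 0" "\<And>r. 0 < r \<Longrightarrow> r < b \<Longrightarrow> measure M (ball x r) / h r < \<eta>"
      by (auto simp: eventually_at_right_field)
    obtain n where n: "inverse (real (Suc n)) < b" using reals_Archimedean[OF b(1)] by blast
    have "x \<notin> U n"
    proof
      assume "x \<in> U n"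
      then obtain r where r: "0 < r" "r \<le> inverse (real (Suc n))" "\<eta> * h r < measure M (ball x r)"
        by (auto simp: U_def)
      then have "measure M (ball x r) / h r < \<eta>" using b(2)[of r] n by simp
      then show False using r(3) h_pos[OF r(1)] by (simp add: divide_less_eq)
    qed
    then show ?case by blast
  qed
  then have "(\<Inter>n. U n) \<in> null_sets M" using AE_iff_null_sets[OF Im] by simp
  then have "measure M (\<Inter>n. U n) = 0" by (rule measure_eq_0_null_sets)
  moreover have "(\<lambda>n. measure M (U n)) \<longlonglongrightarrow> measure M (\<Inter>n. U n)"
    using Um dec by (intro finite_Lim_measure_decseq) auto
  ultimately have "(\<lambda>n. measure M (U n)) \<longlonglongrightarrow> 0" by simp
  then have "\<forall>\<^sub>F n in sequentially. measure M (U n) < \<kappa>" using \<kappa> by (rule order_tendstoD)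
  then obtain n where n: "measure M (U n) < \<kappa>" by (auto simp: eventually_sequentially)
  show ?thesis
  proof (rule that[OF Um n])
    show "measure M (ball z r) \<le> \<eta> * h r" if "z \<notin> U n" "0 < r" "r \<le> inverse (real (Suc n))" for z r
      using that by (auto simp: U_def not_less)
  qed simp
qed

lemma mass_le_measure:
  assumes "integrable M f" "\<And>y. \<bar>f y\<bar> \<le> 1"
  shows "mass f x r \<le> measure M (ball x r)"
proof -
  have "mass f x r \<le> (\<integral>y. indicator (ball x r) y \<partial>M)"
    unfolding mass_def using assms
    by (intro integral_mono mass_integrable integrable_real_indicator)
      (auto simp: emeasure_eq_measure indicator_def)
  then show ?thesis by simp
qed

text \<open>Density \<eta> is available only up to the scale \<open>s\<close>, so the constant
  function is split at \<open>ball x s\<close>. The inner part contributes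
  \<open>C * \<eta>\<close>. For the outer part only the growth bound is at hand, but the
  displacement relative to \<open>s\<close> is at most \<open>2 * \<eta>\<close>, which contributes
  \<open>4 * C * \<eta>\<close>.\<close>

lemma T1_far_part:
  assumes \<eta>: "\<eta> > 0" and s: "s > 0" and x: "\<And>r. 0 < r \<Longrightarrow> r \<le> s \<Longrightarrow> measure M (ball x r) \<le> \<eta> * h r"
    and R: "R > 0" "8 * R \<le> s" "R \<le> \<eta> * s" and \<delta>: "0 < \<delta>" "\<delta> \<le> R" and z: "dist x z < 2 * R"
  shows "\<bar>T1 (4 * R) x - T \<delta> (\<lambda>y. indicator (- ball x (4 * R)) y * 1) z\<bar> \<le> 5 * C * \<eta>"
proof -
  let ?B = "ball x (4 * R)"
  define f1 f2 :: "'a \<Rightarrow> real" where "f1 = indicator (ball x s)" and "f2 = indicator (- ball x s)"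
  have I: "integrable M f1" "integrable M f2"
    unfolding f1_def f2_def by (intro integrable_real_indicator; auto simp: emeasure_eq_measure)+
  have I': "integrable M (\<lambda>y. indicator (- ?B) y * f1 y)" "integrable M (\<lambda>y. indicator (- ?B) y * f2 y)"
    using I by (auto intro!: indicator_mult_integrable)
  have 1: "\<bar>T (4 * R) f1 x - T \<delta> (\<lambda>y. indicator (- ?B) y * f1 y) z\<bar> \<le> C * \<eta>"
  proof -
    have "mass f1 x s' \<le> \<eta> * h s'" if "4 * R \<le> s'" for s'
    proof (cases "s' \<le> s")
      case True
      have "mass f1 x s' \<le> measure M (ball x s')"
        by (rule mass_le_measure[OF I(1)]) (simp add: f1_def indicator_def)
      also have "\<dots> \<le> \<eta> * h s'" using True that R by (intro x) auto
      finally show ?thesis .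
    next
      case False
      have "mass f1 x s' \<le> (\<integral>y. \<bar>f1 y\<bar> \<partial>M)" by (rule mass_le_norm[OF I(1)])
      also have "\<dots> = measure M (ball x s)" by (simp add: f1_def)
      also have "\<dots> \<le> \<eta> * h s" using s by (intro x) auto
      also have "\<dots> \<le> \<eta> * h s'" using False s \<eta> by (intro mult_left_mono h_mono) auto
      finally show ?thesis .
    qed
    then have "\<bar>T (4 * R) f1 x - T \<delta> (\<lambda>y. indicator (- ?B) y * f1 y) z\<bar> \<le> dist x z / (4 * R) * (2 * (C * \<eta>))"
      using \<delta> z \<eta> by (intro T_smooth_diff I) auto
    also have "\<dots> \<le> 1 / 2 * (2 * (C * \<eta>))"
      using z R \<eta> C_ge_1 by (intro mult_right_mono) (auto simp: divide_le_eq)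
    finally show ?thesis by simp
  qed
  have 2: "\<bar>T (4 * R) f2 x - T \<delta> (\<lambda>y. indicator (- ?B) y * f2 y) z\<bar> \<le> 4 * C * \<eta>"
  proof -
    have "mass f2 x s' \<le> 1 * h s'" if "s \<le> s'" for s'
    proof -
      have "mass f2 x s' \<le> measure M (ball x s')"
        by (rule mass_le_measure[OF I(2)]) (simp add: f2_def indicator_def)
      also have "\<dots> \<le> h s'" using that s by (intro growth) auto
      finally show ?thesis by simp
    qed
    then have 1: "\<bar>T s f2 x - T \<delta> (\<lambda>y. indicator (- ball x s) y * f2 y) z\<bar> \<le> dist x z / s * (2 * (C * 1))"
      using \<delta> z R by (intro T_smooth_diff I) auto
    have 2: "dist x z / s * (2 * (C * 1)) \<le> (2 * \<eta>) * (2 * (C * 1))"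
      using z R s C_ge_1 by (intro mult_right_mono) (auto simp: divide_le_eq)
    have 3: "T s f2 x = T (4 * R) f2 x"
      unfolding T_eq using R by (intro Bochner_Integration.integral_cong) (auto simp: f2_def TK_def indicator_def)
    have 4: "(\<lambda>y. indicator (- ball x s) y * f2 y) = (\<lambda>y. indicator (- ?B) y * f2 y)"
      using R by (auto simp: f2_def indicator_def fun_eq_iff)
    have 5: "(2 * \<eta>) * (2 * (C * 1)) = 4 * C * \<eta>" by simp
    show ?thesis using order_trans[OF 1 2] unfolding 3 4 5 .
  qed
  have one: "(\<lambda>_. 1) = (\<lambda>y. f1 y + f2 y)"
    by (rule ext) (simp add: f1_def f2_def indicator_def)
  have R4: "4 * R > 0" using R by simp
  have e1: "T1 (4 * R) x = T (4 * R) f1 x + T (4 * R) f2 x" unfolding one by (rule T_add[OF R4 I])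
  have cut: "(\<lambda>y. indicator (- ?B) y * 1) = (\<lambda>y. indicator (- ?B) y * f1 y + indicator (- ?B) y * f2 y)"
    by (rule ext) (simp add: f1_def f2_def indicator_def)
  have e2: "T \<delta> (\<lambda>y. indicator (- ?B) y * 1) z
      = T \<delta> (\<lambda>y. indicator (- ?B) y * f1 y) z + T \<delta> (\<lambda>y. indicator (- ?B) y * f2 y) z"
    unfolding cut by (rule T_add[OF \<delta>(1) I'])
  show ?thesis unfolding e1 e2 using 1 2 by linarith
qed

text \<open>Antisymmetry makes this half the integral of a commutator, in which the kernel meets the
  increment of the bump, at most \<open>dist z y / R\<close>. By \<open>near_integral\<close> the
  inner integral is at most \<open>16 * C * \<eta>\<close> at points outside \<open>N\<close>. At
  points of \<open>N\<close> only the growth bound remains and \<eta> becomes 1, whence the term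
  with the mass of \<open>N\<close>.\<close>

lemma bump_near_part:
  assumes \<eta>: "\<eta> > 0" and N: "N \<in> sets M" and R: "R > 0" and \<delta>: "0 < \<delta>"
    and dens: "\<And>z r. z \<notin> N \<Longrightarrow> 0 < r \<Longrightarrow> r \<le> 8 * R \<Longrightarrow> measure M (ball z r) \<le> \<eta> * h r"
  shows "\<bar>\<integral>z. bump x R z * T \<delta> (indicator (ball x (4 * R))) z \<partial>M\<bar>
    \<le> 8 * C * (\<eta> * measure M (ball x (4 * R)) + mass (indicator N) x (4 * R))"
proof -
  let ?B = "ball x (4 * R)" and ?b = "bump x R"
  have Ib: "integrable M ?b" by (intro lipschitz_integrable bounded_lipschitz_bump R)
  have IB: "integrable M (indicator ?B :: 'a \<Rightarrow> real)"
    by (intro indicator_integrable) auto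
  have IN: "integrable M (indicator N :: 'a \<Rightarrow> real)"
    using N by (intro indicator_integrable) auto
  define a where "a = (\<integral>z. ?b z * T \<delta> (indicator ?B) z \<partial>M)"
  have anti: "a = - (\<integral>z. indicator ?B z * T \<delta> ?b z \<partial>M)"
    unfolding a_def by (rule T_antisym[OF \<delta> IB Ib])
  have I1: "integrable M (\<lambda>z. ?b z * T \<delta> (indicator ?B) z)" by (rule T_mult_integrable[OF \<delta> IB Ib])
  have I2: "integrable M (\<lambda>z. indicator ?B z * T \<delta> ?b z)" by (rule T_mult_integrable[OF \<delta> Ib IB])
  have eq: "2 * a = (\<integral>z. ?b z * T \<delta> (indicator ?B) z - indicator ?B z * T \<delta> ?b z \<partial>M)"
    using I1 I2 anti by (simp add: a_def)
  have IM: "integrable M (\<lambda>z. indicator ?B z * \<bar>indicator N z :: real\<bar>)" by (intro mass_integrable IN) auto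
  have "\<bar>2 * a\<bar> \<le> (\<integral>z. 16 * C * (\<eta> * indicator ?B z + indicator ?B z * \<bar>indicator N z\<bar>) \<partial>M)"
    unfolding eq
  proof (rule abs_integral_le)
    show "integrable M (\<lambda>z. 16 * C * (\<eta> * indicator ?B z + indicator ?B z * \<bar>indicator N z\<bar>))"
      using IM IB by (intro integrable_mult_right Bochner_Integration.integrable_add)
    fix z
    show "\<bar>?b z * T \<delta> (indicator ?B) z - indicator ?B z * T \<delta> ?b z\<bar>
        \<le> 16 * C * (\<eta> * indicator ?B z + indicator ?B z * \<bar>indicator N z\<bar>)"
    proof (cases "z \<in> ?B")
      case False
      then have "?b z = 0" using R by (intro bump_0) auto
      then show ?thesis using False by simp
    next
      case True
      define A where "A = (if z \<in> N then 1 else \<eta>)"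
      have A: "measure M (ball z r) \<le> A * h r" if "0 < r" "r \<le> 8 * R" for r
        using that growth[of r z] dens[of z r] by (simp add: A_def)
      have R8: "8 * R > 0" using R by simp
      note n = near_integral[OF R8 A]
      have bB: "?b y = indicator ?B y * ?b y" for y
        using R bump_0[OF R, of x y] by (auto simp: indicator_def)
      have "?b z * T \<delta> (indicator ?B) z - indicator ?B z * T \<delta> ?b z
          = (\<integral>y. ?b z * (TK \<delta> z y * indicator ?B y) \<partial>M) - (\<integral>y. TK \<delta> z y * ?b y \<partial>M)"
        using True by (simp add: T_eq)
      also have "\<dots> = (\<integral>y. ?b z * (TK \<delta> z y * indicator ?B y) - TK \<delta> z y * ?b y \<partial>M)"
        using TK_integrable[OF \<delta> IB] TK_integrable[OF \<delta> Ib]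
        by (intro Bochner_Integration.integral_diff[symmetric]) auto
      finally have e: "?b z * T \<delta> (indicator ?B) z - indicator ?B z * T \<delta> ?b z
        = (\<integral>y. ?b z * (TK \<delta> z y * indicator ?B y) - TK \<delta> z y * ?b y \<partial>M)" .
      have "\<bar>?b z * T \<delta> (indicator ?B) z - indicator ?B z * T \<delta> ?b z\<bar> \<le> (\<integral>y. 1 / R * near (8 * R) (dist z y) \<partial>M)"
        unfolding e
      proof (rule abs_integral_le)
        show "integrable M (\<lambda>y. 1 / R * near (8 * R) (dist z y))" using n(1) by (rule integrable_mult_right)
        fix y
        show "\<bar>?b z * (TK \<delta> z y * indicator ?B y) - TK \<delta> z y * ?b y\<bar> \<le> 1 / R * near (8 * R) (dist z y)"
        proof (cases "y \<in> ?B \<and> \<delta> \<le> dist z y")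
          case False
          then have "?b z * (TK \<delta> z y * indicator ?B y) - TK \<delta> z y * ?b y = 0"
            using bB[of y] by (auto simp: TK_def)
          moreover have "0 \<le> 1 / R * near (8 * R) (dist z y)" using near_nonneg R by (intro mult_nonneg_nonneg) auto
          ultimately show ?thesis by (metis abs_zero)
        next
          case y: True
          have d: "dist z y > 0" "z \<noteq> y" using y \<delta> by auto
          have "dist z y \<le> dist x z + dist x y" using dist_triangle[of z y x] by (simp add: dist_commute)
          then have d8: "dist z y < 8 * R" using y True by simp
          have "\<bar>?b z * (TK \<delta> z y * indicator ?B y) - TK \<delta> z y * ?b y\<bar> = \<bar>K z y\<bar> * \<bar>?b z - ?b y\<bar>"
            using y by (simp add: TK_def abs_mult[symmetric] algebra_simps)
          also have "\<dots> \<le> 1 / h (dist z y) * (dist z y / R)"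
            using K_size[OF d(2)] bump_lip[OF R, of x z y] h_pos[OF d(1)] by (intro mult_mono) auto
          also have "\<dots> = 1 / R * near (8 * R) (dist z y)" using d d8 by (simp add: near_def)
          finally show ?thesis .
        qed
      qed
      also have "\<dots> = 1 / R * (\<integral>y. near (8 * R) (dist z y) \<partial>M)" by simp
      also have "\<dots> \<le> 1 / R * (2 * (C * A * (8 * R)))" using n(2) R by (intro mult_left_mono) auto
      also have "\<dots> = 16 * C * A" using R by simp
      also have "\<dots> \<le> 16 * C * (\<eta> * indicator ?B z + indicator ?B z * \<bar>indicator N z\<bar>)"
        using True \<eta> C_ge_1 by (auto simp: A_def)
      finally show ?thesis .
    qed
  qed
  also have "\<dots> = 16 * C * (\<eta> * measure M ?B + mass (indicator N) x (4 * R))"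
    using IM IB by (simp add: mass_def)
  finally show ?thesis unfolding a_def[symmetric] by simp
qed

text \<open>Split 1 at \<open>ball x (4 * R)\<close>. On the support of the bump the outer part is
  nearly the constant \<open>T1 (4 * R) x\<close>, with error 5; the inner part contributes
  \<open>16 = 8 * 2\<close>, one half from density and one from \<open>N\<close>. Doubling at
  \<open>R\<close> converts the measures into the mass of the bump. The estimate is uniform in the
  truncation and so passes to \<open>pairing\<close>.\<close>

lemma bump_test:
  assumes \<eta>: "\<eta> > 0" and s: "s > 0" and N: "N \<in> sets M"
    and dens: "\<And>z r. z \<notin> N \<Longrightarrow> 0 < r \<Longrightarrow> r \<le> s \<Longrightarrow> measure M (ball z r) \<le> \<eta> * h r"
    and x: "x \<notin> N" "\<And>r. 0 < r \<Longrightarrow> mass (indicator N) x r \<le> \<eta> * measure M (ball x (3 * r))"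
    and R: "R > 0" "8 * R \<le> s" "R \<le> \<eta> * s" "doubling_at x R"
  shows "\<bar>pairing (bump x R) - (\<integral>z. bump x R z \<partial>M) * T1 (4 * R) x\<bar> \<le> 21 * C * dbl * \<eta> * (\<integral>z. bump x R z \<partial>M)"
proof -
  let ?B = "ball x (4 * R)" and ?b = "bump x R"
  define m where "m = (\<integral>z. ?b z \<partial>M)"
  have bl: "bounded_lipschitz ?b" by (rule bounded_lipschitz_bump[OF R(1)])
  have Ib: "integrable M ?b" by (rule lipschitz_integrable[OF bl])
  have m0: "m \<ge> 0" unfolding m_def using bump_bounds by (intro integral_nonneg_AE) auto
  have IB: "integrable M (indicator ?B :: 'a \<Rightarrow> real)" "integrable M (\<lambda>y. indicator (- ?B) y * 1 :: real)"
    by (auto intro!: indicator_mult_integrable simp: emeasure_eq_measure less_top[symmetric])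
  \<comment> \<open>At a doubling scale the mass of the bump pays for all balls about
    \<open>x\<close> up to radius \<open>32 * R\<close>.\<close>
  have big: "measure M (ball x r) \<le> dbl * m" if "r \<le> 32 * R" for r
  proof -
    have "measure M (ball x r) \<le> measure M (ball x (32 * R))"
      using that by (intro finite_measure_mono subset_ball) auto
    also have "\<dots> \<le> dbl * measure M (ball x R)" using R(4) by (simp add: doubling_at_def)
    also have "\<dots> \<le> dbl * m" unfolding m_def using bump_mass[OF R(1)] dbl_ge by (intro mult_left_mono) auto
    finally show ?thesis .
  qed
  have est: "\<bar>(\<integral>z. ?b z * T1 \<delta> z \<partial>M) - m * T1 (4 * R) x\<bar> \<le> 21 * C * dbl * \<eta> * m" if \<delta>: "0 < \<delta>" "\<delta> \<le> R" for \<delta>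
  proof -
    let ?f = "\<lambda>y. indicator (- ?B) y * 1 :: real"
    have T1s: "T1 \<delta> z = T \<delta> ?f z + T \<delta> (indicator ?B) z" for z
    proof -
      have one: "(\<lambda>_. 1) = (\<lambda>y. ?f y + indicator ?B y)" by (rule ext) (simp add: indicator_def)
      show ?thesis unfolding one by (rule T_add[OF \<delta>(1) IB(2) IB(1)])
    qed
    have If: "integrable M (\<lambda>z. ?b z * T \<delta> ?f z)" by (rule T_mult_integrable[OF \<delta>(1) IB(2) Ib])
    have IBT: "integrable M (\<lambda>z. ?b z * T \<delta> (indicator ?B) z)" by (rule T_mult_integrable[OF \<delta>(1) IB(1) Ib])
    have sp: "(\<integral>z. ?b z * T1 \<delta> z \<partial>M) = (\<integral>z. ?b z * T \<delta> ?f z \<partial>M) + (\<integral>z. ?b z * T \<delta> (indicator ?B) z \<partial>M)"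
      unfolding T1s distrib_left using If IBT by (rule Bochner_Integration.integral_add)
    have eq: "(\<integral>z. ?b z * T \<delta> ?f z \<partial>M) - m * T1 (4 * R) x = (\<integral>z. ?b z * T \<delta> ?f z - ?b z * T1 (4 * R) x \<partial>M)"
      using If Ib by (simp add: m_def)
    have "\<bar>(\<integral>z. ?b z * T \<delta> ?f z \<partial>M) - m * T1 (4 * R) x\<bar> \<le> (\<integral>z. ?b z * (5 * C * \<eta>) \<partial>M)"
      unfolding eq
    proof (rule abs_integral_le)
      fix z
      show "\<bar>?b z * T \<delta> ?f z - ?b z * T1 (4 * R) x\<bar> \<le> ?b z * (5 * C * \<eta>)"
      proof (cases "dist x z < 2 * R")
        case True
        have "\<bar>T1 (4 * R) x - T \<delta> ?f z\<bar> \<le> 5 * C * \<eta>"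
          by (rule T1_far_part[OF \<eta> s dens[OF x(1)] R(1,2,3) \<delta> True])
        then have "?b z * \<bar>T \<delta> ?f z - T1 (4 * R) x\<bar> \<le> ?b z * (5 * C * \<eta>)"
          by (intro mult_left_mono bump_bounds) (simp only: abs_minus_commute)
        moreover have "\<bar>?b z * T \<delta> ?f z - ?b z * T1 (4 * R) x\<bar> = ?b z * \<bar>T \<delta> ?f z - T1 (4 * R) x\<bar>"
          using bump_bounds(1)[of x R z] by (simp only: right_diff_distrib[symmetric] abs_mult abs_of_nonneg)
        ultimately show ?thesis by simp
      next
        case False
        then show ?thesis using R(1) by (simp add: bump_0)
      qed
    qed (use Ib in auto)
    also have "\<dots> = 5 * C * \<eta> * m" by (simp add: m_def)
    finally have 1: "\<bar>(\<integral>z. ?b z * T \<delta> ?f z \<partial>M) - m * T1 (4 * R) x\<bar> \<le> 5 * C * \<eta> * m" .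
    have "\<bar>\<integral>z. ?b z * T \<delta> (indicator ?B) z \<partial>M\<bar> \<le> 8 * C * (\<eta> * measure M ?B + mass (indicator N) x (4 * R))"
      using R by (intro bump_near_part[OF \<eta> N R(1) \<delta>(1)] dens) auto
    also have "\<dots> \<le> 8 * C * (\<eta> * (dbl * m) + \<eta> * (dbl * m))"
    proof -
      have "mass (indicator N) x (4 * R) \<le> \<eta> * measure M (ball x (3 * (4 * R)))" using R by (intro x) auto
      also have "\<dots> \<le> \<eta> * (dbl * m)" using \<eta> R by (intro mult_left_mono big) auto
      finally show ?thesis using \<eta> R C_ge_1 by (intro mult_left_mono add_mono big) auto
    qed
    finally have 2: "\<bar>\<integral>z. ?b z * T \<delta> (indicator ?B) z \<partial>M\<bar> \<le> 16 * C * dbl * \<eta> * m" by (simp add: algebra_simps)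
    have "5 * C * \<eta> * m * 1 \<le> 5 * C * \<eta> * m * dbl"
      using \<eta> m0 C_ge_1 dbl_ge by (intro mult_left_mono) auto
    then have "5 * C * \<eta> * m \<le> 5 * C * dbl * \<eta> * m" by (simp add: mult_ac)
    then have "\<bar>(\<integral>z. ?b z * T1 \<delta> z \<partial>M) - m * T1 (4 * R) x\<bar> \<le> 5 * C * dbl * \<eta> * m + 16 * C * dbl * \<eta> * m"
      unfolding sp using 1 2 by linarith
    then show ?thesis by (simp add: algebra_simps)
  qed
  have "\<bar>pairing ?b - m * T1 (4 * R) x\<bar> \<le> 21 * C * dbl * \<eta> * m"
  proof (rule tendsto_upperbound)
    show "((\<lambda>\<delta>. \<bar>(\<integral>z. ?b z * T1 \<delta> z \<partial>M) - m * T1 (4 * R) x\<bar>) \<longlongrightarrow> \<bar>pairing ?b - m * T1 (4 * R) x\<bar>) (at_right 0)"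
      by (intro tendsto_intros pairing_tendsto bl)
    show "\<forall>\<^sub>F \<delta> in at_right 0. \<bar>(\<integral>z. ?b z * T1 \<delta> z \<partial>M) - m * T1 (4 * R) x\<bar> \<le> 21 * C * dbl * \<eta> * m"
      unfolding eventually_at_right_field using R(1) est by (intro exI[of _ R]) auto
  qed simp
  then show ?thesis by (simp add: m_def)
qed

lemma T1_step:
  assumes \<eta>: "\<eta> > 0" and c: "0 < c" "c \<le> b" "b \<le> 32 * c" and m: "measure M (ball x b) \<le> \<eta> * h b"
  shows "\<bar>T1 c x - T1 b x\<bar> \<le> C ^ 15 * \<eta>"
proof -
  have hc: "h c > 0" using c(1) by (rule h_pos)
  have "\<bar>T1 c x - T1 b x\<bar> \<le> mass (\<lambda>_. 1) x b / h c" using c by (intro T_cut_diff) auto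
  also have "\<dots> \<le> \<eta> * (C ^ 5 * h c) / h c"
  proof (rule divide_right_mono)
    have "mass (\<lambda>_. 1) x b \<le> \<eta> * h b" using m by simp
    also have "\<dots> \<le> \<eta> * h (32 * c)" using \<eta> c by (intro mult_left_mono h_mono) auto
    also have "\<dots> \<le> \<eta> * (C ^ 5 * h c)" using h_32[OF c(1)] \<eta> by (intro mult_left_mono) auto
    finally show "mass (\<lambda>_. 1) x b \<le> \<eta> * (C ^ 5 * h c)" .
  qed (use hc in simp)
  also have "\<dots> = C ^ 5 * \<eta>" using hc by simp
  also have "\<dots> \<le> C ^ 15 * \<eta>" using C_ge_1 \<eta> by (intro mult_right_mono power_increasing) auto
  finally show ?thesis .
qed

text \<open>For the constant function the chain estimate ends with the measure of a ball of radius
  \<open>32 * c\<close> over \<open>h c\<close>, at most \<open>C^5 * \<eta>\<close> by density;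
  this is why \<open>32 * b\<close> must stay below \<open>s\<close>. The last, incomplete step from
  \<open>c\<close> to \<open>b\<close> costs a further \<open>C^15 * \<eta>\<close>.\<close>

lemma T1_nondoubling_osc:
  assumes \<eta>: "\<eta> > 0" and x: "\<And>r. 0 < r \<Longrightarrow> r \<le> s \<Longrightarrow> measure M (ball x r) \<le> \<eta> * h r"
    and ab: "0 < a" "a \<le> b" "32 * b \<le> s"
    and nd: "\<And>j. 32 ^ j * a < b \<Longrightarrow> \<not> doubling_at x (32 ^ j * a)"
  shows "\<bar>T1 a x - T1 b x\<bar> \<le> 4 * C ^ 15 * \<eta>"
proof -
  obtain n where "b / a < 32 ^ n" using real_arch_pow[of 32 "b / a"] by auto
  then have ex: "b < 32 ^ n * a" using ab by (simp add: field_simps)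
  define m where "m = (LEAST n. b < 32 ^ n * a)"
  have m: "b < 32 ^ m * a" unfolding m_def using ex by (rule LeastI)
  have "m \<noteq> 0" using m ab by (cases m) auto
  then obtain k where k: "m = Suc k" by (cases m) auto
  have "\<not> b < 32 ^ k * a"
    using not_less_Least[of k "\<lambda>n. b < 32 ^ n * a"] k m_def by auto
  then have kb: "32 ^ k * a \<le> b" by simp
  define c where "c = 32 ^ k * a"
  have c: "c > 0" "c \<le> b" "b < 32 * c" using ab kb m k by (auto simp: c_def)
  have hc: "h c > 0" using c by (intro h_pos)
  have "\<bar>T1 a x - T1 c x\<bar> \<le> 1 * (3 * C ^ 10 * measure M (ball x (32 * c))) / h c"
    unfolding c_def
  proof (rule T_nondoubling_chain')
    show "mass (\<lambda>_. 1) x r \<le> 1 * measure M (ball x (32 * r))" if "r > 0" for r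
      using that by (auto intro!: finite_measure_mono subset_ball)
    fix j assume "j < k"
    then have "(32 :: real) ^ j < 32 ^ k" by (intro power_strict_increasing) auto
    then have "32 ^ j * a < 32 ^ k * a" using ab by simp
    then have "32 ^ j * a < b" using kb by linarith
    then show "dbl * measure M (ball x (32 ^ j * a)) \<le> measure M (ball x (32 * (32 ^ j * a)))"
      using nd[of j] by (simp add: doubling_at_def)
  qed (use ab in auto)
  also have "\<dots> \<le> 3 * C ^ 10 * (\<eta> * (C ^ 5 * h c)) / h c"
  proof -
    have "measure M (ball x (32 * c)) \<le> \<eta> * h (32 * c)" using c ab by (intro x) auto
    also have "\<dots> \<le> \<eta> * (C ^ 5 * h c)" using h_32[OF c(1)] \<eta> by (intro mult_left_mono) auto
    finally show ?thesis using hc C_ge_1 unfolding mult_1_left by (intro divide_right_mono mult_left_mono) auto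
  qed
  also have "\<dots> = 3 * C ^ 15 * \<eta>" using hc by (simp add: power_add[symmetric] flip: mult.assoc)
  finally have 1: "\<bar>T1 a x - T1 c x\<bar> \<le> 3 * C ^ 15 * \<eta>" .
  have "\<bar>T1 c x - T1 b x\<bar> \<le> C ^ 15 * \<eta>" using c ab \<eta> x[of b] by (intro T1_step) auto
  then show ?thesis using 1 by linarith
qed

text \<open>Division of \<open>bump_test\<close> by the mass of the bump, which is positive at
  points of the support: \<open>T1 (4 * R) x\<close> is close to the bump average of the limit
  functional, that is close to the bump average of \<open>g\<close>, and this is close to
  \<open>g x\<close>.\<close>

lemma T1_at_doubling_scales:
  assumes \<eta>: "\<eta> > 0" and s: "s > 0" and N: "N \<in> sets M"
    and dens: "\<And>z r. z \<notin> N \<Longrightarrow> 0 < r \<Longrightarrow> r \<le> s \<Longrightarrow> measure M (ball z r) \<le> \<eta> * h r"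
    and x: "x \<notin> N" "\<And>r. 0 < r \<Longrightarrow> mass (indicator N) x r \<le> \<eta> * measure M (ball x (3 * r))"
      "\<And>r. 0 < r \<Longrightarrow> measure M (ball x r) > 0"
    and g: "bounded_lipschitz g"
    and fm: "\<And>R. R > 0 \<Longrightarrow> doubling_at x R \<Longrightarrow>
      \<bar>pairing (bump x R) - (\<integral>z. g z * bump x R z \<partial>M)\<bar> \<le> \<eta> * (\<integral>z. bump x R z \<partial>M)"
  shows "\<exists>R0>0. \<forall>R. 0 < R \<and> R < R0 \<and> doubling_at x R \<longrightarrow> \<bar>T1 R x - g x\<bar> \<le> (21 * C * dbl + 2 + C ^ 15) * \<eta>"
proof -
  obtain L where L: "L \<ge> 0" "\<And>x. \<bar>g x\<bar> \<le> L" "\<And>x y. \<bar>g x - g y\<bar> \<le> L * dist x y"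
    using bounded_lipschitzE[OF g] by metis
  \<comment> \<open>The first two bounds are what \<open>bump_test\<close> requires; the third keeps
    \<open>g\<close> within \<eta> of \<open>g x\<close> on the support of the bump.\<close>
  define R0 where "R0 = min (s / 8) (min (\<eta> * s) (\<eta> / (2 * L + 1)))"
  have R0: "R0 > 0" using s \<eta> L(1) by (simp add: R0_def)
  have "\<bar>T1 R x - g x\<bar> \<le> (21 * C * dbl + 2 + C ^ 15) * \<eta>" if R: "0 < R" "R < R0" "doubling_at x R" for R
  proof -
    have R8: "8 * R \<le> s" "R \<le> \<eta> * s" "R \<le> \<eta> / (2 * L + 1)" using R by (auto simp: R0_def)
    let ?b = "bump x R"
    define m where "m = (\<integral>z. ?b z \<partial>M)"
    have m: "m > 0" using bump_mass[OF R(1), of x] x(3)[OF R(1)] by (simp add: m_def)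
    have bl: "bounded_lipschitz ?b" by (rule bounded_lipschitz_bump[OF R(1)])
    have Ib: "integrable M ?b" by (rule lipschitz_integrable[OF bl])
    have 1: "\<bar>pairing ?b - m * T1 (4 * R) x\<bar> \<le> 21 * C * dbl * \<eta> * m"
      unfolding m_def by (rule bump_test[OF \<eta> s N dens x(1,2) R(1) R8(1,2) R(3)])
    have 2: "\<bar>pairing ?b - (\<integral>z. g z * ?b z \<partial>M)\<bar> \<le> \<eta> * m" unfolding m_def by (rule fm[OF R(1,3)])
    have Igb: "integrable M (\<lambda>z. g z * ?b z)" by (rule lipschitz_mult_integrable[OF g Ib])
    have eq: "(\<integral>z. g z * ?b z \<partial>M) - g x * m = (\<integral>z. g z * ?b z - g x * ?b z \<partial>M)"
      unfolding m_def using Igb Ib by simp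
    have "\<bar>(\<integral>z. g z * ?b z \<partial>M) - g x * m\<bar> \<le> (\<integral>z. \<eta> * ?b z \<partial>M)"
      unfolding eq
    proof (rule abs_integral_le)
      fix z
      show "\<bar>g z * ?b z - g x * ?b z\<bar> \<le> \<eta> * ?b z"
      proof (cases "dist x z < 2 * R")
        case True
        have "\<bar>g z - g x\<bar> \<le> L * dist x z" using L(3)[of z x] by (simp add: dist_commute)
        also have "\<dots> \<le> L * (2 * R)" using True L(1) by (intro mult_left_mono) auto
        also have "\<dots> \<le> \<eta>"
        proof -
          have "R * (2 * L + 1) \<le> \<eta>" using R8(3) L(1) by (simp add: field_simps)
          then show ?thesis using R(1) by (simp add: algebra_simps)
        qed
        finally have "\<bar>g z - g x\<bar> * ?b z \<le> \<eta> * ?b z" using bump_bounds by (intro mult_right_mono) auto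
        then show ?thesis using bump_bounds(1)[of x R z] by (simp add: abs_mult flip: left_diff_distrib)
      next
        case False
        then show ?thesis using R(1) by (simp add: bump_0)
      qed
    qed (use Ib in auto)
    also have "\<dots> = \<eta> * m" by (simp add: m_def)
    finally have 3: "\<bar>(\<integral>z. g z * ?b z \<partial>M) - g x * m\<bar> \<le> \<eta> * m" .
    have "m * \<bar>T1 (4 * R) x - g x\<bar> = \<bar>m * T1 (4 * R) x - g x * m\<bar>"
    proof -
      have "m * T1 (4 * R) x - g x * m = m * (T1 (4 * R) x - g x)" by (simp add: algebra_simps)
      then show ?thesis using m by (simp add: abs_mult)
    qed
    also have "\<dots> \<le> 21 * C * dbl * \<eta> * m + \<eta> * m + \<eta> * m" using 1 2 3 by linarith
    also have "\<dots> = m * ((21 * C * dbl + 2) * \<eta>)" by (simp add: algebra_simps)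
    finally have 4: "\<bar>T1 (4 * R) x - g x\<bar> \<le> (21 * C * dbl + 2) * \<eta>" using m by simp
    have "\<bar>T1 R x - T1 (4 * R) x\<bar> \<le> C ^ 15 * \<eta>"
      using R(1) R8(1) dens[OF x(1), of "4 * R"] by (intro T1_step \<eta>) auto
    then have "\<bar>T1 R x - g x\<bar> \<le> C ^ 15 * \<eta> + (21 * C * dbl + 2) * \<eta>" using 4 by linarith
    then show ?thesis by (simp add: algebra_simps)
  qed
  then show ?thesis using R0 by blast
qed

text \<open>The error \<open>21 * C * dbl + 2 + C^15\<close> at a doubling scale, plus
  \<open>5 * C^15\<close> for leaving it: one step by a factor of at most 32 and one chain of
  non-doubling scales.\<close>

definition osc_const :: real where "osc_const = 21 * C * dbl + 2 + 6 * C ^ 15"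

text \<open>If there are arbitrarily small doubling scales at \<open>x\<close>, all small truncations are compared
  with those at doubling scales; otherwise the kernel is absolutely integrable near \<open>x\<close>.\<close>

lemma good_point_osc:
  assumes \<eta>: "\<eta> > 0" and s: "s > 0" and N: "N \<in> sets M"
    and dens: "\<And>z r. z \<notin> N \<Longrightarrow> 0 < r \<Longrightarrow> r \<le> s \<Longrightarrow> measure M (ball z r) \<le> \<eta> * h r"
    and x: "x \<notin> N" "\<And>r. 0 < r \<Longrightarrow> mass (indicator N) x r \<le> \<eta> * measure M (ball x (3 * r))"
      "\<And>r. 0 < r \<Longrightarrow> measure M (ball x r) > 0"
    and g: "bounded_lipschitz g"
    and fm: "\<And>R. R > 0 \<Longrightarrow> doubling_at x R \<Longrightarrow>
      \<bar>pairing (bump x R) - (\<integral>z. g z * bump x R z \<partial>M)\<bar> \<le> \<eta> * (\<integral>z. bump x R z \<partial>M)"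
  shows "\<exists>d>0. \<forall>a b. 0 < a \<and> a < d \<and> 0 < b \<and> b < d \<longrightarrow> \<bar>T1 a x - T1 b x\<bar> \<le> 2 * osc_const * \<eta>"
proof -
  obtain R0 where R0: "R0 > 0"
    "\<And>R. 0 < R \<Longrightarrow> R < R0 \<Longrightarrow> doubling_at x R \<Longrightarrow> \<bar>T1 R x - g x\<bar> \<le> (21 * C * dbl + 2 + C ^ 15) * \<eta>"
    using T1_at_doubling_scales[OF \<eta> s N dens x g fm] by blast
  define d where "d = min R0 (s / 32)"
  have d: "d > 0" using R0(1) s by (simp add: d_def)
  have dx: "measure M (ball x r) \<le> \<eta> * h r" if "0 < r" "r \<le> s" for r using dens[OF x(1) that] .
  have C15: "1 \<le> C ^ 15" using C_ge_1 by simp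
  show ?thesis
  proof (cases "\<forall>r>0. \<exists>R. 0 < R \<and> R < r \<and> doubling_at x R")
    case True
    have "\<bar>T1 \<epsilon> x - g x\<bar> \<le> osc_const * \<eta>" if \<epsilon>: "0 < \<epsilon>" "\<epsilon> < d" for \<epsilon>
    proof -
      obtain R' where R': "0 < R'" "R' < \<epsilon>" "doubling_at x R'" using True \<epsilon> by blast
      define P where "P k \<longleftrightarrow> doubling_at x (32 ^ k * R') \<and> 32 ^ k * R' \<le> \<epsilon>" for k :: nat
      have P0: "P 0" using R' by (simp add: P_def)
      obtain n where n: "\<epsilon> / R' < 32 ^ n" using real_arch_pow[of 32 "\<epsilon> / R'"] by auto
      have bound: "k \<le> n" if "P k" for k
      proof (rule ccontr)
        assume "\<not> k \<le> n"
        then have "(32::real) ^ n \<le> 32 ^ k" by (intro power_increasing) auto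
        also have "\<dots> \<le> \<epsilon> / R'" using that R' by (simp add: P_def field_simps)
        finally show False using n by simp
      qed
      \<comment> \<open>The last doubling scale of the sequence \<open>32^k * R'\<close> not
        exceeding \<epsilon>; all later ones up to \<epsilon> are non-doubling, so the chain
        estimate bridges the rest.\<close>
      define k where "k = (GREATEST k. P k)"
      have Pk: "P k" unfolding k_def using P0 bound by (rule GreatestI_nat[where b=n]) auto
      have k_max: "j \<le> k" if "P j" for j
        unfolding k_def using that bound by (rule Greatest_le_nat[where b=n]) auto
      define R where "R = 32 ^ k * R'"
      have R: "0 < R" "R \<le> \<epsilon>" "doubling_at x R" using Pk R' by (auto simp: P_def R_def)
      have TR: "\<bar>T1 R x - g x\<bar> \<le> (21 * C * dbl + 2 + C ^ 15) * \<eta>"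
        using R \<epsilon> by (intro R0(2)) (auto simp: d_def)
      have step: "\<bar>T1 R x - T1 b x\<bar> \<le> C ^ 15 * \<eta>" if b: "R \<le> b" "b \<le> 32 * R" "b \<le> s" for b
        using R b dx[of b] by (intro T1_step \<eta>) auto
      have \<epsilon>s: "32 * \<epsilon> \<le> s" using \<epsilon> by (simp add: d_def)
      have "\<bar>T1 R x - T1 \<epsilon> x\<bar> \<le> 5 * C ^ 15 * \<eta>"
      proof (cases "32 * R \<le> \<epsilon>")
        case True
        have "\<bar>T1 (32 * R) x - T1 \<epsilon> x\<bar> \<le> 4 * C ^ 15 * \<eta>"
        proof (rule T1_nondoubling_osc[OF \<eta> dx])
          fix j assume j: "32 ^ j * (32 * R) < \<epsilon>"
          show "\<not> doubling_at x (32 ^ j * (32 * R))"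
          proof
            assume "doubling_at x (32 ^ j * (32 * R))"
            moreover have "32 ^ j * (32 * R) = 32 ^ (j + 1 + k) * R'" by (simp add: R_def power_add)
            ultimately have "P (j + 1 + k)" using j by (simp add: P_def)
            then show False using k_max[of "j + 1 + k"] by simp
          qed
        qed (use R True \<epsilon>s in auto)
        moreover have "\<bar>T1 R x - T1 (32 * R) x\<bar> \<le> C ^ 15 * \<eta>" using True \<epsilon>s R \<epsilon> by (intro step) auto
        ultimately show ?thesis by linarith
      next
        case False
        then have "\<bar>T1 R x - T1 \<epsilon> x\<bar> \<le> C ^ 15 * \<eta>" using \<epsilon>s R \<epsilon> by (intro step) auto
        moreover have "0 \<le> C ^ 15 * \<eta>" using C_ge_1 \<eta> by (intro mult_nonneg_nonneg) auto
        ultimately show ?thesis by linarith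
      qed
      then have "\<bar>T1 \<epsilon> x - g x\<bar> \<le> 5 * C ^ 15 * \<eta> + (21 * C * dbl + 2 + C ^ 15) * \<eta>" using TR by linarith
      then show ?thesis by (simp add: osc_const_def algebra_simps)
    qed
    then have "\<bar>T1 a x - T1 b x\<bar> \<le> 2 * osc_const * \<eta>" if "0 < a" "a < d" "0 < b" "b < d" for a b
      using that by (smt (verit) distrib_right)
    then show ?thesis using d by blast
  next
    case False
    then obtain r where r: "r > 0" "\<And>R. 0 < R \<Longrightarrow> R < r \<Longrightarrow> \<not> doubling_at x R" by blast
    have le: "\<bar>T1 a x - T1 b x\<bar> \<le> 2 * osc_const * \<eta>" if "0 < a" "a \<le> b" "b < min d r" for a b
    proof -
      have "\<bar>T1 a x - T1 b x\<bar> \<le> 4 * C ^ 15 * \<eta>"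
        using that by (intro T1_nondoubling_osc[OF \<eta> dx] r(2)) (auto simp: d_def)
      also have "\<dots> \<le> 2 * osc_const * \<eta>"
      proof (intro mult_right_mono)
        have "0 \<le> 21 * C * dbl" using C_ge_1 dbl_ge by (intro mult_nonneg_nonneg) auto
        then show "4 * C ^ 15 \<le> 2 * osc_const" using C15 by (simp add: osc_const_def)
      qed (use \<eta> in simp)
      finally show ?thesis .
    qed
    have "\<bar>T1 a x - T1 b x\<bar> \<le> 2 * osc_const * \<eta>" if "0 < a" "a < min d r" "0 < b" "b < min d r" for a b
    proof (cases "a \<le> b")
      case True then show ?thesis using le that by blast
    next
      case False
      then have "\<bar>T1 b x - T1 a x\<bar> \<le> 2 * osc_const * \<eta>" using le that by simp
      then show ?thesis by (simp only: abs_minus_commute)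
    qed
    moreover have "min d r > 0" using d r(1) by simp
    ultimately show ?thesis by blast
  qed
qed

section \<open>From small oscillation to convergence almost everywhere\<close>

definition osc_le :: "('a \<Rightarrow> real) \<Rightarrow> 'a \<Rightarrow> real \<Rightarrow> bool" where
  "osc_le f x e \<longleftrightarrow> (\<exists>d>0. \<forall>a b. 0 < a \<and> a < d \<and> 0 < b \<and> b < d \<longrightarrow> \<bar>T a f x - T b f x\<bar> \<le> e)"

lemma osc_le_mono: "osc_le f x e \<Longrightarrow> e \<le> e' \<Longrightarrow> osc_le f x e'"
  unfolding osc_le_def by (meson order_trans)

lemma AE_convergent_if_osc:
  assumes "\<And>e. e > 0 \<Longrightarrow> AE x in M. osc_le f x e"
  shows "AE x in M. \<exists>l. ((\<lambda>\<epsilon>. T \<epsilon> f x) \<longlongrightarrow> l) (at_right 0)"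
proof -
  have "AE x in M. \<forall>n. osc_le f x (inverse (real (Suc n)))"
    unfolding AE_all_countable using assms by simp
  then show ?thesis
  proof eventually_elim
    case (elim x)
    show ?case
    proof (rule convergent_at_right_Cauchy)
      fix e :: real assume "e > 0"
      from reals_Archimedean[OF this] obtain n where "inverse (real (Suc n)) < e" by blast
      then have "osc_le f x e" using elim by (meson less_imp_le osc_le_mono)
      then show "\<exists>d>0. \<forall>a b. 0 < a \<and> a < d \<and> 0 < b \<and> b < d \<longrightarrow> \<bar>T a f x - T b f x\<bar> \<le> e"
        by (simp add: osc_le_def)
    qed
  qed
qed

end

locale principal_value = bounded_singular_kernel +
  assumes density: "AE x in M. ((\<lambda>r. measure M (ball x r) / h r) \<longlongrightarrow> 0) (at_right 0)"
begin

text \<open>Besides the null set outside the support, three sets of measure at most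
  \<open>\<kappa> / 3\<close> are discarded: \<open>N\<close> itself, the points where
  \<open>N\<close> has large relative mass, and the points where some doubling bump detects the
  error of \<open>g\<close>. The remaining points satisfy \<open>good_point_osc\<close>.\<close>

lemma T1_convergent: "AE x in M. \<exists>l. ((\<lambda>\<epsilon>. T1 \<epsilon> x) \<longlongrightarrow> l) (at_right 0)"
proof (rule AE_convergent_if_osc, rule AE_outer_le)
  fix e \<kappa> :: real assume e: "e > 0" and \<kappa>: "\<kappa> > 0"
  have oc: "osc_const > 0" unfolding osc_const_def using C_ge_1 dbl_ge by (intro add_pos_pos mult_pos_pos) auto
  define \<eta> where "\<eta> = e / (2 * osc_const)"
  have \<eta>: "\<eta> > 0" using e oc by (simp add: \<eta>_def)
  \<comment> \<open>The factor \<eta> in the second entry compensates the \<open>1 / \<eta>\<close>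
    of the maximal inequality for the indicator of \<open>N\<close>.\<close>
  have "min (\<kappa> / 3) (\<kappa> / 3 * \<eta>) > 0" using \<kappa> \<eta> by simp
  from exceptional_density_set[OF density \<eta> this] obtain N s where N: "N \<in> sets M"
    "measure M N < min (\<kappa> / 3) (\<kappa> / 3 * \<eta>)" "s > 0"
    "\<And>z r. z \<notin> N \<Longrightarrow> 0 < r \<Longrightarrow> r \<le> s \<Longrightarrow> measure M (ball z r) \<le> \<eta> * h r"
    by metis
  \<comment> \<open>Makes the bound \<open>dbl * (\<gamma> / \<eta>\<^sup>2)\<close> of
    \<open>functional_maximal\<close> equal to \<open>\<kappa> / 3\<close>.\<close>
  define \<gamma> where "\<gamma> = \<kappa> / 3 * \<eta>\<^sup>2 / dbl"
  have \<gamma>: "\<gamma> > 0" using \<kappa> \<eta> dbl_ge by (simp add: \<gamma>_def)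
  obtain g where g: "bounded_lipschitz g"
    "\<And>\<psi>. bounded_lipschitz \<psi> \<Longrightarrow> (pairing \<psi> - (\<integral>x. g x * \<psi> x \<partial>M))\<^sup>2 \<le> \<gamma> * (\<integral>x. (\<psi> x)\<^sup>2 \<partial>M)"
    by (rule pairing_almost_represented[OF \<gamma>]) (rule that)
  define S1 where "S1 = {x. \<exists>r>0. mass (indicator N) x r > \<eta> * measure M (ball x (3 * r))}"
  define S2 where "S2 = {x. \<exists>R>0. doubling_at x R \<and>
      \<eta> * (\<integral>z. bump x R z \<partial>M) < \<bar>pairing (bump x R) - (\<integral>z. g z * bump x R z \<partial>M)\<bar>}"
  define Z where "Z = {x. \<not> (\<forall>r>0. measure M (ball x r) > 0)}"
  have Z: "outer_le M Z 0" using AE_support by (intro outer_le_AE) (auto simp: Z_def)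
  have oN: "outer_le M N (\<kappa> / 3)" using N(1,2) by (intro outer_le_sets) auto
  have o1: "outer_le M S1 (\<kappa> / 3)"
  proof -
    have IN: "integrable M (indicator N :: 'a \<Rightarrow> real)"
      using N(1) by (intro indicator_integrable) auto
    have "outer_le M S1 ((\<integral>y. \<bar>indicator N y :: real\<bar> \<partial>M) / \<eta>)"
      unfolding S1_def by (rule maximal_mass[OF IN \<eta>])
    moreover have "(\<integral>y. \<bar>indicator N y :: real\<bar> \<partial>M) / \<eta> \<le> \<kappa> / 3"
      using N(1,2) \<eta> by (simp add: divide_le_eq)
    ultimately show ?thesis by (rule outer_le_mono[OF _ subset_refl])
  qed
  have o2: "outer_le M S2 (\<kappa> / 3)"
  proof -
    have "outer_le M S2 (dbl * (\<gamma> / \<eta>\<^sup>2))"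
      unfolding S2_def by (rule functional_maximal[OF \<eta> less_imp_le[OF \<gamma>] g])
    moreover have "dbl * (\<gamma> / \<eta>\<^sup>2) \<le> \<kappa> / 3" using \<eta> dbl_ge by (simp add: \<gamma>_def)
    ultimately show ?thesis by (rule outer_le_mono[OF _ subset_refl])
  qed
  have "{x \<in> space M. \<not> osc_le (\<lambda>_. 1) x e} \<subseteq> ((Z \<union> N) \<union> S1) \<union> S2"
  proof (rule subsetI, rule ccontr)
    fix x assume x: "x \<in> {x \<in> space M. \<not> osc_le (\<lambda>_. 1) x e}" and nx: "x \<notin> ((Z \<union> N) \<union> S1) \<union> S2"
    have x1: "x \<notin> N" using nx by blast
    have x2: "mass (indicator N) x r \<le> \<eta> * measure M (ball x (3 * r))" if "0 < r" for r
    proof (rule ccontr)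
      assume "\<not> ?thesis"
      then have "x \<in> S1" unfolding S1_def using that by (auto simp: not_le)
      then show False using nx by blast
    qed
    have x3: "measure M (ball x r) > 0" if "0 < r" for r using nx that by (auto simp: Z_def)
    have x4: "\<bar>pairing (bump x R) - (\<integral>z. g z * bump x R z \<partial>M)\<bar> \<le> \<eta> * (\<integral>z. bump x R z \<partial>M)"
      if "R > 0" "doubling_at x R" for R
    proof (rule ccontr)
      assume "\<not> ?thesis"
      then have "x \<in> S2" unfolding S2_def using that by (auto simp: not_le)
      then show False using nx by blast
    qed
    have "osc_le (\<lambda>_. 1) x (2 * osc_const * \<eta>)"
      unfolding osc_le_def by (rule good_point_osc[OF \<eta> N(3,1,4) x1 x2 x3 g(1) x4])
    moreover have "2 * osc_const * \<eta> = e" using oc by (simp add: \<eta>_def)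
    ultimately show False using x by simp
  qed
  moreover have "0 + \<kappa> / 3 + \<kappa> / 3 + \<kappa> / 3 \<le> \<kappa>" by simp
  ultimately show "outer_le M {x \<in> space M. \<not> osc_le (\<lambda>_. 1) x e} \<kappa>"
    by (rule outer_le_mono[OF outer_le_Un[OF outer_le_Un[OF outer_le_Un[OF Z oN] o1] o2]])
qed

lemma T_lipschitz_convergent:
  assumes \<phi>: "bounded_lipschitz \<phi>"
  shows "AE x in M. \<exists>l. ((\<lambda>\<epsilon>. T \<epsilon> \<phi> x) \<longlongrightarrow> l) (at_right 0)"
proof -
  obtain B where B: "\<And>\<epsilon> x. \<epsilon> > 0 \<Longrightarrow> \<bar>T \<epsilon> \<phi> x - \<phi> x * T1 \<epsilon> x\<bar> \<le> B"
    "\<And>x. \<exists>l. ((\<lambda>\<epsilon>. T \<epsilon> \<phi> x - \<phi> x * T1 \<epsilon> x) \<longlongrightarrow> l) (at_right 0)"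
    by (rule commutator_bound_convergence[OF \<phi>]) (rule that)
  from T1_convergent show ?thesis
  proof eventually_elim
    case (elim x)
    then obtain l l' where "((\<lambda>\<epsilon>. T1 \<epsilon> x) \<longlongrightarrow> l) (at_right 0)"
      "((\<lambda>\<epsilon>. T \<epsilon> \<phi> x - \<phi> x * T1 \<epsilon> x) \<longlongrightarrow> l') (at_right 0)" using B(2) by blast
    then have "((\<lambda>\<epsilon>. (T \<epsilon> \<phi> x - \<phi> x * T1 \<epsilon> x) + \<phi> x * T1 \<epsilon> x) \<longlongrightarrow> l' + \<phi> x * l) (at_right 0)"
      by (intro tendsto_intros)
    then show ?case by auto
  qed
qed

text \<open>Banach's principle: a maximal inequality and convergence on a dense class. The
  oscillation \<open>e\<close> is made of four quarters, one from \<open>f - g\<close> and one from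
  the convergence for \<open>g\<close> at each of the two radii.\<close>

lemma T_convergent:
  assumes f: "integrable M f"
  shows "AE x in M. \<exists>l. ((\<lambda>\<epsilon>. T \<epsilon> f x) \<longlongrightarrow> l) (at_right 0)"
proof (rule AE_convergent_if_osc, rule AE_outer_le)
  fix e \<kappa> :: real assume e: "e > 0" and \<kappa>: "\<kappa> > 0"
  \<comment> \<open>Solves \<open>max_const * (t / (e / 4)) = \<kappa>\<close>, the maximal bound at
    level \<open>e / 4\<close>.\<close>
  define t where "t = \<kappa> * (e / 4) / max_const"
  have t: "t > 0" using e \<kappa> max_const_pos by (simp add: t_def)
  obtain g where g: "bounded_lipschitz g" "(\<integral>x. \<bar>f x - g x\<bar> \<partial>M) < t"
    using bounded_lipschitz_dense_L1[OF finite_measure_axioms sets_M f t] .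
  have Ig: "integrable M g" by (rule lipschitz_integrable[OF g(1)])
  define S1 where "S1 = {x. \<exists>\<epsilon>>0. e / 4 < \<bar>T \<epsilon> (\<lambda>y. f y - g y) x\<bar>}"
  define S2 where "S2 = {x. \<not> (\<exists>l. ((\<lambda>\<epsilon>. T \<epsilon> g x) \<longlongrightarrow> l) (at_right 0))}"
  have o1: "outer_le M S1 \<kappa>"
  proof -
    have o: "outer_le M S1 (max_const * ((\<integral>y. \<bar>f y - g y\<bar> \<partial>M) / (e / 4)))"
      unfolding S1_def using e f Ig by (intro maximal_weak_type) auto
    have "max_const * ((\<integral>y. \<bar>f y - g y\<bar> \<partial>M) / (e / 4)) \<le> max_const * (t / (e / 4))"
      using g(2) e max_const_pos by (intro mult_left_mono divide_right_mono) auto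
    moreover have "max_const * (t / (e / 4)) = \<kappa>" using e max_const_pos by (simp add: t_def)
    ultimately have "max_const * ((\<integral>y. \<bar>f y - g y\<bar> \<partial>M) / (e / 4)) \<le> \<kappa>" by linarith
    with o show ?thesis by (rule outer_le_mono[OF _ subset_refl])
  qed
  have o2: "outer_le M S2 0"
    using T_lipschitz_convergent[OF g(1)] by (intro outer_le_AE) (auto simp: S2_def)
  have "{x \<in> space M. \<not> osc_le f x e} \<subseteq> S1 \<union> S2"
  proof (rule subsetI, rule ccontr)
    fix x assume x: "x \<in> {x \<in> space M. \<not> osc_le f x e}" and nx: "x \<notin> S1 \<union> S2"
    from nx obtain l where l: "((\<lambda>\<epsilon>. T \<epsilon> g x) \<longlongrightarrow> l) (at_right 0)" by (auto simp: S2_def)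
    have "e / 4 > 0" using e by simp
    from tendstoD[OF l this] obtain d where d: "d > 0" "\<And>a. 0 < a \<Longrightarrow> a < d \<Longrightarrow> \<bar>T a g x - l\<bar> < e / 4"
      by (auto simp: eventually_at_right_field dist_real_def)
    have fg: "\<bar>T a f x - T a g x\<bar> \<le> e / 4" if "a > 0" for a
    proof -
      have "\<not> e / 4 < \<bar>T a (\<lambda>y. f y - g y) x\<bar>" using nx that by (auto simp: S1_def)
      then show ?thesis using T_diff[OF that f Ig] by simp
    qed
    have "\<bar>T a f x - T b f x\<bar> \<le> e" if "0 < a" "a < d" "0 < b" "b < d" for a b
      using d(2)[OF that(1,2)] d(2)[OF that(3,4)] fg[OF that(1)] fg[OF that(3)] by linarith
    then have "osc_le f x e" using d(1) by (auto simp: osc_le_def)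
    then show False using x by simp
  qed
  then show "outer_le M {x \<in> space M. \<not> osc_le f x e} \<kappa>"
    by (rule outer_le_mono[OF outer_le_Un[OF o1 o2]]) simp
qed

end

section \<open>Principal values\<close>

context principal_value
begin

text \<open>A limit along a sequence, so that measurability is immediate; wherever the limit over
  all radii exists, it is this value.\<close>

definition pv :: "('a \<Rightarrow> real) \<Rightarrow> 'a \<Rightarrow> real" where
  "pv f x = lim (\<lambda>n. T (inverse (real (Suc n))) f x)"

lemma pv_measurable: "integrable M f \<Longrightarrow> pv f \<in> borel_measurable M"
  unfolding pv_def[abs_def] by (intro borel_measurable_lim_metric T_meas) auto

lemma pv_eq:
  assumes "((\<lambda>\<epsilon>. T \<epsilon> f x) \<longlongrightarrow> l) (at_right 0)"
  shows "pv f x = l"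
  unfolding pv_def by (rule limI) (rule filterlim_compose[OF assms filterlim_inverse_Suc])

lemma T_tendsto_pv:
  assumes "integrable M f"
  shows "AE x in M. ((\<lambda>\<epsilon>. T \<epsilon> f x) \<longlongrightarrow> pv f x) (at_right 0)"
  using T_convergent[OF assms] by eventually_elim (use pv_eq in blast)

lemma L2_integrable:
  assumes "f \<in> L2 M" shows "integrable M f"
proof (rule Bochner_Integration.integrable_bound)
  show "integrable M (\<lambda>x. 1 + (f x)\<^sup>2)" using assms by (auto simp: L2_def)
  show "AE x in M. norm (f x) \<le> norm (1 + (f x)\<^sup>2)"
  proof (intro AE_I2)
    fix x
    have "2 * \<bar>f x\<bar> \<le> 1 + (f x)\<^sup>2" using sum_squares_bound[of 1 "\<bar>f x\<bar>"] by simp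
    then show "norm (f x) \<le> norm (1 + (f x)\<^sup>2)" by simp
  qed
qed (use assms in \<open>auto simp: L2_def\<close>)

lemma L2_mult_integrable:
  assumes "f \<in> L2 M" "g \<in> L2 M" shows "integrable M (\<lambda>x. f x * g x)"
proof (rule Bochner_Integration.integrable_bound)
  show "integrable M (\<lambda>x. (f x)\<^sup>2 + (g x)\<^sup>2)" using assms by (auto simp: L2_def)
  show "AE x in M. norm (f x * g x) \<le> norm ((f x)\<^sup>2 + (g x)\<^sup>2)"
  proof (intro AE_I2)
    fix x
    have "2 * (\<bar>f x\<bar> * \<bar>g x\<bar>) \<le> (f x)\<^sup>2 + (g x)\<^sup>2" using sum_squares_bound[of "\<bar>f x\<bar>" "\<bar>g x\<bar>"] by simp
    moreover have "0 \<le> \<bar>f x\<bar> * \<bar>g x\<bar>" by simp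
    ultimately have "\<bar>f x * g x\<bar> \<le> (f x)\<^sup>2 + (g x)\<^sup>2" unfolding abs_mult by linarith
    then show "norm (f x * g x) \<le> norm ((f x)\<^sup>2 + (g x)\<^sup>2)" by simp
  qed
qed (use assms in \<open>auto simp: L2_def\<close>)

lemma L2_add:
  assumes "f \<in> L2 M" "g \<in> L2 M" shows "(\<lambda>x. f x + g x) \<in> L2 M"
proof -
  have "(\<lambda>x. (f x + g x)\<^sup>2) = (\<lambda>x. (f x)\<^sup>2 + 2 * (f x * g x) + (g x)\<^sup>2)"
    by (auto simp: power2_eq_square algebra_simps fun_eq_iff)
  moreover have "integrable M (\<lambda>x. (f x)\<^sup>2 + 2 * (f x * g x) + (g x)\<^sup>2)"
    using assms L2_mult_integrable[OF assms] by (auto simp: L2_def)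
  ultimately show ?thesis using assms by (auto simp: L2_def)
qed

lemma L2_scale: "f \<in> L2 M \<Longrightarrow> (\<lambda>x. c * f x) \<in> L2 M"
  by (auto simp: L2_def power_mult_distrib)

lemma L2_diff: "f \<in> L2 M \<Longrightarrow> g \<in> L2 M \<Longrightarrow> (\<lambda>x. f x - g x) \<in> L2 M"
  using L2_add[of f "\<lambda>x. (-1) * g x"] L2_scale[of g "-1"] by simp

lemma pv_L2:
  assumes f: "f \<in> L2 M"
  shows "pv f \<in> L2 M" "(\<integral>x. (pv f x)\<^sup>2 \<partial>M) \<le> C0 * (\<integral>x. (f x)\<^sup>2 \<partial>M)"
proof -
  have If: "integrable M f" by (rule L2_integrable[OF f])
  have m: "pv f \<in> borel_measurable M" by (rule pv_measurable[OF If])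
  have le: "AE x in M. ennreal \<bar>pv f x\<bar> \<le> maximal_op M K f x"
    using T_tendsto_pv[OF If]
  proof eventually_elim
    case (elim x)
    have "((\<lambda>\<epsilon>. ennreal \<bar>T \<epsilon> f x\<bar>) \<longlongrightarrow> ennreal \<bar>pv f x\<bar>) (at_right 0)"
      by (intro tendsto_ennrealI tendsto_rabs elim)
    moreover have "\<forall>\<^sub>F \<epsilon> in at_right 0. ennreal \<bar>T \<epsilon> f x\<bar> \<le> maximal_op M K f x"
      unfolding eventually_at_right_field by (intro exI[of _ 1]) (auto intro: T_le_maximal)
    ultimately show ?case by (rule tendsto_upperbound) simp
  qed
  note V = maximal_countable_L2[OF f borel_measurable_abs[OF m] abs_ge_zero le]
  then show "pv f \<in> L2 M" "(\<integral>x. (pv f x)\<^sup>2 \<partial>M) \<le> C0 * (\<integral>x. (f x)\<^sup>2 \<partial>M)"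
    using m by (auto simp: L2_def)
qed

lemma pv_add:
  assumes "integrable M f" "integrable M g"
  shows "AE x in M. pv (\<lambda>y. f y + g y) x = pv f x + pv g x"
  using T_tendsto_pv[OF assms(1)] T_tendsto_pv[OF assms(2)]
proof eventually_elim
  case (elim x)
  have "((\<lambda>\<epsilon>. T \<epsilon> f x + T \<epsilon> g x) \<longlongrightarrow> pv f x + pv g x) (at_right 0)" by (intro tendsto_add elim)
  moreover have "\<forall>\<^sub>F \<epsilon> in at_right 0. T \<epsilon> f x + T \<epsilon> g x = T \<epsilon> (\<lambda>y. f y + g y) x"
    unfolding eventually_at_right_field by (intro exI[of _ 1]) (auto simp: T_add[OF _ assms])
  ultimately have "((\<lambda>\<epsilon>. T \<epsilon> (\<lambda>y. f y + g y) x) \<longlongrightarrow> pv f x + pv g x) (at_right 0)"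
    by (rule Lim_transform_eventually)
  then show ?case by (rule pv_eq)
qed

lemma pv_scale:
  assumes "integrable M f"
  shows "AE x in M. pv (\<lambda>y. c * f y) x = c * pv f x"
  using T_tendsto_pv[OF assms]
proof eventually_elim
  case (elim x)
  have "((\<lambda>\<epsilon>. c * T \<epsilon> f x) \<longlongrightarrow> c * pv f x) (at_right 0)" by (intro tendsto_mult_left elim)
  then have "((\<lambda>\<epsilon>. T \<epsilon> (\<lambda>y. c * f y) x) \<longlongrightarrow> c * pv f x) (at_right 0)" by (simp only: T_scale)
  then show ?case by (rule pv_eq)
qed

text \<open>Along a sequence only countably many truncations occur. Their supremum is measurable and
  lies in L2, being below the maximal operator; times the modulus of \<open>g\<close> it is the
  integrable majorant.\<close>

lemma pv_weak_limit:
  assumes f: "f \<in> L2 M" and g: "g \<in> L2 M"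
  shows "((\<lambda>\<epsilon>. \<integral>x. T \<epsilon> f x * g x \<partial>M) \<longlongrightarrow> (\<integral>x. pv f x * g x \<partial>M)) (at_right 0)"
proof (rule tendsto_at_right_sequentially[of 0 1])
  fix S :: "nat \<Rightarrow> real" assume S: "\<And>n. 0 < S n" "S \<longlonglongrightarrow> 0"
  have If: "integrable M f" by (rule L2_integrable[OF f])
  have fm [measurable]: "f \<in> borel_measurable M" and gm [measurable]: "g \<in> borel_measurable M"
    using f g by (auto simp: L2_def)
  have Tm [measurable]: "T (S n) f \<in> borel_measurable M" for n by (intro T_meas S fm)
  note fl = filterlim_at_right_0_sequence[OF S]
  define F where "F x = (SUP n. ennreal \<bar>T (S n) f x\<bar>)" for x
  have Fm [measurable]: "F \<in> borel_measurable M" unfolding F_def[abs_def] by measurable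
  have Fle: "F x \<le> maximal_op M K f x" for x
    unfolding F_def by (intro SUP_least T_le_maximal S)
  have "(\<integral>\<^sup>+x. (F x)\<^sup>2 \<partial>M) \<le> (\<integral>\<^sup>+x. (maximal_op M K f x)\<^sup>2 \<partial>M)"
    using Fle by (intro nn_integral_mono power_mono) auto
  also have "\<dots> \<le> ennreal (C0 * (\<integral>x. (f x)\<^sup>2 \<partial>M))" by (rule maximal_L2[OF f])
  finally have "(\<integral>\<^sup>+x. (F x)\<^sup>2 \<partial>M) \<noteq> \<infinity>" by (auto simp: top_unique)
  then have "AE x in M. (F x)\<^sup>2 \<noteq> \<infinity>" by (intro nn_integral_PInf_AE) auto
  then have Ffin: "AE x in M. F x < \<infinity>" by eventually_elim (auto simp: less_top power2_eq_square ennreal_mult_eq_top_iff)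
  \<comment> \<open>The supremum as a real function. Where \<open>F\<close> is infinite this yields
    0, which affects only a null set.\<close>
  define V where "V x = enn2real (F x)" for x
  have Vm: "V \<in> borel_measurable M" unfolding V_def[abs_def] by measurable
  have "AE x in M. ennreal (V x) \<le> maximal_op M K f x"
    using Ffin by eventually_elim (use Fle in \<open>auto simp: V_def less_top\<close>)
  then have "integrable M (\<lambda>x. (V x)\<^sup>2)"
    by (intro maximal_countable_L2[OF f Vm]) (auto simp: V_def)
  then have "V \<in> L2 M" using Vm by (simp add: L2_def)
  moreover have "(\<lambda>x. \<bar>g x\<bar>) \<in> L2 M" using g by (auto simp: L2_def)
  ultimately have w: "integrable M (\<lambda>x. V x * \<bar>g x\<bar>)" by (rule L2_mult_integrable)
  show "(\<lambda>n. \<integral>x. T (S n) f x * g x \<partial>M) \<longlonglongrightarrow> (\<integral>x. pv f x * g x \<partial>M)"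
  proof (rule integral_dominated_convergence[OF _ _ w])
    show "(\<lambda>x. pv f x * g x) \<in> borel_measurable M" using pv_measurable[OF If] gm by (intro borel_measurable_times)
    show "AE x in M. (\<lambda>n. T (S n) f x * g x) \<longlonglongrightarrow> pv f x * g x"
      using T_tendsto_pv[OF If]
      by eventually_elim (intro tendsto_mult_right filterlim_compose[OF _ fl])
    show "AE x in M. norm (T (S n) f x * g x) \<le> V x * \<bar>g x\<bar>" for n
      using Ffin
    proof eventually_elim
      case (elim x)
      have "ennreal \<bar>T (S n) f x\<bar> \<le> F x" unfolding F_def by (intro SUP_upper) auto
      then have "ennreal \<bar>T (S n) f x\<bar> \<le> ennreal (V x)" using elim by (simp add: V_def less_top)
      then have "\<bar>T (S n) f x\<bar> \<le> V x" by (simp add: V_def)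
      then show ?case by (simp add: abs_mult mult_right_mono)
    qed
  qed measurable
qed simp

section \<open>Identification with the weak limit and its extension to L1\<close>

lemma pv_is_weak_limit: "is_weak_limit_op M K pv"
  unfolding is_weak_limit_op_def bounded_linear_L2_def
proof (intro conjI ballI allI)
  show "\<exists>B. \<forall>f\<in>L2 M. (\<integral>x. (pv f x)\<^sup>2 \<partial>M) \<le> B * (\<integral>x. (f x)\<^sup>2 \<partial>M)" using pv_L2(2) by blast
qed (auto intro: pv_L2 pv_add pv_scale L2_integrable pv_weak_limit)

text \<open>Both weak limits are tested against the difference \<open>S f - pv f\<close>, which
  leaves the integral of its square.\<close>

lemma weak_limit_unique:
  assumes S: "is_weak_limit_op M K S" and f: "f \<in> L2 M"
  shows "AE x in M. S f x = pv f x"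
proof -
  have Sf: "S f \<in> L2 M" using S f by (auto simp: is_weak_limit_op_def bounded_linear_L2_def)
  define g where "g x = S f x - pv f x" for x
  have g: "g \<in> L2 M" unfolding g_def[abs_def] by (rule L2_diff[OF Sf pv_L2(1)[OF f]])
  have "((\<lambda>\<epsilon>. \<integral>x. T \<epsilon> f x * g x \<partial>M) \<longlongrightarrow> (\<integral>x. S f x * g x \<partial>M)) (at_right 0)"
    using S f g by (auto simp: is_weak_limit_op_def)
  then have "(\<integral>x. S f x * g x \<partial>M) = (\<integral>x. pv f x * g x \<partial>M)"
    by (rule tendsto_unique[OF trivial_limit_at_right_real _ pv_weak_limit[OF f g]])
  moreover have "(\<integral>x. (g x)\<^sup>2 \<partial>M) = (\<integral>x. S f x * g x - pv f x * g x \<partial>M)"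
    by (intro Bochner_Integration.integral_cong) (auto simp: g_def power2_eq_square algebra_simps)
  ultimately have "(\<integral>x. (g x)\<^sup>2 \<partial>M) = 0"
    using L2_mult_integrable[OF Sf g] L2_mult_integrable[OF pv_L2(1)[OF f] g] by simp
  then have "AE x in M. (g x)\<^sup>2 = 0"
    using g by (subst (asm) integral_nonneg_eq_0_iff_AE) (auto simp: L2_def)
  then show ?thesis by eventually_elim (simp add: g_def)
qed

lemma weak_limit_op_is_weak_limit: "is_weak_limit_op M K (weak_limit_op M K)"
  unfolding weak_limit_op_def by (rule someI[where P="is_weak_limit_op M K", OF pv_is_weak_limit])

lemma weak_limit_op_eq: "f \<in> L2 M \<Longrightarrow> AE x in M. weak_limit_op M K f x = pv f x"
  by (rule weak_limit_unique[OF weak_limit_op_is_weak_limit])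

lemma weak_limit_op_L2: "f \<in> L2 M \<Longrightarrow> weak_limit_op M K f \<in> L2 M"
  using weak_limit_op_is_weak_limit unfolding is_weak_limit_op_def bounded_linear_L2_def by blast

text \<open>Off a null set and the set where some truncation of the difference exceeds
  \<open>t / 2\<close>, the limits differ by at most \<open>t / 2\<close>.\<close>

lemma pv_weak_type:
  assumes f: "integrable M f" and g: "integrable M g" and t: "t > 0"
  shows "outer_le M {x. t < \<bar>pv g x - pv f x\<bar>} (max_const * ((\<integral>y. \<bar>g y - f y\<bar> \<partial>M) / (t / 2)))"
proof -
  define S1 where "S1 = {x. \<exists>\<epsilon>>0. t / 2 < \<bar>T \<epsilon> (\<lambda>y. g y - f y) x\<bar>}"
  define Z where "Z = {x. \<not> (((\<lambda>\<epsilon>. T \<epsilon> f x) \<longlongrightarrow> pv f x) (at_right 0) \<and> ((\<lambda>\<epsilon>. T \<epsilon> g x) \<longlongrightarrow> pv g x) (at_right 0))}"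
  have "AE x in M. x \<notin> Z" using T_tendsto_pv[OF f] T_tendsto_pv[OF g] by eventually_elim (simp add: Z_def)
  then have Z: "outer_le M Z 0" by (intro outer_le_AE) auto
  have S1: "outer_le M S1 (max_const * ((\<integral>y. \<bar>g y - f y\<bar> \<partial>M) / (t / 2)))"
    unfolding S1_def using f g t by (intro maximal_weak_type) auto
  have "{x. t < \<bar>pv g x - pv f x\<bar>} \<subseteq> S1 \<union> Z"
  proof (rule subsetI, rule ccontr)
    fix x assume x: "x \<in> {x. t < \<bar>pv g x - pv f x\<bar>}" and nx: "x \<notin> S1 \<union> Z"
    have "((\<lambda>\<epsilon>. \<bar>T \<epsilon> g x - T \<epsilon> f x\<bar>) \<longlongrightarrow> \<bar>pv g x - pv f x\<bar>) (at_right 0)"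
      using nx by (intro tendsto_intros) (auto simp: Z_def)
    moreover have "\<forall>\<^sub>F \<epsilon> in at_right 0. \<bar>T \<epsilon> g x - T \<epsilon> f x\<bar> \<le> t / 2"
      unfolding eventually_at_right_field
    proof (intro exI[of _ 1] conjI allI impI)
      fix \<epsilon> :: real assume \<epsilon>: "0 < \<epsilon>"
      then have "\<not> t / 2 < \<bar>T \<epsilon> (\<lambda>y. g y - f y) x\<bar>" using nx by (auto simp: S1_def)
      then show "\<bar>T \<epsilon> g x - T \<epsilon> f x\<bar> \<le> t / 2" using T_diff[OF \<epsilon> g f] by simp
    qed simp
    ultimately have "\<bar>pv g x - pv f x\<bar> \<le> t / 2" by (rule tendsto_upperbound) simp
    then show False using x t by simp
  qed
  then show ?thesis by (rule outer_le_mono[OF outer_le_Un[OF S1 Z]]) simp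
qed

lemma outer_le_measure: "outer_le M S a \<Longrightarrow> measure M S \<le> a" if "S \<in> sets M"
  using finite_measure_mono unfolding outer_le_def by (meson order_trans)

text \<open>The principal value is defined on all of L1 and agrees almost everywhere with the weak
  limit on L2. Convergence in measure is therefore the weak type bound applied to
  \<open>u k - f\<close>.\<close>

lemma pv_is_L1_extension:
  assumes f: "integrable M f"
  shows "is_L1_extension_value M (weak_limit_op M K) f (pv f)"
  unfolding is_L1_extension_value_def
proof (intro conjI allI impI)
  show "pv f \<in> borel_measurable M" by (rule pv_measurable[OF f])
  fix u :: "nat \<Rightarrow> 'a \<Rightarrow> real"
  assume u: "(\<forall>k. u k \<in> L2 M \<and> integrable M (u k)) \<and> (\<lambda>k. \<integral>x. \<bar>u k x - f x\<bar> \<partial>M) \<longlonglongrightarrow> 0"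
  show "tendsto_in_measure M (\<lambda>k. weak_limit_op M K (u k)) (pv f)"
    unfolding tendsto_in_measure_def
  proof (intro allI impI)
    fix \<delta> :: real assume \<delta>: "\<delta> > 0"
    define B where "B k = max_const * ((\<integral>x. \<bar>u k x - f x\<bar> \<partial>M) / (\<delta> / 2))" for k
    have B: "B \<longlonglongrightarrow> 0"
    proof -
      have "B \<longlonglongrightarrow> max_const * (0 / (\<delta> / 2))"
        unfolding B_def[abs_def] using u \<delta> by (intro tendsto_intros) auto
      then show ?thesis by simp
    qed
    have le: "measure M {x \<in> space M. \<bar>weak_limit_op M K (u k) x - pv f x\<bar> > \<delta>} \<le> B k" for k
    proof (rule outer_le_measure)
      have [measurable]: "weak_limit_op M K (u k) \<in> borel_measurable M" "pv f \<in> borel_measurable M"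
        using weak_limit_op_L2[of "u k"] u pv_measurable[OF f] by (auto simp: L2_def)
      show "{x \<in> space M. \<bar>weak_limit_op M K (u k) x - pv f x\<bar> > \<delta>} \<in> sets M" by measurable
      define Z where "Z = {x. weak_limit_op M K (u k) x \<noteq> pv (u k) x}"
      have "AE x in M. x \<notin> Z" using weak_limit_op_eq[of "u k"] u by (auto simp: Z_def)
      then have Z: "outer_le M Z 0" by (intro outer_le_AE) auto
      have sub: "{x \<in> space M. \<bar>weak_limit_op M K (u k) x - pv f x\<bar> > \<delta>} \<subseteq> {x. \<delta> < \<bar>pv (u k) x - pv f x\<bar>} \<union> Z"
        by (auto simp: Z_def)
      have "outer_le M {x. \<delta> < \<bar>pv (u k) x - pv f x\<bar>} (B k)"
        unfolding B_def using u by (intro pv_weak_type f \<delta>) auto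
      from outer_le_mono[OF outer_le_Un[OF this Z] sub]
      show "outer_le M {x \<in> space M. \<bar>weak_limit_op M K (u k) x - pv f x\<bar> > \<delta>} (B k)" by simp
    qed
    show "(\<lambda>k. measure M {x \<in> space M. \<bar>weak_limit_op M K (u k) x - pv f x\<bar> > \<delta>}) \<longlonglongrightarrow> 0"
      by (rule tendsto_sandwich[OF _ always_eventually[OF allI[OF le]] tendsto_const B]) simp
  qed
qed

lemma L1_extension_unique:
  assumes f: "integrable M f"
    and g: "is_L1_extension_value M S f g" "is_L1_extension_value M S f g'"
    and S: "\<And>u. u \<in> L2 M \<Longrightarrow> S u \<in> borel_measurable M"
  shows "AE x in M. g x = g' x"
proof -
  \<comment> \<open>Cutting off at height \<open>k\<close> gives bounded functions that converge to
    \<open>f\<close> in L1. At least one admissible sequence is needed, for otherwise the defining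
    property of the extension would say nothing about its value.\<close>
  define u where "u k x = max (- real k) (min (real k) (f x))" for k x
  have fm [measurable]: "f \<in> borel_measurable M" using f by auto
  have um: "u k \<in> borel_measurable M" for k unfolding u_def[abs_def] by measurable
  have ub: "\<bar>u k x\<bar> \<le> real k" for k x by (auto simp: u_def)
  have uL2: "u k \<in> L2 M" for k by (rule bounded_in_L2[OF um ub])
  have uI: "integrable M (u k)" for k by (rule bounded_integrable[OF um ub])
  have "(\<lambda>k. \<integral>x. \<bar>u k x - f x\<bar> \<partial>M) \<longlonglongrightarrow> (\<integral>x. 0 \<partial>M)"
  proof (rule integral_dominated_convergence[where w="\<lambda>x. \<bar>f x\<bar>"])
    show "AE x in M. (\<lambda>k. \<bar>u k x - f x\<bar>) \<longlonglongrightarrow> 0"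
    proof (intro AE_I2)
      fix x
      have "\<forall>\<^sub>F k in sequentially. \<bar>f x\<bar> \<le> real k"
        using filterlim_real_sequentially by (simp add: filterlim_at_top)
      then have "\<forall>\<^sub>F k in sequentially. \<bar>u k x - f x\<bar> = 0" by eventually_elim (auto simp: u_def)
      then show "(\<lambda>k. \<bar>u k x - f x\<bar>) \<longlonglongrightarrow> 0" by (rule tendsto_eventually)
    qed
    show "AE x in M. norm \<bar>u k x - f x\<bar> \<le> \<bar>f x\<bar>" for k by (intro AE_I2) (auto simp: u_def)
  qed (use f um in auto)
  then have u0: "(\<lambda>k. \<integral>x. \<bar>u k x - f x\<bar> \<partial>M) \<longlonglongrightarrow> 0" by simp
  have t: "tendsto_in_measure M (\<lambda>k. S (u k)) g" "tendsto_in_measure M (\<lambda>k. S (u k)) g'"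
    using g uL2 uI u0 by (auto simp: is_L1_extension_value_def)
  have gm [measurable]: "g \<in> borel_measurable M" "g' \<in> borel_measurable M"
    using g by (auto simp: is_L1_extension_value_def)
  have Sm [measurable]: "S (u k) \<in> borel_measurable M" for k using S[OF uL2] .
  have "AE x in M. \<bar>g x - g' x\<bar> \<le> 2 * \<delta>" if \<delta>: "\<delta> > 0" for \<delta>
  proof -
    define a where "a k = measure M {x \<in> space M. \<bar>S (u k) x - g x\<bar> > \<delta>}" for k
    define b where "b k = measure M {x \<in> space M. \<bar>S (u k) x - g' x\<bar> > \<delta>}" for k
    have ab: "(\<lambda>k. a k + b k) \<longlonglongrightarrow> 0 + 0"
      using t \<delta> unfolding a_def b_def tendsto_in_measure_def by (intro tendsto_add) auto
    define A where "A = {x \<in> space M. \<bar>g x - g' x\<bar> > 2 * \<delta>}"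
    have Am: "A \<in> sets M" unfolding A_def by measurable
    have "measure M A \<le> a k + b k" for k
    proof -
      have m: "{x \<in> space M. \<bar>S (u k) x - g x\<bar> > \<delta>} \<in> sets M" "{x \<in> space M. \<bar>S (u k) x - g' x\<bar> > \<delta>} \<in> sets M"
        by measurable
      have "A \<subseteq> {x \<in> space M. \<bar>S (u k) x - g x\<bar> > \<delta>} \<union> {x \<in> space M. \<bar>S (u k) x - g' x\<bar> > \<delta>}"
        by (auto simp: A_def)
      then have "measure M A \<le> measure M ({x \<in> space M. \<bar>S (u k) x - g x\<bar> > \<delta>} \<union> {x \<in> space M. \<bar>S (u k) x - g' x\<bar> > \<delta>})"
        by (rule finite_measure_mono) (rule sets.Un[OF m])
      also have "\<dots> \<le> a k + b k" unfolding a_def b_def by (rule measure_Un_le[OF m])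
      finally show ?thesis .
    qed
    then have "measure M A \<le> 0 + 0" by (intro LIMSEQ_le_const[OF ab]) auto
    then have "measure M A = 0" by (simp add: measure_le_0_iff)
    then have "A \<in> null_sets M" using Am by (simp add: null_sets_def emeasure_eq_measure)
    then have "AE x in M. x \<notin> A" by (rule AE_not_in)
    then show ?thesis by eventually_elim (auto simp: A_def not_less)
  qed
  then have "AE x in M. \<forall>n. \<bar>g x - g' x\<bar> \<le> 2 * inverse (real (Suc n))"
    unfolding AE_all_countable by simp
  then show ?thesis
  proof eventually_elim
    case (elim x)
    have "(\<lambda>n. 2 * inverse (real (Suc n))) \<longlonglongrightarrow> 2 * 0" by (intro tendsto_mult_left LIMSEQ_inverse_real_of_nat)
    then have "\<bar>g x - g' x\<bar> \<le> 2 * 0" by (rule LIMSEQ_le_const) (use elim in blast)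
    then show ?case by simp
  qed
qed

lemma singular_integral_op_eq:
  assumes f: "integrable M f"
  shows "AE x in M. singular_integral_op M K f x = pv f x"
proof (rule L1_extension_unique[OF f])
  show "is_L1_extension_value M (weak_limit_op M K) f (singular_integral_op M K f)"
    unfolding singular_integral_op_def
    by (rule someI[where P="is_L1_extension_value M (weak_limit_op M K) f", OF pv_is_L1_extension[OF f]])
  show "is_L1_extension_value M (weak_limit_op M K) f (pv f)" by (rule pv_is_L1_extension[OF f])
qed (use weak_limit_op_L2 in \<open>auto simp: L2_def\<close>)

end

theorem theorem1p6:
  fixes \<mu> :: "'a::{metric_space, second_countable_topology} measure"
    and K :: "'a \<Rightarrow> 'a \<Rightarrow> real"
    and h :: "real \<Rightarrow> real"
    and C :: real
  assumes "finite_measure \<mu>"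
    and "sets \<mu> = sets borel"
    and "vitali_closed_balls \<mu>"
    and "(\<lambda>(x, y). K x y) \<in> borel_measurable (restrict_space borel {(x, y). x \<noteq> y})"
    and "\<And>x y. x \<noteq> y \<Longrightarrow> K x y = - K y x"
    and "\<And>\<delta>. \<delta> > 0 \<Longrightarrow> bounded ((\<lambda>(x, y). K x y) ` {(x, y). dist x y > \<delta>})"
    and "(\<exists>\<phi> :: 'a \<Rightarrow> real ^ 'n. bij \<phi> \<and> (\<forall>x y. dist (\<phi> x) (\<phi> y) = dist x y))
         \<or> doubling_measure \<mu>"
    and "\<And>r. r > 0 \<Longrightarrow> h r > 0"
    and "mono_on {0<..} h"
    and "(h \<longlongrightarrow> 0) (at_right 0)"
    and "\<And>r. r > 0 \<Longrightarrow> h (2 * r) \<le> C * h r"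
    and "\<And>x y. x \<noteq> y \<Longrightarrow> \<bar>K x y\<bar> \<le> 1 / h (dist x y)"
    and "\<And>x y z. x \<noteq> y \<Longrightarrow> z \<noteq> x \<Longrightarrow> dist x y > 2 * dist y z \<Longrightarrow>
           \<bar>K x y - K x z\<bar> \<le> dist y z / (dist x y * h (dist x y))"
    and "\<And>x r. r > 0 \<Longrightarrow> measure \<mu> (ball x r) \<le> h r"
    and "AE x in \<mu>. ((\<lambda>r. measure \<mu> (ball x r) / h r) \<longlongrightarrow> 0) (at_right 0)"
    and "maximal_op_L2_bounded \<mu> K"
  shows "\<forall>f. integrable \<mu> f \<longrightarrow>
           (AE x in \<mu>. ((\<lambda>\<epsilon>. truncated_op \<mu> K \<epsilon> f x) \<longlongrightarrow> singular_integral_op \<mu> K f x) (at_right 0))"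
proof (intro allI impI)
  fix f :: "'a \<Rightarrow> real" assume f: "integrable \<mu> f"
  obtain C\<^sub>0 where C\<^sub>0: "\<And>f. f \<in> L2 \<mu> \<Longrightarrow>
      (\<integral>\<^sup>+x. (maximal_op \<mu> K f x)\<^sup>2 \<partial>\<mu>) \<le> ennreal (C\<^sub>0 * (\<integral>x. (f x)\<^sup>2 \<partial>\<mu>))"
    using assms(16) by (auto simp: maximal_op_L2_bounded_def)
  interpret finite_measure \<mu> by (rule assms(1))
  \<comment> \<open>The hypothesis leaves the sign of the constant open; its modulus is a
    nonnegative constant for which the bound holds too.\<close>
  interpret principal_value \<mu> K h C "\<bar>C\<^sub>0\<bar>"
  proof unfold_locales
    fix f :: "'a \<Rightarrow> real" assume "f \<in> L2 \<mu>"
    note C\<^sub>0[OF this]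
    also have "ennreal (C\<^sub>0 * (\<integral>x. (f x)\<^sup>2 \<partial>\<mu>)) \<le> ennreal (\<bar>C\<^sub>0\<bar> * (\<integral>x. (f x)\<^sup>2 \<partial>\<mu>))"
      by (intro ennreal_leI mult_right_mono integral_nonneg_AE) auto
    finally show "(\<integral>\<^sup>+x. (maximal_op \<mu> K f x)\<^sup>2 \<partial>\<mu>) \<le> ennreal (\<bar>C\<^sub>0\<bar> * (\<integral>x. (f x)\<^sup>2 \<partial>\<mu>))" .
  qed (fact assms abs_ge_zero)+
  show "AE x in \<mu>. ((\<lambda>\<epsilon>. truncated_op \<mu> K \<epsilon> f x) \<longlongrightarrow> singular_integral_op \<mu> K f x) (at_right 0)"
    using T_tendsto_pv[OF f] singular_integral_op_eq[OF f] by eventually_elim simp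
qed

end
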